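(* Let $\alpha>0$, $\beta\in\mathbb{R}$, and let $L(s,\chi)$ denote the Dirichlet $L$-function associated to the Dirichlet character $\chi$. Suppose $(n_q,k_q)_{q\ge1}$ is a Stoltz sequence, and let $k$ be a non-negative integer. Let $s\in\mathbb{C}$ with $\Re(s)>-\frac12$ and $\Re(s)\ne1$. Then: (i) if $\chi$ is non-principal, $$\lim_{q\to\infty}\frac1{k_q}\sum_{j=1}^{k_q}L^{(k)}\bigl(s+iT_{\alpha,\beta}^{n_q+j}(x),\chi\bigr)=\frac{\alpha}{\pi}\int_{\mathbb{R}}\frac{L^{(k)}(s+i\tau,\chi)}{\alpha^2+(\tau-\beta)^2}\,d\tau=L^{(k)}(s+\alpha+i\beta,\chi)$$ for almost all $x\in\mathbb{R}$; (ii) if $\chi$ is principal, $$\lim_{q\to\infty}\frac1{k_q}\sum_{j=1}^{k_q}L^{(k)}\bigl(s+iT_{\alpha,\beta}^{n_q+j}(x),\chi\bigr)=\frac{\alpha}{\pi}\int_{\mathbb{R}}\frac{L^{(k)}(s+i\tau,\chi)}{\alpha^2+(\tau-\beta)^2}\,d\tau$$ for almost all $x\in\mathbb{R}$.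
   Context: $L^{(k)}(\cdot,\chi)$ is the $k$-th derivative in the first variable ($L^{(0)}=L$). "Almost all" is with respect to Lebesgue measure. For $\alpha>0$ and $\beta\in\mathbb{R}$, $T_{\alpha,\beta}:\mathbb{R}\to\mathbb{R}$ is the map $T_{\alpha,\beta}(x)=\frac{\alpha}{2}\left(\frac{x+\beta}{\alpha}-\frac{\alpha}{x-\beta}\right)$ if $x\ne\beta$, and $T_{\alpha,\beta}(\beta)=\beta$; $T_{\alpha,\beta}^{j}$ denotes its $j$-th iterate. It preserves, and is ergodic for, the probability measure $\mu_{\alpha,\beta}(A)=\frac{\alpha}{\pi}\int_A\frac{dt}{\alpha^2+(t-\beta)^2}$. Stoltz sequences. For a set $Z\subseteq\mathbb{Z}\times\mathbb{N}$, put $Z^h=\{(n,k)\in Z:k\ge h\}$, $Z^h_{\alpha}=\{(z,s)\in\mathbb{Z}^2:|z-y|<\alpha(s-r)\text{ for some }(y,r)\in Z^h\}$, and $Z^h_{\alpha}(\lambda)=\{n:(n,\lambda)\in Z^h_{\alpha}\}$ for $\lambda\in\mathbb{N}$. A sequence of pairs of natural numbers $(n_l,k_l)_{l\ge1}$ is Stoltz if there exist a set $Z\subseteq\mathbb{Z}\times\mathbb{N}$ and a function $h=h(t)$ tending to infinity with $t$ such that $(n_l,k_l)\in Z^{h(t)}$ for all $l\ge t$, and there exist $h_0$, $\alpha_0>0$ and $A>0$ such that $|Z^{h_0}_{\alpha_0}(\lambda)|\le A\lambda$ for all integers $\lambda>0$. *)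

theory Defs
  imports "HOL-Complex_Analysis.Complex_Analysis"
begin

definition dirichlet_character :: "nat \<Rightarrow> (int \<Rightarrow> complex) \<Rightarrow> bool" where
  "dirichlet_character m chi \<longleftrightarrow>
     m > 0 \<and>
     (\<forall>a b. chi (a * b) = chi a * chi b) \<and>
     (\<forall>a. chi (a + int m) = chi a) \<and>
     (\<forall>a. chi a \<noteq> 0 \<longleftrightarrow> coprime a (int m))"

definition principal_character :: "nat \<Rightarrow> (int \<Rightarrow> complex)" where
  "principal_character m = (\<lambda>a. if coprime a (int m) then 1 else 0)"

text \<open>
  The meromorphic continuation to the whole plane of the Dirichlet series
  \<open>\<Sum>n\<ge>1. chi(n) n\<^sup>-\<^sup>s\<close>, which converges absolutely for \<open>Re s > 1\<close>. By the identity theorem,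
  at most one function has the property below: a nicely meromorphic function is continuous
  away from its poles and takes the value 0 at them.
\<close>
definition dirichlet_L :: "(int \<Rightarrow> complex) \<Rightarrow> complex \<Rightarrow> complex" where
  "dirichlet_L chi =
     (THE f. f nicely_meromorphic_on UNIV \<and>
             (\<forall>s. Re s > 1 \<longrightarrow>
                f s = (\<Sum>n. chi (int (Suc n)) / of_nat (Suc n) powr s)))"

definition boole_map :: "real \<Rightarrow> real \<Rightarrow> real \<Rightarrow> real" where
  "boole_map \<alpha> \<beta> x =
     (if x = \<beta> then \<beta> else \<alpha> / 2 * ((x + \<beta>) / \<alpha> - \<alpha> / (x - \<beta>)))"

definition height_part :: "(int \<times> nat) set \<Rightarrow> real \<Rightarrow> (int \<times> nat) set" where
  "height_part Z h = {(n, k) \<in> Z. real k \<ge> h}"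

definition cone_set :: "(int \<times> nat) set \<Rightarrow> real \<Rightarrow> real \<Rightarrow> (int \<times> int) set" where
  "cone_set Z h a =
     {(z, s). \<exists>(y, r) \<in> height_part Z h. real_of_int \<bar>z - y\<bar> < a * real_of_int (s - int r)}"

definition cone_section :: "(int \<times> nat) set \<Rightarrow> real \<Rightarrow> real \<Rightarrow> nat \<Rightarrow> int set" where
  "cone_section Z h a lam = {n. (n, int lam) \<in> cone_set Z h a}"

text \<open>
  Sequences are indexed from 1; the values at index 0 play no role. Finiteness of the sections
  is part of the cardinality bound, since \<open>card\<close> is 0 on infinite sets.
\<close>
definition stoltz :: "(nat \<Rightarrow> nat) \<Rightarrow> (nat \<Rightarrow> nat) \<Rightarrow> bool" where
  "stoltz ns ks \<longleftrightarrow>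
     (\<exists>(Z :: (int \<times> nat) set) (h :: nat \<Rightarrow> real).
        filterlim h at_top sequentially \<and>
        (\<forall>t\<ge>1. \<forall>l\<ge>t. (int (ns l), ks l) \<in> height_part Z (h t)) \<and>
        (\<exists>h0 a0 A. a0 > 0 \<and> A > 0 \<and>
           (\<forall>lam>0. finite (cone_section Z h0 a0 lam) \<and>
                   real (card (cone_section Z h0 a0 lam)) \<le> A * real lam)))"

end

theory Submission
  imports Defs "HOL-Probability.Probability" "HOL-Real_Asymp.Real_Asymp"
begin

text \<open>
  The substitution \<open>x = \<beta> + \<alpha> cot (\<pi> u)\<close> carries Lebesgue measure on the unit interval to the Cauchy
  measure and turns the Boole map into the doubling map \<open>u \<mapsto> 2 u mod 1\<close>. The cone condition of a Stoltz
  sequence and a greedy selection of disjoint intervals give a weak-type maximal inequality for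
  the moving averages; together with mixing of the doubling map, this yields almost everywhere
  convergence for every continuous function that is integrable against the Cauchy kernel.

  Integrability needs \<open>L(\<sigma> + i t) = O(\<bar>t\<bar>\<^sup>c)\<close> with some \<open>c < 1\<close> for \<open>\<sigma> > -1/2\<close>. Writing \<open>L\<close> through the shifted
  series \<open>\<Sum> (n + a) powr -s\<close>, the trapezoidal rule reduces this to sums of \<open>(n + a) powr -(i t)\<close>: the Kusmin-Landau
  inequality handles \<open>n \<ge> \<bar>t\<bar>\<close>, the second derivative test handles \<open>n \<le> \<bar>t\<bar>\<close> and saves the factor \<open>\<surd>\<bar>t\<bar>\<close>, and
  no functional equation is used. Cauchy's inequality passes to derivatives. For a non-principal
  character \<open>L\<close> is entire, and the growth bound lets the Cauchy integral over growing rectangles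
  converge to the Poisson formula, which evaluates the integral.
\<close>

section \<open>Exponential sums\<close>

text \<open>The line -1/2 is where two exponents meet. A function is integrable against the Cauchy
  kernel once it grows with an exponent below 1, and the second derivative test with partial
  summation gives \<open>1/2 - \<sigma>\<close> up to a logarithm, which is below 1 exactly for
  \<open>\<sigma> > -1/2\<close>. The trapezoidal remainder contributes only the exponent
  \<open>- \<sigma>\<close>, so it is never the bottleneck. On the ergodic side the obstacle is that
  the windows \<open>n_q + 1, ..., n_q + k_q\<close> move: Birkhoff's theorem concerns initial
  segments and gives no convergence for them. The cone count of a Stoltz sequence enters only
  through the maximal inequality, which reduces the claim to a dense class of functions, here
  bounded continuous functions \<open>p\<close> of the coordinate \<open>u\<close>. Replacing such a
  \<open>p\<close> by a mean \<open>Q\<close> of finitely many of its iterates changes every window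
  sum by a bounded amount, negligible since \<open>k_q\<close> tends to infinity. Mixing makes
  \<open>Q\<close> close to its mean in L1, and the maximal inequality is then applied once more, to
  \<open>Q\<close> minus its mean.\<close>

lemma norm_cis_diff: "norm (cis x - 1) = 2 * \<bar>sin (x / 2)\<bar>"
proof -
  have "(norm (cis x - 1))\<^sup>2 = (cos x - 1)\<^sup>2 + (sin x)\<^sup>2"
    by (simp add: cmod_power2)
  also have "\<dots> = 2 - 2 * cos x"
    using sin_cos_squared_add[of x] by (simp add: power2_eq_square algebra_simps)
  also have "\<dots> = (2 * \<bar>sin (x / 2)\<bar>)\<^sup>2"
    using cos_double_sin[of "x/2"] by (simp add: power_mult_distrib)
  finally show ?thesis
    by (rule power2_eq_imp_eq) auto
qed

text \<open>The real part is the constant -1/2, so the variation of \<open>1 / (cis x - 1)\<close>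
  is that of \<open>cot (x / 2) / 2\<close>, which telescopes for monotone \<open>x\<close>.
  \<open>kusmin_landau\<close> rests on this.\<close>

lemma inverse_cis_minus_1:
  assumes "sin (x / 2) \<noteq> 0"
  shows "1 / (cis x - 1) = Complex (-1/2) (- cot (x / 2) / 2)"
proof -
  define c d where "c = cos (x / 2)" and "d = sin (x / 2)"
  have d: "d \<noteq> 0" and cd: "c * c + d * d = 1"
    using assms sin_cos_squared_add[of "x/2"] by (auto simp: c_def d_def power2_eq_square)
  have x: "cos x = c * c - d * d" "sin x = 2 * d * c"
    using cos_double[of "x/2"] sin_double[of "x/2"] by (auto simp: c_def d_def power2_eq_square)
  have "Complex (-1/2) (- (c/d) / 2) * (cis x - 1) = 1"
    using d cd by (simp add: complex_eq_iff x divide_simps) algebra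
  moreover have "cis x - 1 \<noteq> 0"
    using norm_cis_diff[of x] d by (auto simp: d_def)
  ultimately show ?thesis
    by (simp add: cot_def c_def d_def field_simps)
qed

text \<open>Jordan's inequality: sine is concave on \<open>{0..pi}\<close>, so up to
  \<open>pi / 2\<close> it lies above the chord \<open>2 / pi * y\<close>; beyond that, the
  reflection of \<open>y\<close> to \<open>pi - y\<close> applies.\<close>

lemma sin_half_ge:
  assumes "0 < l" "l \<le> pi" "l \<le> x" "x \<le> 2 * pi - l"
  shows "sin (x / 2) \<ge> l / pi"
proof -
  have *: "sin y \<ge> 2 / pi * y" if "0 \<le> y" "y \<le> pi / 2" for y
  proof -
    have "convex_on {0..pi} (\<lambda>x. - sin x)"
      by (rule f''_ge0_imp_convex[where f' = "\<lambda>x. - cos x" and f'' = "sin"])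
         (auto intro!: derivative_eq_intros sin_ge_zero)
    from convex_onD[OF this, of _ 0 "pi/2"] have "t \<le> sin (t * (pi/2))"
      if "0 \<le> t" "t \<le> 1" for t
      using that by fastforce
    from this[of "2/pi*y"] show ?thesis
      using that by (simp add: field_simps)
  qed
  show ?thesis
  proof (cases "x \<le> pi")
    case True
    have "l / pi \<le> 2 / pi * (x/2)" using assms by (simp add: field_simps)
    also have "\<dots> \<le> sin (x/2)" using assms True by (intro *) auto
    finally show ?thesis .
  next
    case False
    have "l / pi \<le> 2 / pi * (pi - x/2)" using assms by (simp add: field_simps)
    also have "\<dots> \<le> sin (pi - x/2)" using assms False by (intro *) auto
    finally show ?thesis by simp
  qed
qed

lemma cot_antimono_on: "0 < x \<Longrightarrow> x \<le> y \<Longrightarrow> y < pi \<Longrightarrow> cot y \<le> cot x"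
proof -
  assume a: "0 < x" "x \<le> y" "y < pi"
  have "sin x > 0" "sin y > 0" using a by (auto intro!: sin_gt_zero)
  moreover have "sin (y - x) \<ge> 0" using a by (intro sin_ge_zero) auto
  ultimately show ?thesis
    by (simp add: cot_def sin_diff field_simps)
qed

lemma abel_summation:
  fixes f g :: "nat \<Rightarrow> 'a::comm_ring"
  assumes "p \<le> q"
  shows "(\<Sum>n=p..<q. f n * (g (Suc n) - g n)) = f q * g q - f p * g p - (\<Sum>n=p..<q. (f (Suc n) - f n) * g (Suc n))"
  using assms by (induction q rule: dec_induct) (simp_all add: algebra_simps)

text \<open>Each term is a difference in disguise: \<open>cis (\<theta> n) = c n * (cis (\<theta>
  (Suc n)) - cis (\<theta> n))\<close> with \<open>c n = 1 / (cis (d n) - 1)\<close>. Abel summation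
  moves the differences onto \<open>c\<close>, and since \<open>d\<close> decreases, the variation
  of \<open>c\<close> telescopes to two cotangents. The endpoints cost \<open>pi / (2 * l)\<close>
  each, the variation \<open>pi / l\<close>.\<close>

theorem kusmin_landau:
  fixes \<theta> :: "nat \<Rightarrow> real"
  assumes anti: "\<And>n. p \<le> n \<Longrightarrow> Suc n < q \<Longrightarrow> \<theta> (Suc (Suc n)) - \<theta> (Suc n) \<le> \<theta> (Suc n) - \<theta> n"
    and rng: "\<And>n. p \<le> n \<Longrightarrow> n < q \<Longrightarrow> l \<le> \<theta> (Suc n) - \<theta> n - 2 * pi * of_int j
                 \<and> \<theta> (Suc n) - \<theta> n - 2 * pi * of_int j \<le> 2 * pi - l"
    and l: "0 < l" "l \<le> pi"
  shows "norm (\<Sum>n=p..<q. cis (\<theta> n)) \<le> 2 * pi / l"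
proof (cases "p < q")
  case False
  then show ?thesis using l by simp
next
  case True
  define d where "d n = \<theta> (Suc n) - \<theta> n - 2 * pi * of_int j" for n
  define c where "c n = 1 / (cis (d n) - 1)" for n
  have s: "sin (d n / 2) \<ge> l / pi" if "p \<le> n" "n < q" for n
    using rng[OF that] l unfolding d_def by (intro sin_half_ge) auto
  have s0: "sin (d n / 2) > 0" if "p \<le> n" "n < q" for n
    using s[OF that] l by (smt (verit) divide_pos_pos pi_gt_zero)
  have cis: "cis (\<theta> n) = c n * (cis (\<theta> (Suc n)) - cis (\<theta> n))" if "p \<le> n" "n < q" for n
  proof -
    have "cis (\<theta> (Suc n)) = cis (d n) * cis (\<theta> n)"
    proof -
      have "cis (\<theta> (Suc n)) = cis (d n + \<theta> n + 2 * pi * of_int j)" by (simp add: d_def)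
      also have "\<dots> = cis (d n) * cis (\<theta> n) * cis (2 * pi * of_int j)" by (simp only: cis_mult)
      also have "cis (2 * pi * of_int j) = 1" by (rule cis_multiple_2pi) auto
      finally show ?thesis by simp
    qed
    moreover have "cis (d n) - 1 \<noteq> 0"
      using norm_cis_diff[of "d n"] s0[OF that] by auto
    ultimately show ?thesis by (simp add: c_def field_simps)
  qed
  have nc: "norm (c n) \<le> pi / (2 * l)" if "p \<le> n" "n < q" for n
    using s[OF that] s0[OF that] l
    by (simp add: c_def norm_divide norm_cis_diff field_simps)
  have ceq: "c n = Complex (-1/2) (- cot (d n / 2) / 2)" if "p \<le> n" "n < q" for n
    unfolding c_def using s0[OF that] by (intro inverse_cis_minus_1) auto
  have cot_bd: "\<bar>cot (d n / 2)\<bar> \<le> pi / l" if "p \<le> n" "n < q" for n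
  proof -
    have "\<bar>cot (d n / 2)\<bar> \<le> 1 / sin (d n / 2)"
      using s0[OF that] by (simp add: cot_def abs_divide divide_right_mono)
    also have "\<dots> \<le> pi / l" using s[OF that] s0[OF that] l by (simp add: field_simps)
    finally show ?thesis .
  qed
  \<comment> \<open>\<open>c\<close> is controlled only below \<open>q\<close>, so the last term is
    split off and the variation of \<open>c\<close> is taken up to \<open>r = q - 1\<close>.\<close>
  obtain r where r: "q = Suc r" "p \<le> r" using True by (metis less_Suc_eq_le not0_implies_Suc not_less0)
  have dc: "norm (c (Suc n) - c n) = (cot (d (Suc n) / 2) - cot (d n / 2)) / 2" if "n \<in> {p..<r}" for n
  proof -
    have n: "p \<le> n" "n < q" "p \<le> Suc n" "Suc n < q" using that r by auto
    have "d (Suc n) \<le> d n" using anti[of n] n by (simp add: d_def)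
    then have le: "cot (d n / 2) \<le> cot (d (Suc n) / 2)"
      using rng[OF n(1,2)] rng[OF n(3,4)] l unfolding d_def by (intro cot_antimono_on) auto
    have "c (Suc n) - c n = Complex 0 (- ((cot (d (Suc n) / 2) - cot (d n / 2)) / 2))"
      by (subst ceq[OF n(1,2)], subst ceq[OF n(3,4)]) (simp add: complex_eq_iff field_simps)
    then show ?thesis using le by (simp add: complex_norm)
  qed
  have "(\<Sum>n=p..<q. cis (\<theta> n)) = (\<Sum>n=p..<r. c n * (cis (\<theta> (Suc n)) - cis (\<theta> n))) + c r * (cis (\<theta> (Suc r)) - cis (\<theta> r))"
    using r by (simp flip: cis)
  also have "\<dots> = c r * cis (\<theta> (Suc r)) - c p * cis (\<theta> p) - (\<Sum>n=p..<r. (c (Suc n) - c n) * cis (\<theta> (Suc n)))"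
    by (subst abel_summation) (use r in \<open>auto simp: algebra_simps\<close>)
  also have "norm \<dots> \<le> norm (c r) + norm (c p) + (\<Sum>n=p..<r. norm (c (Suc n) - c n))"
    by (intro order_trans[OF norm_triangle_ineq4] add_mono order_trans[OF norm_sum] sum_mono) (auto simp: norm_mult)
  also have "(\<Sum>n=p..<r. norm (c (Suc n) - c n)) = (cot (d r / 2) - cot (d p / 2)) / 2"
    using sum_Suc_diff'[of p r "\<lambda>n. cot (d n / 2)"] r
    by (subst sum.cong[OF refl dc]) (simp_all flip: sum_divide_distrib)
  also have "norm (c r) + norm (c p) + \<dots> \<le> pi / (2*l) + pi / (2*l) + (pi / l + pi / l) / 2"
    using cot_bd[of r] cot_bd[of p] r True nc[of r] nc[of p] by (intro add_mono divide_right_mono) auto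
  also have "\<dots> = 2 * pi / l" using l by (simp add: field_simps)
  finally show ?thesis .
qed


section \<open>Second derivative test\<close>

lemma gap_telescope:
  fixes d :: "nat \<Rightarrow> real"
  assumes gap: "\<And>n. p \<le> n \<Longrightarrow> Suc n < q \<Longrightarrow> d (Suc n) + g \<le> d n"
    and "p \<le> m" "m \<le> n" "n < q"
  shows "d n + g * (real n - real m) \<le> d m"
  using assms(3,4)
proof (induction n rule: dec_induct)
  case (step n)
  then have "d (Suc n) + g \<le> d n" using gap[of n] assms(2) by auto
  then show ?case using step by (simp add: algebra_simps)
qed simp

text \<open>The witness is the first index at which \<open>d\<close> drops below \<open>c\<close>;
  monotonicity keeps it there. This cuts off the increments that are close to a multiple of
  \<open>2 * pi\<close>.\<close>

lemma threshold_index: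
  fixes d :: "nat \<Rightarrow> real"
  assumes gap: "\<And>n. p \<le> n \<Longrightarrow> Suc n < q \<Longrightarrow> d (Suc n) \<le> d n" and "p \<le> q"
  obtains r where "p \<le> r" "r \<le> q" "\<forall>n\<in>{p..<r}. c \<le> d n" "\<forall>n\<in>{r..<q}. d n < c"
proof -
  define r where "r = (LEAST r. p \<le> r \<and> (q \<le> r \<or> d r < c))"
  have r: "p \<le> r \<and> (q \<le> r \<or> d r < c)"
    unfolding r_def by (rule LeastI[of _ q]) (use assms in auto)
  have le: "r \<le> m" if "p \<le> m" "q \<le> m \<or> d m < c" for m
    unfolding r_def using that by (intro Least_le) auto
  have "d n < c" if "r \<le> n" "n < q" for n
    using gap_telescope[of p q d 0 r n] gap that r by (cases "q \<le> r") auto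
  then have "\<forall>n\<in>{r..<q}. d n < c" by simp
  moreover have "\<forall>n\<in>{p..<r}. c \<le> d n"
    using le by (metis atLeastLessThan_iff leD not_less)
  moreover have "r \<le> q" using le[of q] assms(2) by simp
  ultimately show ?thesis using r that[of r] by simp
qed

lemma norm_sum_cis_le: "norm (\<Sum>n=p..<q. cis (\<theta> n)) \<le> real (q - p)"
  by (rule order_trans[OF norm_sum]) simp

text \<open>Counts the increments too close to a multiple of \<open>2 * pi\<close> for
  Kusmin-Landau; the corresponding terms are estimated trivially.\<close>

lemma gap_card_bound:
  fixes d :: "nat \<Rightarrow> real"
  assumes gap: "\<And>n. p \<le> n \<Longrightarrow> Suc n < q \<Longrightarrow> d (Suc n) + g \<le> d n" and g: "g > 0"
    and rng: "\<And>n. p \<le> n \<Longrightarrow> n < q \<Longrightarrow> c \<le> d n \<and> d n \<le> c + l" and l: "l \<ge> 0"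
  shows "real (q - p) \<le> l / g + 1"
proof (cases "p < q")
  case True
  have "d (q - 1) + g * (real (q - 1) - real p) \<le> d p"
    using True by (intro gap_telescope[of p q]) (auto intro: gap)
  then have "g * (real (q - 1) - real p) \<le> l"
    using rng[of p] rng[of "q-1"] True by fastforce
  then show ?thesis using True g by (simp add: field_simps of_nat_diff)
qed (use g l in auto)

text \<open>Within distance \<open>l\<close> of either end of the period there are at most
  \<open>l / g + 1\<close> terms; between, Kusmin-Landau gives \<open>2 * pi / l\<close>. The choice
  \<open>l = sqrt g\<close> balances the two: the ends cost \<open>2 / l\<close> each, and
  \<open>4 + 2 * pi \<le> 12\<close>.\<close>

lemma exp_sum_one_period:
  fixes \<theta> :: "nat \<Rightarrow> real"
  assumes gap: "\<And>n. p \<le> n \<Longrightarrow> Suc n < q \<Longrightarrow> \<theta> (Suc (Suc n)) - \<theta> (Suc n) + g \<le> \<theta> (Suc n) - \<theta> n"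
    and g: "0 < g" "g \<le> 1" and "p \<le> q"
    and rng: "\<And>n. p \<le> n \<Longrightarrow> n < q \<Longrightarrow> 2 * pi * of_int j \<le> \<theta> (Suc n) - \<theta> n \<and> \<theta> (Suc n) - \<theta> n \<le> 2 * pi * of_int j + 2 * pi"
  shows "norm (\<Sum>n=p..<q. cis (\<theta> n)) \<le> 12 / sqrt g"
proof -
  define d where "d n = \<theta> (Suc n) - \<theta> n" for n
  define c where "c = 2 * pi * of_int j"
  define l where "l = sqrt g"
  have gap': "d (Suc n) + g \<le> d n" if "p \<le> n" "Suc n < q" for n
    using gap[OF that] by (simp add: d_def)
  have gap0: "d (Suc n) \<le> d n" if "p \<le> n" "Suc n < q" for n
    using gap'[OF that] g by simp
  have l: "0 < l" "l \<le> 1" "l * l = g" using g by (auto simp: l_def)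
  have pi: "pi > 3" using pi_gt3 .
  obtain r1 where r1: "p \<le> r1" "r1 \<le> q" "\<forall>n\<in>{p..<r1}. c + 2 * pi - l \<le> d n"
      "\<forall>n\<in>{r1..<q}. d n < c + 2 * pi - l"
    by (rule threshold_index[of p q d "c + 2 * pi - l", OF gap0 \<open>p \<le> q\<close>])
  have gap1: "d (Suc n) \<le> d n" if "r1 \<le> n" "Suc n < q" for n
    using gap0[of n] that r1(1) by simp
  obtain r2 where r2: "r1 \<le> r2" "r2 \<le> q" "\<forall>n\<in>{r1..<r2}. c + l \<le> d n"
      "\<forall>n\<in>{r2..<q}. d n < c + l"
    by (rule threshold_index[of r1 q d "c + l", OF gap1 r1(2)])
  have "l / g = 1 / l" using l by (metis divide_self_if divide_divide_eq_left less_irrefl)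
  then have short: "l / g + 1 \<le> 2 / l"
    using l by (simp add: field_simps)
  have "real (r1 - p) \<le> l / g + 1"
  proof (rule gap_card_bound[of p r1 d g "c + 2 * pi - l" l])
    show "d (Suc n) + g \<le> d n" if "p \<le> n" "Suc n < r1" for n using gap'[of n] that r1 by auto
    show "c + 2 * pi - l \<le> d n \<and> d n \<le> c + 2 * pi - l + l" if "p \<le> n" "n < r1" for n
      using bspec[OF r1(3), of n] rng[of n] that r1(2) by (auto simp: d_def c_def)
  qed (use g l in auto)
  then have 1: "norm (\<Sum>n=p..<r1. cis (\<theta> n)) \<le> 2 / l"
    using short norm_sum_cis_le[of \<theta> p r1] by linarith
  have "real (q - r2) \<le> l / g + 1"
  proof (rule gap_card_bound[of r2 q d g c l])
    show "d (Suc n) + g \<le> d n" if "r2 \<le> n" "Suc n < q" for n using gap'[of n] that r1 r2 by auto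
    show "c \<le> d n \<and> d n \<le> c + l" if "r2 \<le> n" "n < q" for n
      using bspec[OF r2(4), of n] rng[of n] that r1(1,2) r2(1,2) by (auto simp: d_def c_def)
  qed (use g l in auto)
  then have 3: "norm (\<Sum>n=r2..<q. cis (\<theta> n)) \<le> 2 / l"
    using short norm_sum_cis_le[of \<theta> r2 q] by linarith
  have 2: "norm (\<Sum>n=r1..<r2. cis (\<theta> n)) \<le> 2 * pi / l"
  proof (rule kusmin_landau[where j = j])
    show "\<theta> (Suc (Suc n)) - \<theta> (Suc n) \<le> \<theta> (Suc n) - \<theta> n" if "r1 \<le> n" "Suc n < r2" for n
      using gap0[of n] that r1 r2 by (auto simp: d_def)
    show "l \<le> \<theta> (Suc n) - \<theta> n - 2 * pi * of_int j \<and> \<theta> (Suc n) - \<theta> n - 2 * pi * of_int j \<le> 2 * pi - l"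
      if "r1 \<le> n" "n < r2" for n
      using bspec[OF r2(3), of n] bspec[OF r1(4), of n] that r1(1,2) r2(1,2) by (auto simp: d_def c_def)
  qed (use l pi in auto)
  have "(\<Sum>n=p..<q. cis (\<theta> n)) = (\<Sum>n=p..<r1. cis (\<theta> n)) + (\<Sum>n=r1..<r2. cis (\<theta> n)) + (\<Sum>n=r2..<q. cis (\<theta> n))"
    using r1 r2 by (simp add: sum.atLeastLessThan_concat)
  also have "norm \<dots> \<le> 2 / l + 2 * pi / l + 2 / l"
    using 1 2 3 by (intro order_trans[OF norm_triangle_ineq] add_mono)
  also have "\<dots> = (4 + 2 * pi) / l" by (simp add: add_divide_distrib)
  also have "\<dots> \<le> 12 / l" using l pi_less_4 by (intro divide_right_mono) auto
  finally show ?thesis by (simp add: l_def)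
qed

text \<open>Induction on the number of periods. As the increments decrease, those in the topmost
  period form an initial block, covered by \<open>exp_sum_one_period\<close>; the remaining ones
  start a period lower. At most \<open>D / (2 * pi) + 1\<close> periods occur.\<close>

theorem second_derivative_test:
  fixes \<theta> :: "nat \<Rightarrow> real"
  assumes gap: "\<And>n. p \<le> n \<Longrightarrow> Suc n < q \<Longrightarrow> \<theta> (Suc (Suc n)) - \<theta> (Suc n) + g \<le> \<theta> (Suc n) - \<theta> n"
    and g: "0 < g" "g \<le> 1"
    and rng: "\<And>n. p \<le> n \<Longrightarrow> n < q \<Longrightarrow> 0 \<le> \<theta> (Suc n) - \<theta> n \<and> \<theta> (Suc n) - \<theta> n \<le> D"
    and D: "D \<ge> 0"
  shows "norm (\<Sum>n=p..<q. cis (\<theta> n)) \<le> (D / (2 * pi) + 1) * (12 / sqrt g)"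
proof -
  define d where "d n = \<theta> (Suc n) - \<theta> n" for n
  have gap': "d (Suc n) + g \<le> d n" if "p \<le> n" "Suc n < q" for n
    using gap[OF that] by (simp add: d_def)
  have gap0: "d (Suc n) \<le> d n" if "p \<le> n" "Suc n < q" for n
    using gap'[OF that] g by simp
  have *: "norm (\<Sum>n=p'..<q. cis (\<theta> n)) \<le> (real J + 1) * (12 / sqrt g)"
    if "p \<le> p'" "p' \<le> q" "p' < q \<Longrightarrow> d p' < 2 * pi * (real J + 1)" for J p'
    using that
  proof (induction J arbitrary: p')
    case 0
    have "norm (\<Sum>n=p'..<q. cis (\<theta> n)) \<le> 12 / sqrt g"
    proof (rule exp_sum_one_period[where j = 0])
      show "2 * pi * of_int 0 \<le> \<theta> (Suc n) - \<theta> n \<and> \<theta> (Suc n) - \<theta> n \<le> 2 * pi * of_int 0 + 2 * pi"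
        if "p' \<le> n" "n < q" for n
        using gap_telescope[of p q d 0 p' n] gap0 that 0 rng[of n] by (auto simp: d_def)
    qed (use gap 0 g in auto)
    then show ?case by simp
  next
    case (Suc J)
    have gap1: "d (Suc n) \<le> d n" if "p' \<le> n" "Suc n < q" for n
      using gap0[of n] that Suc.prems(1) by simp
    obtain r where r: "p' \<le> r" "r \<le> q" "\<forall>n\<in>{p'..<r}. 2 * pi * (real J + 1) \<le> d n"
      "\<forall>n\<in>{r..<q}. d n < 2 * pi * (real J + 1)"
      by (rule threshold_index[of p' q d "2 * pi * (real J + 1)", OF gap1 Suc.prems(2)])
    have 1: "norm (\<Sum>n=p'..<r. cis (\<theta> n)) \<le> 12 / sqrt g"
    proof (rule exp_sum_one_period[where j = "int J + 1"])
      show "\<theta> (Suc (Suc n)) - \<theta> (Suc n) + g \<le> \<theta> (Suc n) - \<theta> n" if "p' \<le> n" "Suc n < r" for n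
        using gap[of n] that Suc.prems r by auto
      show "2 * pi * of_int (int J + 1) \<le> \<theta> (Suc n) - \<theta> n \<and>
            \<theta> (Suc n) - \<theta> n \<le> 2 * pi * of_int (int J + 1) + 2 * pi"
        if "p' \<le> n" "n < r" for n
        using gap_telescope[of p q d 0 p' n] gap0 that Suc.prems bspec[OF r(3), of n] r(2)
        by (auto simp: d_def algebra_simps)
    qed (use g r in auto)
    have 2: "norm (\<Sum>n=r..<q. cis (\<theta> n)) \<le> (real J + 1) * (12 / sqrt g)"
      using Suc.prems r by (intro Suc.IH) auto
    have "(\<Sum>n=p'..<q. cis (\<theta> n)) = (\<Sum>n=p'..<r. cis (\<theta> n)) + (\<Sum>n=r..<q. cis (\<theta> n))"
      using r by (simp add: sum.atLeastLessThan_concat)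
    also have "norm \<dots> \<le> 12 / sqrt g + (real J + 1) * (12 / sqrt g)"
      using 1 2 by (intro order_trans[OF norm_triangle_ineq] add_mono)
    finally show ?case by (simp add: algebra_simps add_divide_distrib)
  qed
  show ?thesis
  proof (cases "p < q")
    case True
    define J where "J = nat \<lfloor>D / (2 * pi)\<rfloor>"
    have J: "real J = of_int \<lfloor>D / (2 * pi)\<rfloor>" using D by (simp add: J_def)
    have "D / (2 * pi) < real J + 1" unfolding J by linarith
    then have "d p < 2 * pi * (real J + 1)"
      using rng[of p] True by (auto simp: d_def field_simps)
    then have "norm (\<Sum>n=p..<q. cis (\<theta> n)) \<le> (real J + 1) * (12 / sqrt g)"
      using True by (intro *) auto
    also have "\<dots> \<le> (D / (2 * pi) + 1) * (12 / sqrt g)"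
      unfolding J using g by (intro mult_right_mono add_right_mono) auto
    finally show ?thesis .
  qed (use D g in auto)
qed

section \<open>Sums of \<open>cis (t * ln (n + a))\<close>\<close>

lemma ln_add_one_bounds:
  fixes x :: real
  assumes "x > 0"
  shows "ln (x + 1) - ln x \<le> 1 / x" "1 / (x + 1) \<le> ln (x + 1) - ln x"
  using ln_diff_le[of "x+1" x] ln_diff_le[of x "x+1"] assms by (simp_all add: field_simps)

text \<open>\<open>x * (x + 2)\<close> falls short of \<open>(x + 1)\<^sup>2\<close> by exactly 1,
  and \<open>ln\<close> lies below its tangent.\<close>

lemma ln_second_difference:
  fixes x :: real
  assumes "x > 0"
  shows "ln (x + 2) - ln (x + 1) + 1 / (x + 1)\<^sup>2 \<le> ln (x + 1) - ln x"
proof -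
  have "ln (x * (x + 2)) - ln ((x + 1)\<^sup>2) \<le> (x * (x + 2) - (x + 1)\<^sup>2) / (x + 1)\<^sup>2"
    using assms by (intro ln_diff_le) auto
  also have "x * (x + 2) - (x + 1)\<^sup>2 = -1" by (simp add: power2_eq_square algebra_simps)
  finally show ?thesis using assms by (simp add: ln_mult ln_realpow)
qed

text \<open>On a dyadic block about \<open>t / (2 * pi * p) + 1\<close> periods occur, each costing
  \<open>12 / sqrt g = 60 * p / sqrt t\<close>; with \<open>p \<le> t\<close> this is
  \<open>O(sqrt t)\<close>. The test needs \<open>g \<le> 1\<close>, that is
  \<open>t \<le> 25 * p\<^sup>2\<close>; otherwise \<open>p < sqrt t\<close> and the trivial bound
  by the length suffices.\<close>

lemma zeta_sum_block:
  fixes t a :: real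
  assumes t: "t \<ge> 1" and a: "1 \<le> a" "a \<le> 2" and p: "1 \<le> p" "real p \<le> t" and q: "p \<le> q" "q \<le> 2 * p + 1"
  shows "norm (\<Sum>n=p..<q. cis (t * ln (real n + a))) \<le> 132 * sqrt t"
proof (cases "t \<le> 25 * (real p)\<^sup>2")
  case False
  have "norm (\<Sum>n=p..<q. cis (t * ln (real n + a))) \<le> real (q - p)" by (rule norm_sum_cis_le)
  also have "\<dots> \<le> 2 * real p" using p q by linarith
  also have "real p = sqrt ((real p)\<^sup>2)" by simp
  also have "\<dots> \<le> sqrt t" using False by (intro real_sqrt_le_mono) (smt (verit) zero_le_power2)
  also have "2 * sqrt t \<le> 132 * sqrt t" using t by simp
  finally show ?thesis by simp
next
  case True
  \<comment> \<open>In the block \<open>n + a + 1\<close> is at most \<open>5 * p\<close>, so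
    \<open>g\<close> bounds the second differences of the phase from below.\<close>
  define g where "g = t / (5 * real p)\<^sup>2"
  have g: "0 < g" "g \<le> 1" using t p True by (auto simp: g_def power_mult_distrib)
  have sg: "sqrt g = sqrt t / (5 * real p)"
    unfolding g_def real_sqrt_divide by (subst real_sqrt_abs) simp
  have "norm (\<Sum>n=p..<q. cis (t * ln (real n + a))) \<le> (t / real p / (2 * pi) + 1) * (12 / sqrt g)"
  proof (rule second_derivative_test)
    fix n assume n: "p \<le> n" "Suc n < q"
    define x where "x = real n + a"
    have x: "x > 0" "x + 1 \<le> 5 * real p" using n a q p by (auto simp: x_def)
    have "g \<le> t * (1 / (x + 1)\<^sup>2)"
    proof -
      have "(x + 1)\<^sup>2 \<le> (5 * real p)\<^sup>2" using x by (intro power_mono) auto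
      then have "t / (5 * real p)\<^sup>2 \<le> t / (x + 1)\<^sup>2"
        using x t p by (intro divide_left_mono mult_pos_pos zero_less_power) auto
      then show ?thesis by (simp only: g_def times_divide_eq_right mult_1_right)
    qed
    also have "\<dots> \<le> t * (ln (x + 1) - ln x - (ln (x + 2) - ln (x + 1)))"
      using t ln_second_difference[OF x(1)] by (intro mult_left_mono) auto
    finally show "t * ln (real (Suc (Suc n)) + a) - t * ln (real (Suc n) + a) + g
        \<le> t * ln (real (Suc n) + a) - t * ln (real n + a)"
      by (simp add: x_def algebra_simps)
  next
    fix n assume n: "p \<le> n" "n < q"
    have x: "real n + a > 0" using a by simp
    have "ln (real n + a + 1) - ln (real n + a) \<le> 1 / (real n + a)" by (rule ln_add_one_bounds[OF x])
    also have "\<dots> \<le> 1 / real p" using n a p by (intro divide_left_mono) auto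
    finally have "t * (ln (real n + a + 1) - ln (real n + a)) \<le> t * (1 / real p)"
      using t by (intro mult_left_mono) auto
    moreover have "ln (real n + a) \<le> ln (real n + a + 1)" using x by simp
    ultimately show "0 \<le> t * ln (real (Suc n) + a) - t * ln (real n + a) \<and>
        t * ln (real (Suc n) + a) - t * ln (real n + a) \<le> t / real p"
      using t mult_left_mono[of "ln (real n + a)" "ln (real n + a + 1)" t] by (simp add: algebra_simps)
  qed (use g t in auto)
  also have "\<dots> = 60 * (t / (2 * pi) + real p) / sqrt t"
    unfolding sg using p t by (simp add: field_simps)
  also have "\<dots> \<le> 60 * (t + t) / sqrt t"
  proof (intro divide_right_mono mult_left_mono add_mono)
    show "t / (2 * pi) \<le> t" using t pi_gt3 divide_left_mono[of 1 "2 * pi" t] by simp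
  qed (use p t in auto)
  also have "\<dots> = 120 * sqrt t" using t by (simp add: real_div_sqrt field_simps)
  also have "\<dots> \<le> 132 * sqrt t" using t by simp
  finally show ?thesis by simp
qed

text \<open>Dyadic splitting at \<open>M div 2\<close>: the upper half is one block of
  \<open>zeta_sum_block\<close>, and halving lowers \<open>log 2 M\<close> by at least 1, which pays
  for it.\<close>

theorem zeta_sum_bound:
  fixes t a :: real
  assumes t: "t \<ge> 1" and a: "1 \<le> a" "a \<le> 2" and "1 \<le> M" "real M \<le> t + 1"
  shows "norm (\<Sum>n<M. cis (t * ln (real n + a))) \<le> 132 * sqrt t * (1 + log 2 (real M))"
  using assms(4,5)
proof (induction M rule: less_induct)
  case (less M)
  show ?case
  proof (cases "M = 1")
    case True
    have "1 \<le> sqrt t" using t by simp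
    then have "1 \<le> 132 * sqrt t" by linarith
    then show ?thesis using True by simp
  next
    case False
    define p where "p = M div 2"
    have p: "1 \<le> p" "p < M" "real p \<le> t" "M \<le> 2 * p + 1" using False less.prems by (auto simp: p_def)
    have "(\<Sum>n<M. cis (t * ln (real n + a))) = (\<Sum>n<p. cis (t * ln (real n + a))) + (\<Sum>n=p..<M. cis (t * ln (real n + a)))"
      using p by (simp add: lessThan_atLeast0 sum.atLeastLessThan_concat)
    also have "norm \<dots> \<le> 132 * sqrt t * (1 + log 2 (real p)) + 132 * sqrt t"
      using p t a less.prems
      by (intro order_trans[OF norm_triangle_ineq] add_mono less.IH zeta_sum_block) auto
    also have "\<dots> = 132 * sqrt t * (1 + log 2 (2 * real p))"
      using p by (simp add: log_mult algebra_simps)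
    also have "\<dots> \<le> 132 * sqrt t * (1 + log 2 (real M))"
      using p t by (intro mult_left_mono add_left_mono) (auto simp: p_def)
    finally show ?thesis .
  qed
qed

text \<open>Abel summation produces the nonnegative weights \<open>w n - w (Suc n)\<close>, so
  partial sums may be replaced by their bounds \<open>c * y\<close>; summing by parts back moves the
  differences onto \<open>y\<close>. With \<open>y\<close> linear the result is a sum of weights,
  with \<open>y\<close> constant only the first weight remains.\<close>

lemma abel_bound_antimono:
  fixes z :: "nat \<Rightarrow> complex" and w y :: "nat \<Rightarrow> real"
  assumes "p \<le> q" and w: "\<And>n. p \<le> n \<Longrightarrow> n < q \<Longrightarrow> w (Suc n) \<le> w n" "w q \<ge> 0"
    and A: "\<And>m. p \<le> m \<Longrightarrow> m \<le> q \<Longrightarrow> norm (\<Sum>n=p..<m. z n) \<le> c * y m" and "c \<ge> 0" "y p \<ge> 0" "w p \<ge> 0"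
  shows "norm (\<Sum>n=p..<q. of_real (w n) * z n) \<le> c * (w p * y p + (\<Sum>n=p..<q. w n * (y (Suc n) - y n)))"
proof -
  define S where "S m = (\<Sum>n=p..<m. z n)" for m
  have "(\<Sum>n=p..<q. of_real (w n) * z n) = (\<Sum>n=p..<q. of_real (w n) * (S (Suc n) - S n))"
    by (intro sum.cong) (auto simp: S_def)
  also have "\<dots> = of_real (w q) * S q - (\<Sum>n=p..<q. (of_real (w (Suc n)) - of_real (w n)) * S (Suc n))"
    by (subst abel_summation) (use assms in \<open>auto simp: S_def\<close>)
  also have "norm \<dots> \<le> w q * (c * y q) + (\<Sum>n=p..<q. (w n - w (Suc n)) * (c * y (Suc n)))"
  proof (intro order_trans[OF norm_triangle_ineq4] add_mono order_trans[OF norm_sum] sum_mono)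
    show "norm (of_real (w q) * S q) \<le> w q * (c * y q)"
      unfolding norm_mult S_def using w(2) \<open>p \<le> q\<close> by (intro mult_mono A) auto
    fix n assume n: "n \<in> {p..<q}"
    have "norm (of_real (w (Suc n)) - of_real (w n) :: complex) = w n - w (Suc n)"
      using w(1)[of n] n by (simp flip: of_real_diff)
    then show "norm ((of_real (w (Suc n)) - of_real (w n)) * S (Suc n)) \<le> (w n - w (Suc n)) * (c * y (Suc n))"
      unfolding norm_mult S_def using n w(1)[of n] by (intro mult_mono A) auto
  qed
  also have "\<dots> = c * (w q * y q - (\<Sum>n=p..<q. (w (Suc n) - w n) * y (Suc n)))"
    by (simp add: algebra_simps sum_distrib_left sum_subtractf)
  also have "w q * y q - (\<Sum>n=p..<q. (w (Suc n) - w n) * y (Suc n)) = w p * y p + (\<Sum>n=p..<q. w n * (y (Suc n) - y n))"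
    using abel_summation[OF \<open>p \<le> q\<close>, of w y] by simp
  finally show ?thesis .
qed

text \<open>For increasing weights the boundary term is at most \<open>w q * B\<close> and the total
  variation \<open>w q - w 0\<close> costs at most as much again.\<close>

lemma abel_bound_mono:
  fixes z :: "nat \<Rightarrow> complex" and w :: "nat \<Rightarrow> real"
  assumes w: "\<And>n. n < q \<Longrightarrow> w n \<le> w (Suc n)" "w 0 \<ge> 0"
    and A: "\<And>m. m \<le> q \<Longrightarrow> norm (\<Sum>n<m. z n) \<le> B"
  shows "norm (\<Sum>n<q. of_real (w n) * z n) \<le> 2 * w q * B"
proof -
  define S where "S m = (\<Sum>n<m. z n)" for m
  have B: "B \<ge> 0" using A[of 0] by simp
  have wq: "w 0 \<le> w q" using gap_telescope[of 0 "Suc q" "\<lambda>n. - w n" 0 0 q] w(1) by simp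
  have "(\<Sum>n<q. of_real (w n) * z n) = (\<Sum>n=0..<q. of_real (w n) * (S (Suc n) - S n))"
    by (simp add: S_def lessThan_atLeast0)
  also have "\<dots> = of_real (w q) * S q - (\<Sum>n=0..<q. (of_real (w (Suc n)) - of_real (w n)) * S (Suc n))"
    by (subst abel_summation) (auto simp: S_def)
  also have "norm \<dots> \<le> w q * B + (\<Sum>n=0..<q. (w (Suc n) - w n) * B)"
  proof (intro order_trans[OF norm_triangle_ineq4] add_mono order_trans[OF norm_sum] sum_mono)
    show "norm (of_real (w q) * S q) \<le> w q * B"
      unfolding norm_mult S_def using w wq by (intro mult_mono A) auto
    fix n assume n: "n \<in> {0..<q}"
    have "norm (of_real (w (Suc n)) - of_real (w n) :: complex) = w (Suc n) - w n"
      using w(1)[of n] n by (simp flip: of_real_diff)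
    then show "norm ((of_real (w (Suc n)) - of_real (w n)) * S (Suc n)) \<le> (w (Suc n) - w n) * B"
      unfolding norm_mult S_def using n w(1)[of n] by (intro mult_mono A) auto
  qed
  also have "(\<Sum>n=0..<q. (w (Suc n) - w n) * B) = (w q - w 0) * B"
    by (simp add: sum_Suc_diff'[of 0 q w] flip: sum_distrib_right)
  also have "w q * B + \<dots> \<le> 2 * w q * B" using w(2) B by (simp add: algebra_simps)
  finally show ?thesis .
qed

section \<open>Continuation of the Hurwitz series\<close>

lemma summable_nat_powr: "a < -1 \<Longrightarrow> summable (\<lambda>n. real (Suc n) powr a)"
  using summable_real_powr_iff[of a] summable_Suc_iff[of "\<lambda>n. real n powr a"] by simp

lemma norm_real_powr: "x > 0 \<Longrightarrow> norm (of_real x powr z :: complex) = x powr Re z"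
  by (simp add: norm_powr_real_powr)

lemma has_field_derivative_real_powr:
  fixes y c :: complex
  assumes "y \<notin> \<real>\<^sub>\<le>\<^sub>0"
  shows "((\<lambda>y. y powr c) has_field_derivative c * y powr (c - 1)) (at y within S)"
  by (rule has_field_derivative_at_within) (rule has_field_derivative_powr[OF assms])

text \<open>Weierstrass test on small closed balls, where the continuous \<open>Q\<close> is
  bounded. The exponent \<open>c - 1 - Re s\<close> is scaled so that it is below -1 exactly on the
  half-plane.\<close>

lemma holomorphic_suminf_halfplane:
  fixes f :: "nat \<Rightarrow> complex \<Rightarrow> complex"
  assumes hol: "\<And>n. f n holomorphic_on {s. Re s > c}"
    and bound: "\<And>n s. Re s > c \<Longrightarrow> norm (f n s) \<le> Q s * real (Suc n) powr (c - 1 - Re s)"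
    and Q: "continuous_on UNIV Q"
  shows "(\<lambda>s. \<Sum>n. f n s) holomorphic_on {s. Re s > c}"
    and "Re s > c \<Longrightarrow> summable (\<lambda>n. f n s)"
proof -
  show "summable (\<lambda>n. f n s)" if "Re s > c" for s
    using bound[OF that] that
    by (intro summable_comparison_test'[OF summable_mult[OF summable_nat_powr]]) auto
  show "(\<lambda>s. \<Sum>n. f n s) holomorphic_on {s. Re s > c}"
  proof (rule holomorphic_uniform_sequence[where f = "\<lambda>N s. \<Sum>n<N. f n s"])
    show "open {s. Re s > c}" by (rule open_halfspace_Re_gt)
    show "(\<lambda>s. \<Sum>n<N. f n s) holomorphic_on {s. Re s > c}" for N
      by (intro holomorphic_intros hol)
    fix x assume x: "x \<in> {s. Re s > c}"
    \<comment> \<open>Half the distance to the boundary line, so the whole ball stays at distance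
      \<open>d\<close> from it.\<close>
    define d where "d = (Re x - c) / 2"
    have d: "d > 0" using x by (simp add: d_def)
    have re: "Re z \<ge> c + d" if "z \<in> cball x d" for z
    proof -
      have "Re x - Re z \<le> norm (x - z)" using complex_Re_le_cmod[of "x - z"] by simp
      then show ?thesis using that by (simp add: dist_norm d_def field_simps)
    qed
    have "bounded (Q ` cball x d)"
      by (intro compact_imp_bounded compact_continuous_image continuous_on_subset[OF Q]) auto
    then obtain B where B: "\<And>z. z \<in> cball x d \<Longrightarrow> norm (Q z) \<le> B"
      unfolding bounded_iff by blast
    have "uniform_limit (cball x d) (\<lambda>N s. \<Sum>n<N. f n s) (\<lambda>s. \<Sum>n. f n s) sequentially"
    proof (rule Weierstrass_m_test)
      show "norm (f n z) \<le> B * real (Suc n) powr (- 1 - d)" if z: "z \<in> cball x d" for n z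
      proof -
        have "norm (f n z) \<le> Q z * real (Suc n) powr (c - 1 - Re z)"
          using re[OF z] d by (intro bound) auto
        also have "\<dots> \<le> B * real (Suc n) powr (- 1 - d)"
          using B[OF z] re[OF z] by (intro mult_mono powr_mono) auto
        finally show ?thesis .
      qed
      show "summable (\<lambda>n. B * real (Suc n) powr (- 1 - d))"
        by (intro summable_mult summable_nat_powr) (use d in auto)
    qed
    then show "\<exists>d>0. cball x d \<subseteq> {s. Re s > c} \<and>
        uniform_limit (cball x d) (\<lambda>N s. \<Sum>n<N. f n s) (\<lambda>s. \<Sum>n. f n s) sequentially"
      using re d by (intro exI[of _ d]) (auto intro: less_le_trans[of c "c + d"])
  qed
qed

text \<open>The Hurwitz zeta function, meaningful as a series for \<open>Re s > 1\<close>.\<close>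

definition hurwitz_series :: "real \<Rightarrow> complex \<Rightarrow> complex" where
  "hurwitz_series a s = (\<Sum>n. of_real (real n + a) powr (- s))"

lemma powr_shift_le:
  fixes a :: real
  assumes "a \<ge> 1" "e \<le> 0"
  shows "(real n + a) powr e \<le> real (Suc n) powr e"
  using assms by (intro powr_mono2') auto

lemma hurwitz_series_holomorphic:
  assumes "a \<ge> 1"
  shows "hurwitz_series a holomorphic_on {s. Re s > 1}"
    and "Re s > 1 \<Longrightarrow> summable (\<lambda>n. of_real (real n + a) powr (- s) :: complex)"
proof -
  have b: "norm (of_real (real n + a) powr (- s) :: complex) \<le> 1 * real (Suc n) powr (1 - 1 - Re s)"
    if "Re s > 1" for n s
    using that assms powr_shift_le[of a "- Re s" n] by (simp add: norm_real_powr del: of_real_add)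
  have h: "(\<lambda>s. of_real (real n + a) powr (- s) :: complex) holomorphic_on {s. Re s > 1}" for n
    by (intro holomorphic_intros)
  have Q: "continuous_on UNIV (\<lambda>s :: complex. 1 :: real)" by simp
  show "hurwitz_series a holomorphic_on {s. Re s > 1}"
    unfolding hurwitz_series_def [abs_def] by (rule holomorphic_suminf_halfplane(1)[OF h b Q])
  show "Re s > 1 \<Longrightarrow> summable (\<lambda>n. of_real (real n + a) powr (- s) :: complex)"
    by (rule holomorphic_suminf_halfplane(2)[OF h b Q])
qed

text \<open>Taylor remainder at \<open>x + 1\<close> of \<open>y powr (1 - s)\<close> expanded at
  \<open>x\<close>. The term \<open>i = 1\<close> is \<open>(1 - s) * x powr (- s)\<close>: summed
  over \<open>x = n + a\<close> it yields the Hurwitz series, the later terms yield its values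
  further to the right.\<close>

definition binom_remainder :: "nat \<Rightarrow> complex \<Rightarrow> real \<Rightarrow> complex" where
  "binom_remainder N s x = of_real (x + 1) powr (1 - s)
     - (\<Sum>i\<le>N. ((1 - s) gchoose i) * of_real x powr (1 - s - of_nat i))"

text \<open>Taylor's theorem on the segment from \<open>x\<close> to \<open>x + 1\<close>;
  \<open>Re s + N \<ge> 0\<close> makes the derivative bound largest at the left end
  \<open>x\<close>.\<close>

lemma norm_binom_remainder_le:
  assumes x: "x \<ge> 1" and s: "Re s + real N \<ge> 0"
  shows "norm (binom_remainder N s x) \<le> norm (\<Prod>j\<le>N. 1 - s - of_nat j) / fact N * x powr (- Re s - real N)"
proof -
  define f where "f i y = (\<Prod>j<i. 1 - s - of_nat j) * y powr (1 - s - of_nat i)" for i :: nat and y :: complex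
  define S where "S = closed_segment (of_real x) (of_real (x + 1) :: complex)"
  have S: "y \<in> S \<longleftrightarrow> (\<exists>r. y = of_real r \<and> x \<le> r \<and> r \<le> x + 1)" for y
    unfolding S_def closed_segment_of_real using x by (auto simp: closed_segment_eq_real_ivl)
  have "norm (f 0 (of_real (x + 1)) - (\<Sum>i\<le>N. f i (of_real x) * (of_real (x + 1) - of_real x) ^ i / fact i))
    \<le> norm (\<Prod>j\<le>N. 1 - s - of_nat j) * x powr (- Re s - real N) * norm (of_real (x + 1) - of_real x :: complex) ^ Suc N / fact N"
  proof (rule complex_Taylor)
    show "convex S" by (simp add: S_def)
    show "of_real x \<in> S" "of_real (x + 1) \<in> S" by (simp_all add: S_def)
    fix i :: nat and y assume y: "y \<in> S"
    have ny: "y \<notin> \<real>\<^sub>\<le>\<^sub>0"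
    proof -
      obtain r where "y = of_real r" "x \<le> r" using y S by blast
      then have "Re y > 0" using x by simp
      then show ?thesis by (simp add: complex_nonpos_Reals_iff)
    qed
    show "(f i has_field_derivative f (Suc i) y) (at y within S)"
      unfolding f_def
      by (auto intro!: derivative_eq_intros has_field_derivative_real_powr[OF ny] simp: ny algebra_simps)
  next
    fix y assume y: "y \<in> S"
    then obtain r where r: "y = of_real r" "x \<le> r" "r \<le> x + 1" by (auto simp: S)
    have "norm (f (Suc N) y) = norm (\<Prod>j\<le>N. 1 - s - of_nat j) * r powr (- Re s - real N)"
      using r x by (simp add: f_def norm_mult norm_real_powr lessThan_Suc_atMost)
    also have "\<dots> \<le> norm (\<Prod>j\<le>N. 1 - s - of_nat j) * x powr (- Re s - real N)"
      using r x s by (intro mult_left_mono powr_mono2') auto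
    finally show "norm (f (Suc N) y) \<le> norm (\<Prod>j\<le>N. 1 - s - of_nat j) * x powr (- Re s - real N)" .
  qed
  also have "f 0 (of_real (x + 1)) - (\<Sum>i\<le>N. f i (of_real x) * (of_real (x + 1) - of_real x) ^ i / fact i) = binom_remainder N s x"
    by (simp add: f_def binom_remainder_def gbinomial_prod_rev atLeast0LessThan)
  finally show ?thesis by simp
qed

text \<open>The remainder decays like \<open>n powr (- Re s - N)\<close>, so each further Taylor
  term moves the half-plane of convergence one unit to the left.\<close>

lemma binom_remainder_holomorphic:
  assumes "a \<ge> 1"
  shows "(\<lambda>s. \<Sum>n. binom_remainder N s (real n + a)) holomorphic_on {s. Re s > 1 - real N}"
    and "Re s > 1 - real N \<Longrightarrow> summable (\<lambda>n. binom_remainder N s (real n + a))"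
proof -
  have b: "norm (binom_remainder N s (real n + a)) \<le>
      norm (\<Prod>j\<le>N. 1 - s - of_nat j) / fact N * real (Suc n) powr (1 - real N - 1 - Re s)"
    if "Re s > 1 - real N" for n s
  proof -
    have "norm (binom_remainder N s (real n + a)) \<le>
      norm (\<Prod>j\<le>N. 1 - s - of_nat j) / fact N * (real n + a) powr (- Re s - real N)"
      using that assms by (intro norm_binom_remainder_le) auto
    also have "\<dots> \<le> norm (\<Prod>j\<le>N. 1 - s - of_nat j) / fact N * real (Suc n) powr (- Re s - real N)"
      using that assms by (intro mult_left_mono powr_shift_le) auto
    also have "- Re s - real N = 1 - real N - 1 - Re s" by simp
    finally show ?thesis .
  qed
  have h: "(\<lambda>s. binom_remainder N s (real n + a)) holomorphic_on {s. Re s > 1 - real N}" for n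
    unfolding binom_remainder_def gbinomial_prod_rev using assms
    by (intro holomorphic_intros) (auto simp: complex_eq_iff)
  have Q: "continuous_on UNIV (\<lambda>s. norm (\<Prod>j\<le>N. 1 - s - of_nat j :: complex) / fact N)"
    by (intro continuous_intros) auto
  show "(\<lambda>s. \<Sum>n. binom_remainder N s (real n + a)) holomorphic_on {s. Re s > 1 - real N}"
    by (rule holomorphic_suminf_halfplane(1)[OF h b Q])
  show "Re s > 1 - real N \<Longrightarrow> summable (\<lambda>n. binom_remainder N s (real n + a))"
    by (rule holomorphic_suminf_halfplane(2)[OF h b Q])
qed

lemma tendsto_powr_neg:
  assumes "Re z < 0"
  shows "(\<lambda>n. of_real (real n + a) powr z :: complex) \<longlonglongrightarrow> 0"
proof (rule tendsto_norm_zero_cancel)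
  have "(\<lambda>n. (real n + a) powr Re z) \<longlonglongrightarrow> 0"
    using assms by real_asymp
  moreover have "eventually (\<lambda>n. norm (of_real (real n + a) powr z :: complex) = (real n + a) powr Re z) sequentially"
    using eventually_gt_at_top[of "nat \<lceil>- a\<rceil>"]
  proof eventually_elim
    case (elim n)
    then have "real n + a > 0" by linarith
    then show ?case by (rule norm_real_powr)
  qed
  ultimately show "(\<lambda>n. norm (of_real (real n + a) powr z :: complex)) \<longlonglongrightarrow> 0"
    by (simp add: tendsto_cong)
qed

text \<open>Sum the remainders over \<open>x = n + a\<close>: the terms
  \<open>x powr (1 - s)\<close> telescope to the one at \<open>a\<close>, the term
  \<open>i = 1\<close> becomes the left-hand side, and the terms \<open>i \<ge> 2\<close> are
  Hurwitz series at shifted arguments.\<close>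

lemma hurwitz_recursion:
  assumes a: "a \<ge> 1" and s: "Re s > 1" and N: "N \<ge> 1"
  shows "(s - 1) * hurwitz_series a s = of_real a powr (1 - s)
     + (\<Sum>i=2..N. ((1 - s) gchoose i) * hurwitz_series a (s + of_nat i - 1))
     + (\<Sum>n. binom_remainder N s (real n + a))"
proof -
  define x :: "nat \<Rightarrow> complex" where "x n = of_real (real n + a)" for n
  have "(\<lambda>n. x n powr (1 - s)) \<longlonglongrightarrow> 0"
    unfolding x_def by (intro tendsto_powr_neg) (use s in auto)
  from telescope_sums[OF this] have 1: "(\<lambda>n. x (Suc n) powr (1 - s) - x n powr (1 - s)) sums (- (of_real a powr (1 - s)))"
    by (simp add: x_def)
  have 2: "(\<lambda>n. \<Sum>i=1..N. ((1 - s) gchoose i) * x n powr (1 - s - of_nat i)) sums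
      (\<Sum>i=1..N. ((1 - s) gchoose i) * hurwitz_series a (s + of_nat i - 1))"
  proof (intro sums_sum sums_mult)
    fix i assume i: "i \<in> {1..N}"
    have "(\<lambda>n. of_real (real n + a) powr (- (s + of_nat i - 1))) sums hurwitz_series a (s + of_nat i - 1)"
      unfolding hurwitz_series_def
      by (intro summable_sums hurwitz_series_holomorphic(2) a) (use i s in auto)
    then show "(\<lambda>n. x n powr (1 - s - of_nat i)) sums hurwitz_series a (s + of_nat i - 1)"
      by (simp add: x_def algebra_simps)
  qed
  have "binom_remainder N s (real n + a) = x (Suc n) powr (1 - s) - x n powr (1 - s) -
        (\<Sum>i=1..N. ((1 - s) gchoose i) * x n powr (1 - s - of_nat i))" for n
    by (simp add: binom_remainder_def x_def sum.atLeast1_atMost_eq atMost_atLeast0 sum.atLeast_Suc_atMost algebra_simps)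
  then have 3: "(\<Sum>n. binom_remainder N s (real n + a)) = - (of_real a powr (1 - s)) -
      (\<Sum>i=1..N. ((1 - s) gchoose i) * hurwitz_series a (s + of_nat i - 1))"
    using sums_diff[OF 1 2] by (simp add: sums_iff)
  show ?thesis
    unfolding 3 using N by (simp add: sum.atLeast_Suc_atMost numeral_2_eq_2 algebra_simps)
qed

text \<open>One step to the left per induction step: on the right of the recursion the series occurs
  only at arguments shifted by at least 1, where the continuation is already available.\<close>

lemma hurwitz_continuation_halfplane:
  assumes a: "a \<ge> 1"
  shows "\<exists>E. E holomorphic_on {s. Re s > 1 - real K} \<and> (\<forall>s. Re s > 1 \<longrightarrow> E s = (s - 1) * hurwitz_series a s)"
proof (induction K)
  case 0
  show ?case
    using hurwitz_series_holomorphic(1)[OF a]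
    by (intro exI[of _ "\<lambda>s. (s - 1) * hurwitz_series a s"]) (auto intro!: holomorphic_intros)
next
  case (Suc K)
  then obtain E where E: "E holomorphic_on {s. Re s > 1 - real K}"
    "\<And>s. Re s > 1 \<Longrightarrow> E s = (s - 1) * hurwitz_series a s" by auto
  define P where "P i s = - (\<Prod>j<i-1. 1 - s - of_nat j) / fact i" for i :: nat and s :: complex
  define F where "F s = of_real a powr (1 - s) + (\<Sum>i=2..Suc K. P i s * E (s + of_nat i - 1))
     + (\<Sum>n. binom_remainder (Suc K) s (real n + a))" for s
  have "(\<lambda>s. E (s + of_nat i - 1)) holomorphic_on {s. Re s > 1 - real (Suc K)}" if "i \<in> {2..Suc K}" for i
    using that
    by (intro holomorphic_on_compose_gen[OF _ E(1), unfolded o_def] holomorphic_intros) auto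
  then have "F holomorphic_on {s. Re s > 1 - real (Suc K)}"
    unfolding F_def P_def using a binom_remainder_holomorphic(1)[OF a, of "Suc K"]
    by (intro holomorphic_intros) (auto simp: complex_eq_iff)
  moreover have "F s = (s - 1) * hurwitz_series a s" if "Re s > 1" for s
  proof -
    have "P i s * E (s + of_nat i - 1) = ((1 - s) gchoose i) * hurwitz_series a (s + of_nat i - 1)"
      if i: "i \<in> {2..Suc K}" for i
    proof -
      obtain k where k: "i = Suc k" using i by (cases i) auto
      have "E (s + of_nat i - 1) = (s + of_nat k - 1) * hurwitz_series a (s + of_nat i - 1)"
        using \<open>Re s > 1\<close> i by (subst E(2)) (auto simp: k)
      then show ?thesis
        by (simp add: P_def gbinomial_prod_rev k atLeast0LessThan divide_simps) (simp add: algebra_simps)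
    qed
    then show ?thesis
      unfolding F_def hurwitz_recursion[OF a that, of "Suc K", simplified] by simp
  qed
  ultimately show ?case by blast
qed

lemma halfplane_continuation_unique:
  assumes "f holomorphic_on {s. Re s > c}" "g holomorphic_on {s. Re s > c}"
    and "\<And>s. Re s > b \<Longrightarrow> f s = g s" and "Re z > c"
  shows "f z = g z"
proof (rule analytic_continuation_open[where s = "{s. Re s > max b c}" and s' = "{s. Re s > c}" and f = f and g = g])
  show "open {s. Re s > max b c}" "open {s. Re s > c}" by (rule open_halfspace_Re_gt)+
  show "{s. Re s > max b c} \<noteq> {}" by (auto intro: exI[of _ "of_real (max b c + 1)"])
  show "connected {s. Re s > c}" by (intro convex_connected convex_halfspace_Re_gt)
qed (use assms in auto)

text \<open>The factor \<open>s - 1\<close> cancels the simple pole of the Hurwitz zeta function, so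
  the continuation is entire.\<close>

definition hurwitz_E :: "real \<Rightarrow> complex \<Rightarrow> complex" where
  "hurwitz_E a = (SOME E. E holomorphic_on UNIV \<and> (\<forall>s. Re s > 1 \<longrightarrow> E s = (s - 1) * hurwitz_series a s))"

text \<open>Continuations to different half-planes agree by uniqueness, so they glue: at
  \<open>s\<close> take any index whose half-plane contains \<open>s\<close>. The choice
  \<open>2 - Re s\<close>, rounded up, leaves a full unit of room.\<close>

lemma hurwitz_E:
  assumes a: "a \<ge> 1"
  shows "hurwitz_E a holomorphic_on UNIV" "Re s > 1 \<Longrightarrow> hurwitz_E a s = (s - 1) * hurwitz_series a s"
proof -
  obtain F where F: "\<And>K. F K holomorphic_on {s. Re s > 1 - real K}"
    "\<And>K s. Re s > 1 \<Longrightarrow> F K s = (s - 1) * hurwitz_series a s"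
    using hurwitz_continuation_halfplane[OF a] by metis
  have eq: "F K s = F L s" if "Re s > 1 - real K" "K \<le> L" for K L s
    by (rule halfplane_continuation_unique[where c = "1 - real K" and b = 1])
       (use that F(2) in \<open>auto intro: holomorphic_on_subset[OF F(1)]\<close>)
  define E where "E s = F (nat \<lceil>2 - Re s\<rceil>) s" for s
  have EF: "E s = F K s" if "Re s > 1 - real K" for s K
  proof -
    have "Re s > 1 - real (nat \<lceil>2 - Re s\<rceil>)" by linarith
    then show ?thesis unfolding E_def using eq that by (metis nle_le)
  qed
  have "E holomorphic_on UNIV"
  proof (rule holomorphic_on_subset)
    show "E holomorphic_on (\<Union>K. {s. Re s > 1 - real K})"
    proof (rule holomorphic_on_UN_open)
      show "E holomorphic_on {s. Re s > 1 - real K}" for K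
        using F(1)[of K] EF by (subst holomorphic_cong[OF refl, where g = "F K"]) auto
      show "open {s. Re s > 1 - real K}" for K by (rule open_halfspace_Re_gt)
    qed
    show "UNIV \<subseteq> (\<Union>K. {s. Re s > 1 - real K})"
    proof
      fix s :: complex
      obtain K :: nat where "1 - Re s < real K" using reals_Archimedean2 by blast
      then have "1 - real K < Re s" by simp
      then show "s \<in> (\<Union>K. {s. Re s > 1 - real K})" by blast
    qed
  qed
  moreover have "E s = (s - 1) * hurwitz_series a s" if "Re s > 1" for s
    using EF[of 0 s] F(2)[of s 0] that by simp
  ultimately have "\<exists>E. E holomorphic_on UNIV \<and> (\<forall>s. Re s > 1 \<longrightarrow> E s = (s - 1) * hurwitz_series a s)"
    by blast
  from someI_ex[OF this] have "hurwitz_E a holomorphic_on UNIV \<and> (\<forall>s. Re s > 1 \<longrightarrow> hurwitz_E a s = (s - 1) * hurwitz_series a s)"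
    unfolding hurwitz_E_def .
  then show "hurwitz_E a holomorphic_on UNIV" "Re s > 1 \<Longrightarrow> hurwitz_E a s = (s - 1) * hurwitz_series a s"
    by auto
qed


text \<open>\<open>s - 1\<close> times the difference between the trapezoidal rule and the integral
  of \<open>y powr (- s)\<close> over the interval from \<open>x\<close> to \<open>x + 1\<close>.
  The factor clears the denominator of the antiderivative, so \<open>s = 1\<close> needs no
  exception.\<close>

definition trapezoid_error :: "complex \<Rightarrow> real \<Rightarrow> complex" where
  "trapezoid_error s x = (s - 1) * (of_real x powr (- s) + of_real (x + 1) powr (- s)) / 2
     + of_real (x + 1) powr (1 - s) - of_real x powr (1 - s)"

text \<open>The Peano kernel form of the error: \<open>u * (1 - u) / 2\<close> integrated against
  the second derivative \<open>s * (s + 1) * (x + u) powr (- s - 2)\<close>. The function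
  \<open>H\<close> is the antiderivative obtained by integrating by parts twice.\<close>

lemma trapezoid_error_integral:
  assumes x: "x > 0" and nz: "(s - 1) * s * (s + 1) \<noteq> 0"
  shows "((\<lambda>u. of_real (u * (1 - u)) * of_real (x + u) powr (- s - 2)) has_integral
     2 * trapezoid_error s x / ((s - 1) * s * (s + 1))) {0..1}"
proof -
  define c where "c = (s - 1) * s * (s + 1)"
  define k where "k = (s - 1) * s"
  define H :: "complex \<Rightarrow> complex" where "H u =
     k * ((u * (u - 1) * (1/2)) * (of_real x + u) powr (- s - 1))
     + (s - 1) * ((u - 1 / 2) * (of_real x + u) powr (- s)) + (of_real x + u) powr (1 - s)" for u
  have "((\<lambda>u. c / 2 * (of_real u * (1 - of_real u) * (of_real x + of_real u) powr (- s - 2))) has_integral (H (of_real 1) - H (of_real 0))) {0..1}"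
  proof (rule fundamental_theorem_of_calculus)
    fix u :: real assume u: "u \<in> {0..1}"
    have n: "of_real x + of_real u \<notin> (\<real>\<^sub>\<le>\<^sub>0 :: complex set)"
      using x u by (auto simp: complex_nonpos_Reals_iff)
    have D: "((\<lambda>u. (of_real x + u) powr e) has_field_derivative e * (of_real x + of_real u) powr (e - 1)) (at (of_real u))"
      for e :: complex
      using n by (auto intro!: derivative_eq_intros has_field_derivative_powr)
    have [simp]: "- s - 1 - 1 = - s - 2" "1 - s - 1 = - s" by simp_all
    have "(H has_field_derivative
        (k * ((of_real u * (of_real u - 1) * (1/2)) * ((- s - 1) * (of_real x + of_real u) powr (- s - 2))
              + (of_real u - 1/2) * (of_real x + of_real u) powr (- s - 1))
         + (s - 1) * ((of_real u - 1/2) * (- s * (of_real x + of_real u) powr (- s - 1))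
              + 1 * (of_real x + of_real u) powr (- s))
        + (1 - s) * (of_real x + of_real u) powr (- s))) (at (of_real u))"
      unfolding H_def
    proof (intro DERIV_add DERIV_cmult DERIV_mult')
      show "((\<lambda>u. u * (u - 1) * (1/2)) has_field_derivative (of_real u - 1/2)) (at (of_real u :: complex))"
        by (auto intro!: derivative_eq_intros simp: field_simps)
      show "((\<lambda>u. u - 1/2) has_field_derivative 1) (at (of_real u :: complex))"
        by (auto intro!: derivative_eq_intros)
    qed (use D[of "-s-1"] D[of "-s"] D[of "1-s"] in simp_all)
    also have "(k * ((of_real u * (of_real u - 1) * (1/2)) * ((- s - 1) * (of_real x + of_real u) powr (- s - 2))
              + (of_real u - 1/2) * (of_real x + of_real u) powr (- s - 1))
         + (s - 1) * ((of_real u - 1/2) * (- s * (of_real x + of_real u) powr (- s - 1))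
              + 1 * (of_real x + of_real u) powr (- s))
        + (1 - s) * (of_real x + of_real u) powr (- s))
       = c / 2 * (of_real u * (1 - of_real u) * (of_real x + of_real u) powr (- s - 2))"
      unfolding c_def k_def by (simp only: ring_distribs add_divide_distrib diff_divide_distrib times_divide_eq_right) (simp add: algebra_simps)
    finally show "((\<lambda>u. H (of_real u)) has_vector_derivative c / 2 * (of_real u * (1 - of_real u) * (of_real x + of_real u) powr (- s - 2))) (at u within {0..1})"
      by (rule has_vector_derivative_real_field)
  qed simp
  moreover have "H (of_real 1) - H (of_real 0) = trapezoid_error s x"
    by (simp add: H_def trapezoid_error_def field_simps)
  ultimately have "((\<lambda>u. 2 / c * (c / 2 * (of_real u * (1 - of_real u) * (of_real x + of_real u) powr (- s - 2)))) has_integral 2 / c * trapezoid_error s x) {0..1}"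
    by (intro has_integral_mult_right) simp
  moreover have "2 / c * (c / 2 * v) = v" for v
    using nz by (simp add: c_def)
  ultimately show ?thesis by (simp add: c_def mult.assoc)
qed

text \<open>The sum is taken under the integral before norms, so the oscillation of the terms
  survives and can be exploited for each fixed \<open>u\<close>. For \<open>s\<close> equal to 1, 0
  or -1 the representation would divide by 0, but there every error vanishes.\<close>

lemma norm_sum_trapezoid_error_le:
  assumes x: "\<And>n. n \<in> A \<Longrightarrow> x n > 0" and "finite A"
    and B: "\<And>u. 0 \<le> u \<Longrightarrow> u \<le> 1 \<Longrightarrow> norm (\<Sum>n\<in>A. of_real (x n + u) powr (- s - 2) :: complex) \<le> B"
  shows "norm (\<Sum>n\<in>A. trapezoid_error s (x n)) \<le> norm (s - 1) * (norm s * norm (s + 1) / 2 * B)"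
proof (cases "(s - 1) * s * (s + 1) = 0")
  case True
  have "trapezoid_error s (x n) = 0" if "n \<in> A" for n
  proof -
    have "of_real (x n) \<noteq> (0 :: complex)" "of_real (x n) + 1 \<noteq> (0 :: complex)"
      using x[OF that] by (auto simp: complex_eq_iff)
    note nz = this
    consider "s = 1" | "s = 0" | "s = -1" using True by (auto simp: eq_neg_iff_add_eq_0)
    then show ?thesis
      by cases (use nz in \<open>simp_all add: trapezoid_error_def power2_eq_square field_simps\<close>)
  qed
  moreover have "B \<ge> 0" using B[of 0] by (meson norm_ge_zero order_trans order_refl zero_le_one)
  ultimately show ?thesis by simp
next
  case False
  have "((\<lambda>u. \<Sum>n\<in>A. of_real (u * (1 - u)) * of_real (x n + u) powr (- s - 2)) has_integral
     (\<Sum>n\<in>A. 2 * trapezoid_error s (x n) / ((s - 1) * s * (s + 1)))) {0..1}"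
    using assms(1,2) False by (intro has_integral_sum trapezoid_error_integral) auto
  then have "norm (\<Sum>n\<in>A. 2 * trapezoid_error s (x n) / ((s - 1) * s * (s + 1))) \<le> B * measure lborel (cbox 0 (1::real))"
  proof (intro has_integral_bound)
    show "0 \<le> B" using B[of 0] by (meson norm_ge_zero order_trans order_refl zero_le_one)
    fix u :: real assume u: "u \<in> cbox 0 1"
    have "norm (\<Sum>n\<in>A. of_real (u * (1 - u)) * of_real (x n + u) powr (- s - 2) :: complex) =
        (u * (1 - u)) * norm (\<Sum>n\<in>A. of_real (x n + u) powr (- s - 2) :: complex)"
      using u unfolding sum_distrib_left[symmetric] norm_mult norm_of_real by simp
    also have "\<dots> \<le> 1 * B"
      using u by (intro mult_mono B mult_le_one) auto
    finally show "norm (\<Sum>n\<in>A. of_real (u * (1 - u)) * of_real (x n + u) powr (- s - 2) :: complex) \<le> B" by simp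
  qed simp
  then have B': "norm (\<Sum>n\<in>A. 2 * trapezoid_error s (x n) / ((s - 1) * s * (s + 1))) \<le> B" by simp
  have "(\<Sum>n\<in>A. trapezoid_error s (x n)) = ((s - 1) * s * (s + 1)) / 2 * (\<Sum>n\<in>A. 2 * trapezoid_error s (x n) / ((s - 1) * s * (s + 1)))"
    using False by (simp add: sum_distrib_left)
  also have "norm \<dots> \<le> norm (((s - 1) * s * (s + 1)) / 2) * B"
    unfolding norm_mult by (rule mult_left_mono[OF B']) auto
  finally show ?thesis
    by (simp add: norm_mult norm_divide mult.assoc)
qed

lemma trapezoid_error_holomorphic:
  assumes a: "a \<ge> 1"
  shows "(\<lambda>s. \<Sum>n. trapezoid_error s (real n + a)) holomorphic_on {s. Re s > -1}"
    and "Re s > - 1 \<Longrightarrow> summable (\<lambda>n. trapezoid_error s (real n + a))"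
proof -
  have b: "norm (trapezoid_error s (real n + a)) \<le>
      norm (s - 1) * (norm s * norm (s + 1)) / 2 * real (Suc n) powr (-1 - 1 - Re s)"
    if "Re s > - 1" for n s
  proof -
    have "norm (\<Sum>n\<in>{n}. trapezoid_error s (real n + a)) \<le> norm (s - 1) * (norm s * norm (s + 1) / 2 * real (Suc n) powr (-1 - 1 - Re s))"
    proof (rule norm_sum_trapezoid_error_le)
      fix u :: real assume u: "0 \<le> u" "u \<le> 1"
      have "norm (\<Sum>n\<in>{n}. of_real (real n + a + u) powr (- s - 2) :: complex) = (real n + a + u) powr (- Re s - 2)"
        using u a by (simp add: norm_real_powr del: of_real_add)
      also have "\<dots> \<le> real (Suc n) powr (- Re s - 2)"
        using u a that by (intro powr_mono2') auto
      also have "- Re s - 2 = -1 - 1 - Re s" by simp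
      finally show "norm (\<Sum>n\<in>{n}. of_real (real n + a + u) powr (- s - 2) :: complex) \<le> real (Suc n) powr (-1 - 1 - Re s)" .
    qed (use a in auto)
    then show ?thesis by simp
  qed
  have h: "(\<lambda>s. trapezoid_error s (real n + a)) holomorphic_on {s. Re s > -1}" for n
    unfolding trapezoid_error_def using assms
    by (intro holomorphic_intros) (auto simp: complex_eq_iff)
  have Q: "continuous_on UNIV (\<lambda>s::complex. norm (s - 1) * (norm s * norm (s + 1)) / 2)"
    by (intro continuous_intros) auto
  show "(\<lambda>s. \<Sum>n. trapezoid_error s (real n + a)) holomorphic_on {s. Re s > -1}"
    by (rule holomorphic_suminf_halfplane(1)[OF h b Q])
  show "Re s > - 1 \<Longrightarrow> summable (\<lambda>n. trapezoid_error s (real n + a))"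
    by (rule holomorphic_suminf_halfplane(2)[OF h b Q])
qed

lemma sum_trapezoid_error:
  "(\<Sum>n<N. trapezoid_error s (real n + a)) = (s - 1) * ((\<Sum>n<N. of_real (real n + a) powr (- s))
     - of_real a powr (- s) / 2 + of_real (real N + a) powr (- s) / 2)
     + of_real (real N + a) powr (1 - s) - of_real a powr (1 - s)"
proof (induction N)
  case (Suc N)
  have "real N + a + 1 = real (Suc N) + a" by simp
  then show ?case
    unfolding sum.lessThan_Suc unfolding Suc.IH unfolding trapezoid_error_def
    by (simp only: ring_distribs add_divide_distrib diff_divide_distrib times_divide_eq_right) (simp add: algebra_simps)
qed simp

text \<open>For \<open>Re s > 1\<close> let \<open>N\<close> tend to infinity in
  \<open>sum_trapezoid_error\<close>; the boundary terms at \<open>N\<close> vanish. Both sides are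
  holomorphic for \<open>Re s > -1\<close>, so the identity persists there.\<close>

lemma hurwitz_E_eq_trapezoid:
  assumes a: "a \<ge> 1" and s: "Re s > -1"
  shows "hurwitz_E a s = of_real a powr (1 - s) + (s - 1) * of_real a powr (- s) / 2 + (\<Sum>n. trapezoid_error s (real n + a))"
proof (rule halfplane_continuation_unique[where b = 1 and f = "hurwitz_E a" and c = "-1", OF _ _ _ s])
  show "hurwitz_E a holomorphic_on {s. - 1 < Re s}"
    by (rule holomorphic_on_subset[OF hurwitz_E(1)[OF a]]) auto
  show "(\<lambda>s. of_real a powr (1 - s) + (s - 1) * of_real a powr (- s) / 2 + (\<Sum>n. trapezoid_error s (real n + a))) holomorphic_on {s. - 1 < Re s}"
    using a by (intro holomorphic_intros trapezoid_error_holomorphic) auto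
  fix s :: complex assume s: "Re s > 1"
  have "(\<lambda>N. \<Sum>n<N. trapezoid_error s (real n + a)) \<longlonglongrightarrow> (s - 1) * (hurwitz_series a s
     - of_real a powr (- s) / 2 + 0 / 2) + 0 - of_real a powr (1 - s)"
    unfolding sum_trapezoid_error hurwitz_series_def using s a
    by (intro tendsto_intros tendsto_powr_neg summable_LIMSEQ hurwitz_series_holomorphic) auto
  then have "(\<Sum>n. trapezoid_error s (real n + a)) = (s - 1) * (hurwitz_series a s
     - of_real a powr (- s) / 2 + 0 / 2) + 0 - of_real a powr (1 - s)"
    by (intro sums_unique[symmetric]) (simp add: sums_def)
  then show "hurwitz_E a s = of_real a powr (1 - s) + (s - 1) * of_real a powr (- s) / 2 + (\<Sum>n. trapezoid_error s (real n + a))"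
    unfolding hurwitz_E(2)[OF a s] by (simp add: ring_distribs)
qed

text \<open>The residue of the Hurwitz zeta function at its pole: at \<open>s = 1\<close> all
  trapezoidal errors vanish and \<open>a powr 0\<close> remains. That it does not depend on
  \<open>a\<close> makes the pole cancel for non-principal characters.\<close>

lemma hurwitz_E_1: "a \<ge> 1 \<Longrightarrow> hurwitz_E a 1 = 1"
proof -
  assume a: "a \<ge> 1"
  have "complex_of_real (real n + a) \<noteq> 0" "complex_of_real (real n + a + 1) \<noteq> 0" for n
    unfolding of_real_eq_0_iff using a by auto
  then have "trapezoid_error 1 (real n + a) = 0" for n by (simp add: trapezoid_error_def)
  then show ?thesis using a by (simp add: hurwitz_E_eq_trapezoid)
qed

text \<open>The cut \<open>N\<close> is free; the growth estimate puts it near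
  \<open>\<bar>Im s\<bar>\<close>, where the bounds for the head and the tail meet.\<close>

lemma hurwitz_E_eq_partial:
  assumes a: "a \<ge> 1" and s: "Re s > -1"
  shows "hurwitz_E a s = (s - 1) * (\<Sum>n<N. of_real (real n + a) powr (- s)) + (s - 1) * of_real (real N + a) powr (- s) / 2
     + of_real (real N + a) powr (1 - s) + (\<Sum>n. trapezoid_error s (real (n + N) + a))"
  using suminf_split_initial_segment[OF trapezoid_error_holomorphic(2)[OF a s], of N]
  unfolding hurwitz_E_eq_trapezoid[OF a s] sum_trapezoid_error by (simp add: ring_distribs)

section \<open>Growth in vertical strips\<close>

lemma of_real_powr_minus:
  assumes "x > 0"
  shows "complex_of_real x powr (- s) = of_real (x powr (- Re s)) * cis (- Im s * ln x)"
proof -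
  have "complex_of_real x powr (- s) = exp (- s * of_real (ln x))"
    using assms by (simp add: powr_def Ln_of_real)
  also have "\<dots> = of_real (exp (- Re s * ln x)) * cis (- Im s * ln x)"
    by (simp add: exp_eq_polar)
  also have "exp (- Re s * ln x) = x powr (- Re s)" using assms by (simp add: powr_def)
  finally show ?thesis .
qed

lemma norm_sum_cis_abs:
  "norm (\<Sum>n\<in>A. cis (- y * f n)) = norm (\<Sum>n\<in>A. cis (\<bar>y\<bar> * f n))"
proof (cases "y \<ge> 0")
  case True
  have "(\<Sum>n\<in>A. cis (- y * f n)) = cnj (\<Sum>n\<in>A. cis (\<bar>y\<bar> * f n))"
    using True by (simp add: cis_cnj)
  then show ?thesis by (simp only: complex_mod_cnj)
qed simp

text \<open>For \<open>n \<ge> t\<close> the phase increments lie between \<open>t / (q + b)\<close>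
  and 1, hence well inside the first period, and Kusmin-Landau applies with
  \<open>j = 0\<close>.\<close>

lemma zeta_sum_tail:
  fixes b :: real
  assumes t: "t \<ge> 1" and b: "b \<ge> 1" and p: "real p \<ge> t"
  shows "norm (\<Sum>n=p..<q. cis (t * ln (real n + b))) \<le> 2 * pi / t * (real q + b)"
proof (cases "p < q")
  case False
  then show ?thesis using t b by simp
next
  case True
  have "norm (\<Sum>n=p..<q. cis (t * ln (real n + b))) \<le> 2 * pi / (t / (real q + b))"
  proof (rule kusmin_landau[where j = 0])
    show "t * ln (real (Suc (Suc n)) + b) - t * ln (real (Suc n) + b) \<le> t * ln (real (Suc n) + b) - t * ln (real n + b)" for n
    proof -
      have "0 \<le> 1 / (real n + b + 1)\<^sup>2" by simp
      then have "ln (real n + b + 2) - ln (real n + b + 1) \<le> ln (real n + b + 1) - ln (real n + b)"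
        using ln_second_difference[of "real n + b"] b by linarith
      then have "t * (ln (real n + b + 2) - ln (real n + b + 1)) \<le> t * (ln (real n + b + 1) - ln (real n + b))"
        using t by (intro mult_left_mono) auto
      then show ?thesis by (simp add: algebra_simps)
    qed
    fix n assume n: "p \<le> n" "n < q"
    have x: "real n + b > 0" using b by simp
    note bnd = ln_add_one_bounds[OF x]
    have "t / (real q + b) \<le> t / (real n + b + 1)"
      using n b t by (intro divide_left_mono mult_pos_pos) auto
    also have "\<dots> \<le> t * (ln (real n + b + 1) - ln (real n + b))"
      using mult_left_mono[OF bnd(2), of t] t by simp
    finally have 1: "t / (real q + b) \<le> t * (ln (real n + b + 1) - ln (real n + b))" .
    have "t * (ln (real n + b + 1) - ln (real n + b)) \<le> t * (1 / (real n + b))"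
      using mult_left_mono[OF bnd(1), of t] t by simp
    also have "\<dots> \<le> 1" using n p b t by simp
    also have "t / (real q + b) \<le> 1" using True p b t by simp
    then have "1 \<le> 2 * pi - t / (real q + b)" using pi_gt3 by linarith
    finally show "t / (real q + b) \<le> t * ln (real (Suc n) + b) - t * ln (real n + b) - 2 * pi * of_int 0 \<and>
       t * ln (real (Suc n) + b) - t * ln (real n + b) - 2 * pi * of_int 0 \<le> 2 * pi - t / (real q + b)"
      using 1 by (simp add: algebra_simps)
  next
    show "0 < t / (real q + b)" using t b by simp
    have "t / (real q + b) \<le> 1" using True p b t by simp
    then show "t / (real q + b) \<le> pi" using pi_gt3 by linarith
  qed
  then show ?thesis by (simp add: field_simps)
qed

lemma powr_neg_le_diff:
  fixes x e :: real
  assumes x: "x > 1" and e: "e > 0"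
  shows "x powr (- e - 1) \<le> ((x - 1) powr (- e) - x powr (- e)) / e"
proof -
  have "\<exists>z. x - 1 < z \<and> z < x \<and> x powr (- e) - (x - 1) powr (- e) = (x - (x - 1)) * (- e * z powr (- e - 1))"
    using x by (intro MVT2) (auto intro!: derivative_eq_intros)
  then obtain z where z: "x - 1 < z" "z < x" "(x - 1) powr (- e) - x powr (- e) = e * z powr (- e - 1)"
    by auto
  have "x powr (- e - 1) \<le> z powr (- e - 1)"
    using z x e by (intro powr_mono2') auto
  then show ?thesis using z(3) e by simp
qed

lemma sum_powr_tail_le:
  fixes b e :: real
  assumes "p \<ge> 1" "b \<ge> 1" "e > 0"
  shows "(\<Sum>n=p..<q. (real n + b) powr (- e - 1)) \<le> real p powr (- e) / e"
proof (cases "p \<le> q")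
  case True
  have "(\<Sum>n=p..<q. (real n + b) powr (- e - 1)) \<le> (\<Sum>n=p..<q. ((real n + b - 1) powr (- e) - (real (Suc n) + b - 1) powr (- e)) / e)"
  proof (rule sum_mono)
    fix n assume "n \<in> {p..<q}"
    then have "real n + b > 1" using assms by auto
    from powr_neg_le_diff[OF this assms(3)]
    show "(real n + b) powr (- e - 1) \<le> ((real n + b - 1) powr (- e) - (real (Suc n) + b - 1) powr (- e)) / e"
      by (simp add: algebra_simps)
  qed
  also have "\<dots> = ((real p + b - 1) powr (- e) - (real q + b - 1) powr (- e)) / e"
    using sum_Suc_diff'[OF True, of "\<lambda>n. - ((real n + b - 1) powr (- e))"]
    by (simp add: sum_divide_distrib[symmetric] del: of_nat_Suc)
  also have "\<dots> \<le> (real p + b - 1) powr (- e) / e" using assms by (intro divide_right_mono) auto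
  also have "\<dots> \<le> real p powr (- e) / e" using assms by (intro divide_right_mono powr_mono2') auto
  finally show ?thesis .
qed (use assms in auto)

text \<open>Partial summation against the bound \<open>2 * pi / t * (m + b)\<close> from
  \<open>zeta_sum_tail\<close> gains a factor \<open>1 / t\<close> over the trivial estimate. In the
  growth estimate this balances one of the two factors \<open>t\<close> coming from
  \<open>norm s * norm (s + 1)\<close>; the decay of the tail itself balances the other.\<close>

lemma dirichlet_tail_bound:
  fixes b \<sigma>0 :: real
  assumes t: "\<bar>Im s\<bar> \<ge> 1" and b: "b \<ge> 1" and p: "real p \<ge> \<bar>Im s\<bar>" and \<sigma>: "Re s \<ge> \<sigma>0" and \<sigma>0: "-1 < \<sigma>0"
    and "p \<le> q"
  shows "norm (\<Sum>n=p..<q. of_real (real n + b) powr (- s - 2) :: complex)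
    \<le> 2 * pi / \<bar>Im s\<bar> * ((real p + b) powr (- \<sigma>0 - 1) + real p powr (- \<sigma>0 - 1) / (\<sigma>0 + 1))"
proof -
  define t where "t = \<bar>Im s\<bar>"
  have t: "t \<ge> 1" "real p \<ge> t" using assms by (auto simp: t_def)
  then have p1: "p \<ge> 1" by (cases p) auto
  define w where "w n = (real n + b) powr (- Re s - 2)" for n
  have "(\<Sum>n=p..<q. of_real (real n + b) powr (- s - 2) :: complex) = (\<Sum>n=p..<q. of_real (w n) * cis (- Im s * ln (real n + b)))"
  proof (rule sum.cong)
    fix n assume "n \<in> {p..<q}"
    have "real n + b > 0" using b by simp
    from of_real_powr_minus[OF this, of "s + 2"]
    show "of_real (real n + b) powr (- s - 2) = of_real (w n) * cis (- Im s * ln (real n + b))"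
      by (simp add: w_def)
  qed simp
  also have "norm \<dots> \<le> 2 * pi / t * (w p * (real p + b) + (\<Sum>n=p..<q. w n * (real (Suc n) + b - (real n + b))))"
  proof (rule abel_bound_antimono[OF \<open>p \<le> q\<close>])
    show "w (Suc n) \<le> w n" for n
      unfolding w_def using b \<sigma> \<sigma>0 by (intro powr_mono2') auto
    show "norm (\<Sum>n=p..<m. cis (- Im s * ln (real n + b))) \<le> 2 * pi / t * (real m + b)" for m
      unfolding norm_sum_cis_abs t_def[symmetric] by (rule zeta_sum_tail) (use t b in auto)
  qed (use t b in \<open>auto simp: w_def\<close>)
  also have "\<dots> = 2 * pi / t * (w p * (real p + b) + (\<Sum>n=p..<q. w n))" by simp
  also have "\<dots> \<le> 2 * pi / t * ((real p + b) powr (- \<sigma>0 - 1) + real p powr (- (\<sigma>0 + 1)) / (\<sigma>0 + 1))"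
  proof (intro mult_left_mono add_mono)
    have "w p * (real p + b) = (real p + b) powr (- Re s - 1)"
    proof -
      have "- Re s - 1 = (- Re s - 2) + 1" by simp
      then show ?thesis unfolding w_def using b by (simp only: powr_add) simp
    qed
    also have "\<dots> \<le> (real p + b) powr (- \<sigma>0 - 1)"
      using b \<sigma> by (intro powr_mono) auto
    finally show "w p * (real p + b) \<le> (real p + b) powr (- \<sigma>0 - 1)" .
    have "sum w {p..<q} \<le> (\<Sum>n=p..<q. (real n + b) powr (- (\<sigma>0 + 1) - 1))"
      unfolding w_def using b \<sigma> by (intro sum_mono powr_mono) auto
    also have "\<dots> \<le> real p powr (- (\<sigma>0 + 1)) / (\<sigma>0 + 1)"
      by (rule sum_powr_tail_le) (use p1 b \<sigma>0 in auto)
    finally show "sum w {p..<q} \<le> real p powr (- (\<sigma>0 + 1)) / (\<sigma>0 + 1)" .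
  qed (use t in auto)
  finally show ?thesis by (simp add: t_def)
qed

text \<open>The weight \<open>n powr (- Re s)\<close> is split into an increasing part with exponent
  \<open>- \<sigma>0\<close> and a decreasing part with exponent \<open>\<sigma>0 - Re s\<close>,
  removed by one partial summation each. The bound is thus uniform in
  \<open>Re s \<ge> \<sigma>0\<close>, whatever the sign of \<open>Re s\<close>.\<close>

lemma dirichlet_head_bound:
  fixes a \<sigma>0 :: real
  assumes t: "\<bar>Im s\<bar> \<ge> 1" and a: "1 \<le> a" "a \<le> 2" and N: "1 \<le> N" "real N \<le> \<bar>Im s\<bar> + 1" and \<sigma>: "Re s \<ge> \<sigma>0" and \<sigma>0: "\<sigma>0 \<le> 0"
  shows "norm (\<Sum>n<N. of_real (real n + a) powr (- s) :: complex)
    \<le> 264 * (real N + a) powr (- \<sigma>0) * (sqrt \<bar>Im s\<bar> * (1 + log 2 (\<bar>Im s\<bar> + 1)))"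
proof -
  define t where "t = \<bar>Im s\<bar>"
  have t: "t \<ge> 1" "real N \<le> t + 1" using assms by (auto simp: t_def)
  define z where "z n = of_real ((real n + a) powr (- \<sigma>0)) * cis (- Im s * ln (real n + a))" for n
  define w where "w n = (real n + a) powr (\<sigma>0 - Re s)" for n
  define B where "B = 2 * (real N + a) powr (- \<sigma>0) * (132 * sqrt t * (1 + log 2 (t + 1)))"
  have B: "norm (\<Sum>n<M. z n) \<le> B" if M: "M \<le> N" for M
  proof -
    have "norm (\<Sum>n<M. z n) \<le> 2 * (real M + a) powr (- \<sigma>0) * (132 * sqrt t * (1 + log 2 (t + 1)))"
      unfolding z_def
    proof (rule abel_bound_mono)
      show "(real n + a) powr - \<sigma>0 \<le> (real (Suc n) + a) powr - \<sigma>0" for n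
        using a \<sigma>0 by (intro powr_mono2) auto
      fix m assume m: "m \<le> M"
      have "norm (\<Sum>n<m. cis (\<bar>Im s\<bar> * ln (real n + a))) \<le> 132 * sqrt t * (1 + log 2 (t + 1))"
      proof (cases "m = 0")
        case False
        have "norm (\<Sum>n<m. cis (\<bar>Im s\<bar> * ln (real n + a))) \<le> 132 * sqrt t * (1 + log 2 (real m))"
          unfolding t_def[symmetric] by (rule zeta_sum_bound) (use t a False m M in auto)
        also have "\<dots> \<le> 132 * sqrt t * (1 + log 2 (t + 1))"
          using t False m M by (intro mult_left_mono add_left_mono) auto
        finally show ?thesis .
      qed (use t in auto)
      then show "norm (\<Sum>n<m. cis (- Im s * ln (real n + a))) \<le> 132 * sqrt t * (1 + log 2 (t + 1))"
        unfolding norm_sum_cis_abs .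
    qed auto
    also have "\<dots> \<le> B"
      unfolding B_def using M a \<sigma>0 t by (intro mult_right_mono mult_left_mono powr_mono2) auto
    finally show ?thesis .
  qed
  have B0: "B \<ge> 0" using B[of 0] by simp
  have "(\<Sum>n<N. of_real (real n + a) powr (- s) :: complex) = (\<Sum>n=0..<N. of_real (w n) * z n)"
    unfolding lessThan_atLeast0
  proof (rule sum.cong)
    fix n
    have x: "real n + a > 0" using a by simp
    have "(real n + a) powr (- Re s) = (real n + a) powr (\<sigma>0 - Re s) * (real n + a) powr (- \<sigma>0)"
      by (simp flip: powr_add)
    then show "of_real (real n + a) powr (- s) = of_real (w n) * z n"
      by (simp add: of_real_powr_minus[OF x] w_def z_def mult.assoc del: of_real_add)
  qed simp
  \<comment> \<open>With the constant bound \<open>y = 1\<close> only the first weight remains, and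
    it is at most 1 because \<open>a \<ge> 1\<close>.\<close>
  also have "norm \<dots> \<le> B * (w 0 * 1 + (\<Sum>n=0..<N. w n * (1 - 1)))"
  proof (rule abel_bound_antimono)
    show "w (Suc n) \<le> w n" for n
      unfolding w_def using a \<sigma> by (intro powr_mono2') auto
    show "norm (\<Sum>n=0..<m. z n) \<le> B * 1" if "m \<le> N" for m
      using B[OF that] by (simp add: lessThan_atLeast0)
  qed (use B0 in \<open>auto simp: w_def\<close>)
  also have "\<dots> \<le> B * 1"
    using B0 a \<sigma> powr_mono2'[of "\<sigma>0 - Re s" 1 a] by (intro mult_left_mono) (auto simp: w_def)
  finally show ?thesis by (simp add: B_def t_def mult.assoc)
qed

text \<open>Cut at \<open>N\<close>, the integer just above \<open>t\<close>. The head gives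
  \<open>t powr (1/2 - \<sigma>0)\<close> times a logarithm; the two boundary terms and the
  trapezoidal tail give only \<open>t powr (- \<sigma>0)\<close>. The final exponent is below 1
  exactly because \<open>\<sigma>0 > -1/2\<close>.\<close>

theorem hurwitz_growth:
  fixes a \<sigma>0 :: real
  assumes a: "1 \<le> a" "a \<le> 2" and \<sigma>0: "- 1 / 2 < \<sigma>0" "\<sigma>0 \<le> 0"
  shows "\<exists>C\<ge>0. \<forall>s. \<sigma>0 \<le> Re s \<and> Re s \<le> 2 \<and> \<bar>Im s\<bar> \<ge> 1 \<longrightarrow>
    norm (hurwitz_E a s / (s - 1)) \<le> C * \<bar>Im s\<bar> powr (3 / 4 - \<sigma>0 / 2)"
proof -
  \<comment> \<open>Half of the slack between \<open>1/2 - \<sigma>0\<close> and 1;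
    \<open>t powr e\<close> absorbs the logarithm.\<close>
  define e where "e = (1 / 2 + \<sigma>0) / 2"
  have e: "e > 0" "1 / 2 - \<sigma>0 + e = 3 / 4 - \<sigma>0 / 2" using \<sigma>0 by (auto simp: e_def field_simps)
  define K where "K = 2 + 1 / (e * ln 2)"
  have K: "K \<ge> 0" using e by (simp add: K_def)
  define C where "C = 264 * 4 * K + 4 + 16 + 12 * (8 * 3)"
  have "norm (hurwitz_E a s / (s - 1)) \<le> C * \<bar>Im s\<bar> powr (3 / 4 - \<sigma>0 / 2)"
    if s: "\<sigma>0 \<le> Re s" "Re s \<le> 2" "\<bar>Im s\<bar> \<ge> 1" for s
  proof -
    define t where "t = \<bar>Im s\<bar>"
    define N where "N = nat \<lceil>t\<rceil>"
    define P where "P = t powr (3 / 4 - \<sigma>0 / 2)"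
    have t: "t \<ge> 1" using s by (simp add: t_def)
    have N: "real N \<ge> t" "real N \<le> t + 1" using t unfolding N_def by linarith+
    have N1: "N \<ge> 1" using N t by (cases N) auto
    have s1: "s \<noteq> 1" and s10: "norm (s - 1) \<ge> t"
      using s abs_Im_le_cmod[of "s - 1"] by (auto simp: t_def)
    have Na: "real N + a \<le> 4 * t" "real N + a \<ge> 1" "real N + a \<ge> t" using N a t by linarith+
    have powr4: "(4 * t) powr x \<le> 4 * t powr x" if "x \<le> 1" for x
      using powr_mono[OF that, of 4] t by (simp add: powr_mult)
    have powrP: "t powr x \<le> P" if "x \<le> 3 / 4 - \<sigma>0 / 2" for x
      unfolding P_def using that t by (intro powr_mono) auto
    have 1: "norm (\<Sum>n<N. of_real (real n + a) powr (- s) :: complex) \<le> 264 * 4 * K * P"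
    proof -
      have "1 + log 2 (t + 1) \<le> 1 + log 2 (2 * t)" using t by (intro add_left_mono) auto
      also have "\<dots> = 2 + ln t / ln 2" using t by (simp add: log_mult) (simp add: log_def)
      also have "\<dots> \<le> 2 * t powr e + (t powr e / e) / ln 2"
        using t e ln_powr_bound[of t e] ge_one_powr_ge_zero[of t e] by (intro add_mono divide_right_mono) auto
      also have "\<dots> = K * t powr e" by (simp add: K_def field_simps)
      finally have L: "1 + log 2 (t + 1) \<le> K * t powr e" .
      have "norm (\<Sum>n<N. of_real (real n + a) powr (- s) :: complex) \<le> 264 * (real N + a) powr (- \<sigma>0) * (sqrt t * (1 + log 2 (t + 1)))"
        unfolding t_def by (rule dirichlet_head_bound) (use s a N N1 \<sigma>0 in \<open>auto simp: t_def\<close>)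
      also have "\<dots> \<le> 264 * (4 * t powr (- \<sigma>0)) * (t powr (1/2) * (K * t powr e))"
      proof (intro mult_mono mult_left_mono L)
        have "(real N + a) powr (- \<sigma>0) \<le> (4 * t) powr (- \<sigma>0)" using Na \<sigma>0 by (intro powr_mono2) auto
        then show "(real N + a) powr (- \<sigma>0) \<le> 4 * t powr (- \<sigma>0)" using powr4[of "-\<sigma>0"] \<sigma>0 by linarith
        show "sqrt t \<le> t powr (1/2)" using t by (simp add: powr_half_sqrt)
      qed (use t in auto)
      also have "\<dots> = 264 * 4 * K * (t powr (- \<sigma>0) * t powr (1/2) * t powr e)" by simp
      also have "t powr (- \<sigma>0) * t powr (1/2) * t powr e = P"
        unfolding P_def using e(2) by (simp flip: powr_add)
      finally show ?thesis .
    qed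
    have nN: "norm (of_real (real N + a) powr z :: complex) = (real N + a) powr Re z" for z
      by (rule norm_real_powr) (use Na in auto)
    have 2: "norm (of_real (real N + a) powr (- s) / 2 :: complex) \<le> 4 * P"
    proof -
      have "norm (of_real (real N + a) powr (- s) / 2 :: complex) \<le> (real N + a) powr (- Re s)"
        using nN[of "-s"] by (simp add: norm_divide del: of_real_add)
      also have "\<dots> \<le> (real N + a) powr (- \<sigma>0)" using Na s by (intro powr_mono) auto
      also have "\<dots> \<le> (4 * t) powr (- \<sigma>0)" using Na \<sigma>0 by (intro powr_mono2) auto
      also have "\<dots> \<le> 4 * t powr (- \<sigma>0)" using \<sigma>0 by (intro powr4) auto
      also have "\<dots> \<le> 4 * P" using \<sigma>0 by (intro mult_left_mono powrP) auto
      finally show ?thesis .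
    qed
    have 3: "norm (of_real (real N + a) powr (1 - s) / (s - 1) :: complex) \<le> 16 * P"
    proof -
      have "norm (of_real (real N + a) powr (1 - s) / (s - 1) :: complex) \<le> (real N + a) powr (1 - Re s) / t"
        using nN[of "1-s"] s10 t by (simp add: norm_divide del: of_real_add) (intro divide_left_mono mult_pos_pos, auto)
      also have "\<dots> \<le> (real N + a) powr (1 - \<sigma>0) / t" using Na s t by (intro divide_right_mono powr_mono) auto
      also have "\<dots> \<le> (4 * t) powr (1 + - \<sigma>0) / t"
        using powr_mono2[of "1 - \<sigma>0" "real N + a" "4 * t"] Na \<sigma>0 t by (simp add: divide_right_mono)
      also have "\<dots> = 4 * (4 * t) powr (- \<sigma>0)" unfolding powr_add using t by simp
      also have "\<dots> \<le> 4 * (4 * t powr (- \<sigma>0))" using \<sigma>0 by (intro mult_left_mono powr4) auto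
      also have "\<dots> \<le> 4 * (4 * P)" using \<sigma>0 by (intro mult_left_mono powrP) auto
      finally show ?thesis by simp
    qed
    have 4: "norm ((\<Sum>n. trapezoid_error s (real (n + N) + a)) / (s - 1)) \<le> 12 * (8 * 3) * P"
    proof -
      define B where "B = 8 / t * (3 * t powr (- \<sigma>0 - 1))"
      have part: "norm (\<Sum>n<M. trapezoid_error s (real (n + N) + a)) \<le> norm (s - 1) * (norm s * norm (s + 1) / 2 * B)" for M
      proof -
        have "norm (\<Sum>n\<in>{N..<N+M}. trapezoid_error s (real n + a)) \<le> norm (s - 1) * (norm s * norm (s + 1) / 2 * B)"
        proof (rule norm_sum_trapezoid_error_le)
          fix u :: real assume u: "0 \<le> u" "u \<le> 1"
          \<comment> \<open>The integration variable \<open>u\<close> is absorbed into the real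
            offset \<open>b = a + u\<close>, so the bound is uniform in \<open>u\<close>.\<close>
          have "norm (\<Sum>n=N..<N+M. of_real (real n + (a + u)) powr (- s - 2) :: complex)
            \<le> 2 * pi / t * ((real N + (a + u)) powr (- \<sigma>0 - 1) + real N powr (- \<sigma>0 - 1) / (\<sigma>0 + 1))"
            unfolding t_def
            by (rule dirichlet_tail_bound) (use s u a N \<sigma>0 in \<open>auto simp: t_def\<close>)
          \<comment> \<open>Here \<open>\<sigma>0 + 1 \<ge> 1/2\<close> bounds the second summand by
            twice the first; this is the 3 in \<open>B\<close>.\<close>
          also have "\<dots> \<le> 8 / t * (t powr (- \<sigma>0 - 1) + t powr (- \<sigma>0 - 1) / (1 / 2))"
          proof (intro mult_mono add_mono divide_right_mono frac_le powr_mono2')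
            show "2 * pi \<le> 8" using pi_less_4 by simp
            show "t \<le> real N + (a + u)" using N a u by linarith
          qed (use t N \<sigma>0 in auto)
          also have "\<dots> = B" by (simp add: B_def)
          finally show "norm (\<Sum>n=N..<N+M. of_real (real n + a + u) powr (- s - 2) :: complex) \<le> B"
            by (simp add: add.assoc)
        qed (use a in auto)
        also have "(\<Sum>n\<in>{N..<N+M}. trapezoid_error s (real n + a)) = (\<Sum>n<M. trapezoid_error s (real (n + N) + a))"
          using sum.shift_bounds_nat_ivl[of "\<lambda>n. trapezoid_error s (real n + a)" 0 N M]
          by (simp add: lessThan_atLeast0 add.commute)
        finally show ?thesis .
      qed
      have "summable (\<lambda>n. trapezoid_error s (real (n + N) + a))"
        using summable_ignore_initial_segment[OF trapezoid_error_holomorphic(2)[OF a(1), of s], of N] s \<sigma>0 by simp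
      then have "norm (\<Sum>n. trapezoid_error s (real (n + N) + a)) \<le> norm (s - 1) * (norm s * norm (s + 1) / 2 * B)"
        by (intro tendsto_upperbound[OF tendsto_norm[OF summable_LIMSEQ]] always_eventually allI part) auto
      then have "norm ((\<Sum>n. trapezoid_error s (real (n + N) + a)) / (s - 1)) \<le> norm s * norm (s + 1) / 2 * B"
        using s1 by (simp add: norm_divide pos_divide_le_eq mult.commute)
      also have "\<dots> \<le> (3 * t) * (4 * t) / 2 * B"
      proof (intro mult_right_mono divide_right_mono mult_mono)
        have "norm s \<le> \<bar>Re s\<bar> + \<bar>Im s\<bar>" by (rule cmod_le)
        moreover have "\<bar>Re s\<bar> \<le> 2" using s \<sigma>0 by (simp add: abs_le_iff)
        ultimately show "norm s \<le> 3 * t" using t by (simp add: t_def)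
        have "norm (s + 1) \<le> \<bar>Re (s + 1)\<bar> + \<bar>Im (s + 1)\<bar>" by (rule cmod_le)
        moreover have "\<bar>Re (s + 1)\<bar> \<le> 3" using s \<sigma>0 by (simp add: abs_le_iff)
        ultimately show "norm (s + 1) \<le> 4 * t" using t by (simp add: t_def)
        show "B \<ge> 0" using t by (simp add: B_def)
      qed (use t in auto)
      also have "\<dots> = 6 * 8 * 3 * (t * t powr (- \<sigma>0 - 1))" using t by (simp add: B_def field_simps)
      also have "t * t powr (- \<sigma>0 - 1) = t powr (- \<sigma>0)" using t powr_add[of t 1 "- \<sigma>0 - 1"] by simp
      also have "6 * 8 * 3 * t powr (- \<sigma>0) \<le> 12 * (8 * 3) * P" using \<sigma>0 powrP[of "-\<sigma>0"] powr_ge_zero[of t "-\<sigma>0"] by linarith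
      finally show ?thesis .
    qed
    have "hurwitz_E a s / (s - 1) = (\<Sum>n<N. of_real (real n + a) powr (- s)) + of_real (real N + a) powr (- s) / 2
     + of_real (real N + a) powr (1 - s) / (s - 1) + (\<Sum>n. trapezoid_error s (real (n + N) + a)) / (s - 1)"
    proof -
      have "((s - 1) * A + (s - 1) * B / 2 + D + F) / (s - 1) = A + B / 2 + D / (s - 1) + F / (s - 1)" for A B D F
      proof -
        have nz: "s - 1 \<noteq> 0" using s1 by simp
        show ?thesis
          using nonzero_mult_div_cancel_left[OF nz, of A] nonzero_mult_div_cancel_left[OF nz, of "B / 2"]
          by (simp only: add_divide_distrib times_divide_eq_right)
      qed
      then show ?thesis using s \<sigma>0 by (subst hurwitz_E_eq_partial[OF a(1), of _ N]) auto
    qed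
    also have "norm \<dots> \<le> 264 * 4 * K * P + 4 * P + 16 * P + 12 * (8 * 3) * P"
      using 1 2 3 4 by (intro order_trans[OF norm_triangle_ineq] add_mono)
    also have "\<dots> = C * P" by (simp add: C_def algebra_simps)
    finally show ?thesis by (simp add: P_def t_def)
  qed
  moreover have "C \<ge> 0" using K by (simp add: C_def)
  ultimately show ?thesis by blast
qed

section \<open>Dirichlet L-functions\<close>

text \<open>The difference need not be nicely meromorphic, so the identity theorem is applied to it
  after \<open>remove_sings\<close>. This gives equality near each point except possibly at the
  point itself, where the value is either the limit or, at a common pole, 0.\<close>

lemma nicely_meromorphic_unique:
  assumes f: "f nicely_meromorphic_on UNIV" and g: "g nicely_meromorphic_on UNIV"
    and eq: "\<And>s. Re s > c \<Longrightarrow> f s = g s"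
  shows "f = g"
proof
  fix w :: complex
  define d where "d z = f z - g z" for z
  have mer: "d meromorphic_on UNIV"
    using f g unfolding d_def nicely_meromorphic_on_def by (auto intro!: meromorphic_intros)
  define z0 where "z0 = complex_of_real (c + 1)"
  have "open {s. Re s > c}" by (rule open_halfspace_Re_gt)
  moreover have "z0 \<in> {s. Re s > c}" by (simp add: z0_def)
  ultimately have "eventually (\<lambda>z. z \<in> {s. Re s > c}) (at z0)"
    using eventually_at_in_open' by blast
  then have "eventually (\<lambda>z. d z = 0) (at z0)"
    by eventually_elim (simp add: d_def eq)
  moreover have rs: "eventually (\<lambda>z. remove_sings d z = d z) (at z)" for z
    by (intro eventually_remove_sings_eq_at meromorphic_on_isolated_singularity meromorphic_on_subset[OF mer]) auto
  ultimately have "eventually (\<lambda>z. remove_sings d z = 0) (at z0)"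
    using rs[of z0] by eventually_elim simp
  then have "frequently (\<lambda>z. remove_sings d z = 0) (at z0)"
    by (intro eventually_frequently) auto
  then have 0: "remove_sings d z = 0" for z
    by (rule frequently_eq_meromorphic_imp_constant[OF _ remove_sings_nicely_meromorphic[OF mer]]) auto
  have ev: "eventually (\<lambda>z. f z = g z) (at w)"
    using rs[of w] by eventually_elim (simp add: 0 d_def)
  then have pole: "is_pole f w \<longleftrightarrow> is_pole g w" by (intro is_pole_cong) auto
  have fw: "(is_pole f w \<and> f w = 0) \<or> f \<midarrow>w\<rightarrow> f w" and gw: "(is_pole g w \<and> g w = 0) \<or> g \<midarrow>w\<rightarrow> g w"
    using f g unfolding nicely_meromorphic_on_def by auto
  show "f w = g w"
  proof (cases "is_pole f w")
    case True
    then have "\<not> f \<midarrow>w\<rightarrow> f w" "\<not> g \<midarrow>w\<rightarrow> g w"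
      using pole not_tendsto_and_filterlim_at_infinity[of "at w"] unfolding is_pole_def by (auto simp: trivial_limit_at)
    then show ?thesis using fw gw by auto
  next
    case False
    then have "f \<midarrow>w\<rightarrow> f w" "g \<midarrow>w\<rightarrow> g w" using fw gw pole by auto
    moreover have "f \<midarrow>w\<rightarrow> g w \<longleftrightarrow> g \<midarrow>w\<rightarrow> g w" by (rule tendsto_cong[OF ev])
    ultimately show ?thesis using LIM_unique by blast
  qed
qed

lemma dirichlet_L_eqI:
  assumes "f nicely_meromorphic_on UNIV"
    and "\<And>s. Re s > 1 \<Longrightarrow> f s = (\<Sum>n. chi (int (Suc n)) / of_nat (Suc n) powr s)"
  shows "dirichlet_L chi = f"
  unfolding dirichlet_L_def
proof (rule the_equality)
  fix g assume "g nicely_meromorphic_on UNIV \<and> (\<forall>s. Re s > 1 \<longrightarrow> g s = (\<Sum>n. chi (int (Suc n)) / of_nat (Suc n) powr s))"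
  then show "g = f" using assms by (intro nicely_meromorphic_unique[of g f 1]) auto
qed (use assms in auto)

context
  fixes m :: nat and chi :: "int \<Rightarrow> complex"
  assumes char: "dirichlet_character m chi"
begin

lemma char_pos: "m > 0" and char_mult: "chi (a * b) = chi a * chi b"
  and char_eq_0_iff: "chi a = 0 \<longleftrightarrow> \<not> coprime a (int m)"
  using char unfolding dirichlet_character_def by metis+

lemma char_add_nat: "chi (a + int n * int m) = chi a"
proof (induction n)
  case (Suc n)
  have "chi (a + int (Suc n) * int m) = chi ((a + int n * int m) + int m)" by (simp add: algebra_simps)
  also have "\<dots> = chi (a + int n * int m)" using char unfolding dirichlet_character_def by metis
  finally show ?case using Suc by simp
qed simp

lemma char_mod: "chi (a mod int m) = chi a"
proof (cases "a div int m \<ge> 0")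
  case True
  have "chi a = chi (a mod int m + int (nat (a div int m)) * int m)" using True by (simp add: algebra_simps)
  then show ?thesis by (simp only: char_add_nat)
next
  case False
  have "chi (a mod int m) = chi (a + int (nat (- (a div int m))) * int m)"
    using False by (simp add: minus_div_mult_eq_mod[symmetric] algebra_simps)
  then show ?thesis by (simp only: char_add_nat)
qed

text \<open>A non-principal character has some \<open>b\<close> coprime to the modulus with
  \<open>chi b \<noteq> 1\<close>. Multiplication by \<open>b\<close> permutes the residues, so the
  sum is unchanged when multiplied by \<open>chi b\<close>.\<close>

lemma sum_char_eq_0:
  assumes "chi \<noteq> principal_character m"
  shows "(\<Sum>r=1..m. chi (int r)) = 0"
proof -
  have "\<exists>b. coprime b (int m) \<and> chi b \<noteq> 1"
  proof (rule ccontr)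
    assume "\<not> ?thesis"
    then have "chi a = principal_character m a" for a
      using char_eq_0_iff[of a] by (auto simp: principal_character_def)
    with assms show False by auto
  qed
  then obtain b where b: "coprime b (int m)" "chi b \<noteq> 1" by auto
  define S where "S = (\<Sum>a\<in>{0..<int m}. chi a)"
  have inj: "inj_on (\<lambda>a. (b * a) mod int m) {0..<int m}"
  proof (rule inj_onI)
    fix x y assume xy: "x \<in> {0..<int m}" "y \<in> {0..<int m}" "(b * x) mod int m = (b * y) mod int m"
    then have "int m dvd b * x - b * y" by (simp add: mod_eq_dvd_iff)
    then have "int m dvd b * (x - y)" by (simp add: algebra_simps)
    then have "int m dvd x - y" using b(1) by (simp add: coprime_dvd_mult_right_iff coprime_commute)
    then have "x mod int m = y mod int m" by (simp add: mod_eq_dvd_iff)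
    then show "x = y" using xy by simp
  qed
  have im: "(\<lambda>a. (b * a) mod int m) ` {0..<int m} = {0..<int m}"
    using char_pos by (intro card_subset_eq card_image[OF inj] finite_atLeastLessThan_int) (auto simp: card_image[OF inj])
  have "S = (\<Sum>a\<in>{0..<int m}. chi ((b * a) mod int m))"
    unfolding S_def by (subst im[symmetric], subst sum.reindex[OF inj]) simp
  also have "\<dots> = chi b * S" by (simp add: char_mod char_mult S_def sum_distrib_left)
  finally have "(chi b - 1) * S = 0" by (simp add: algebra_simps)
  then have "S = 0" using b by simp
  \<comment> \<open>Passes between the residue systems from 0 and from 1: they differ in 0 and
    \<open>m\<close>, where \<open>chi\<close> agrees.\<close>
  have "insert m {0..<m} = insert 0 {1..m}" by auto
  then have "(\<Sum>r\<in>insert m {0..<m}. chi (int r)) = (\<Sum>r\<in>insert 0 {1..m}. chi (int r))" by simp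
  then have "(\<Sum>r=1..m. chi (int r)) + chi 0 = (\<Sum>r=0..<m. chi (int r)) + chi (int m)" by (simp add: add.commute)
  moreover have "chi (int m) = chi 0" using char_mod[of "int m"] by simp
  ultimately have "(\<Sum>r=1..m. chi (int r)) = (\<Sum>r=0..<m. chi (int r))" by simp
  also have "(\<Sum>r=0..<m. chi (int r)) = S"
    unfolding S_def by (rule sum.reindex_bij_witness[of _ nat int]) auto
  finally show ?thesis using \<open>S = 0\<close> by simp
qed

text \<open>A crude stand-in for the bound 1: summing over a residue system avoids showing that
  nonzero values are roots of unity.\<close>

definition char_bound :: real where "char_bound = (\<Sum>r<m. norm (chi (int r)))"

lemma norm_char_le: "norm (chi a) \<le> char_bound"
proof -
  have "norm (chi (int (nat (a mod int m)))) \<le> char_bound"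
    unfolding char_bound_def using char_pos by (intro member_le_sum) (auto simp: nat_less_iff)
  then show ?thesis using char_pos by (simp add: char_mod)
qed

lemma char_bound_nonneg: "char_bound \<ge> 0"
  using norm_char_le[of 0] norm_ge_zero[of "chi 0"] by linarith

lemma dirichlet_series_norm:
  "norm (chi (int (Suc n)) / of_nat (Suc n) powr s) \<le> char_bound * real (Suc n) powr (- Re s)"
proof -
  have "norm (complex_of_nat (Suc n) powr s) = real (Suc n) powr Re s"
    using norm_real_powr[of "real (Suc n)" s] by (simp only: of_real_of_nat_eq of_nat_0_less_iff zero_less_Suc)
  then have "norm (chi (int (Suc n)) / of_nat (Suc n) powr s) = norm (chi (int (Suc n))) * real (Suc n) powr (- Re s)"
    by (simp only: norm_divide powr_minus) (simp only: divide_inverse)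
  also have "\<dots> \<le> char_bound * real (Suc n) powr (- Re s)"
    by (intro mult_right_mono norm_char_le) auto
  finally show ?thesis .
qed

lemma dirichlet_series_summable: "Re s > 1 \<Longrightarrow> summable (\<lambda>n. chi (int (Suc n)) / of_nat (Suc n) powr s)"
  using dirichlet_series_norm
  by (intro summable_comparison_test'[OF summable_mult[OF summable_nat_powr[of "- Re s"]]]) auto

text \<open>The terms beyond \<open>n = m\<close>, sorted by residue class and multiplied by
  \<open>s - 1\<close>. The shifts \<open>1 + r / m\<close> lie between 1 and 2, as
  \<open>hurwitz_growth\<close> requires; shifts \<open>r / m\<close> would not.\<close>

definition L_numerator :: "complex \<Rightarrow> complex" where
  "L_numerator s = of_nat m powr (- s) * (\<Sum>r=1..m. chi (int r) * hurwitz_E (1 + real r / real m) s)"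

text \<open>The first \<open>m\<close> terms, split off so that the Hurwitz shifts start above
  1.\<close>

definition L_head :: "complex \<Rightarrow> complex" where
  "L_head s = (\<Sum>r=1..m. chi (int r) * of_nat r powr (- s))"

lemma L_numerator_holomorphic: "L_numerator holomorphic_on UNIV"
  unfolding L_numerator_def [abs_def] using char_pos by (intro holomorphic_intros hurwitz_E) auto

lemma L_head_holomorphic: "L_head holomorphic_on UNIV"
  unfolding L_head_def [abs_def] by (intro holomorphic_intros) auto

text \<open>Grouping into blocks of length \<open>m\<close> turns the series into \<open>m\<close>
  series, one per residue class. Taking out \<open>m powr (- s)\<close> makes each a Hurwitz series;
  the block number 0 forms \<open>L_head\<close>.\<close>

lemma dirichlet_series_eq:
  assumes s: "Re s > 1"
  shows "(\<Sum>n. chi (int (Suc n)) / of_nat (Suc n) powr s) = L_head s + L_numerator s / (s - 1)"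
proof -
  have s1: "s \<noteq> 1" using s by auto
  define g where "g r n = chi (int r) * of_real (real (n * m + r)) powr (- s)" for r n
  have "(\<lambda>n. chi (int (Suc n)) / of_nat (Suc n) powr s) sums (\<Sum>n. chi (int (Suc n)) / of_nat (Suc n) powr s)"
    by (rule summable_sums[OF dirichlet_series_summable[OF s]])
  from sums_group[OF this char_pos]
  have "(\<lambda>n. \<Sum>i = n * m..<n * m + m. chi (int (Suc i)) / of_nat (Suc i) powr s) sums
       (\<Sum>n. chi (int (Suc n)) / of_nat (Suc n) powr s)" .
  also have "(\<lambda>n. \<Sum>i = n * m..<n * m + m. chi (int (Suc i)) / of_nat (Suc i) powr s) = (\<lambda>n. \<Sum>r=1..m. g r n)"
  proof
    fix n
    have "chi (int (n * m + r)) = chi (int r)" for r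
      using char_add_nat[of "int r" n] by (simp add: add.commute)
    then have g: "g r n = chi (int (n * m + r)) / of_nat (n * m + r) powr s" for r
      by (simp only: g_def of_real_of_nat_eq powr_minus divide_inverse)
    show "(\<Sum>i = n * m..<n * m + m. chi (int (Suc i)) / of_nat (Suc i) powr s) = (\<Sum>r=1..m. g r n)"
      unfolding g by (rule sum.reindex_bij_witness[of _ "\<lambda>r. n * m + r - 1" "\<lambda>i. Suc i - n * m"]) (auto simp del: of_nat_Suc)
  qed
  finally have 1: "(\<lambda>n. \<Sum>r=1..m. g r n) sums (\<Sum>n. chi (int (Suc n)) / of_nat (Suc n) powr s)" .
  have "(\<lambda>n. \<Sum>r=1..m. g r n) sums (\<Sum>r=1..m. chi (int r) * of_nat r powr (- s) +
      of_nat m powr (- s) * (chi (int r) * hurwitz_series (1 + real r / real m) s))"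
  proof (intro sums_sum)
    fix r assume r: "r \<in> {1..m}"
    have "(\<lambda>n. of_real (real n + (1 + real r / real m)) powr (- s)) sums hurwitz_series (1 + real r / real m) s"
      unfolding hurwitz_series_def by (intro summable_sums hurwitz_series_holomorphic s) auto
    then have "(\<lambda>n. (of_nat m powr (- s) * chi (int r)) * of_real (real n + (1 + real r / real m)) powr (- s)) sums
       ((of_nat m powr (- s) * chi (int r)) * hurwitz_series (1 + real r / real m) s)"
      by (rule sums_mult)
    also have "(\<lambda>n. (of_nat m powr (- s) * chi (int r)) * of_real (real n + (1 + real r / real m)) powr (- s)) = (\<lambda>n. g r (Suc n))"
    proof
      fix n
      have "real (Suc n * m + r) = real m * (real n + (1 + real r / real m))"
        using char_pos by (simp add: field_simps)
      then have "of_real (real (Suc n * m + r)) powr (- s) = of_real (real m * (real n + (1 + real r / real m))) powr (- s)" by (simp only:)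
      also have "\<dots> = of_nat m powr (- s) * of_real (real n + (1 + real r / real m)) powr (- s)"
        using char_pos powr_times_real[of "of_real (real m)" "of_real (real n + (1 + real r / real m))" "-s"]
        by (simp del: of_real_add of_nat_Suc)
      finally have "of_real (real (Suc n * m + r)) powr (- s) = of_nat m powr (- s) * of_real (real n + (1 + real r / real m)) powr (- s)" .
      then show "(of_nat m powr (- s) * chi (int r)) * of_real (real n + (1 + real r / real m)) powr (- s) = g r (Suc n)"
        unfolding g_def by (simp only: mult_ac)
    qed
    finally have "(\<lambda>n. g r (Suc n)) sums ((of_nat m powr (- s) * chi (int r)) * hurwitz_series (1 + real r / real m) s)" .
    note this' = sums_Suc[OF this]
    have "g r 0 = chi (int r) * of_nat r powr (- s)" by (simp add: g_def)
    with this' show "g r sums (chi (int r) * of_nat r powr (- s) +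
      of_nat m powr (- s) * (chi (int r) * hurwitz_series (1 + real r / real m) s))"
      by (simp add: add.commute mult_ac)
  qed
  with 1 have "(\<Sum>n. chi (int (Suc n)) / of_nat (Suc n) powr s) = (\<Sum>r=1..m. chi (int r) * of_nat r powr (- s) +
      of_nat m powr (- s) * (chi (int r) * hurwitz_series (1 + real r / real m) s))"
    using sums_unique2 by blast
  also have "\<dots> = L_head s + L_numerator s / (s - 1)"
    unfolding L_head_def L_numerator_def sum.distrib sum_distrib_left sum_divide_distrib
    using s1 s by (intro arg_cong2[of _ _ _ _ "(+)"] sum.cong) (auto simp: hurwitz_E(2))
  finally show ?thesis .
qed

text \<open>\<open>remove_sings\<close> turns the formula into the nicely meromorphic function
  required by the definition and changes nothing off 1. At 1 itself the quotient has a division by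
  0.\<close>

lemma dirichlet_L_eq:
  assumes "s \<noteq> 1"
  shows "dirichlet_L chi s = L_head s + L_numerator s / (s - 1)"
proof -
  define F where "F s = L_head s + L_numerator s / (s - 1)" for s
  have an: "L_head analytic_on A" "L_numerator analytic_on A" for A
    using L_head_holomorphic L_numerator_holomorphic analytic_on_holomorphic analytic_on_subset by blast+
  have mer: "F meromorphic_on UNIV"
    unfolding F_def by (intro meromorphic_intros analytic_on_imp_meromorphic_on an)
  have "F holomorphic_on UNIV - {1}"
    unfolding F_def
    by (intro holomorphic_intros holomorphic_on_subset[OF L_head_holomorphic] holomorphic_on_subset[OF L_numerator_holomorphic]) auto
  then have rs: "remove_sings F s = F s" if "s \<noteq> 1" for s
    by (intro remove_sings_at_analytic holomorphic_on_imp_analytic_at) (use that in auto)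
  have "dirichlet_L chi = remove_sings F"
  proof (rule dirichlet_L_eqI)
    show "remove_sings F nicely_meromorphic_on UNIV" by (rule remove_sings_nicely_meromorphic[OF mer])
    fix s :: complex assume s: "Re s > 1"
    then have "s \<noteq> 1" by auto
    then show "remove_sings F s = (\<Sum>n. chi (int (Suc n)) / of_nat (Suc n) powr s)"
      using rs[of s] by (simp add: dirichlet_series_eq[OF s] F_def del: of_nat_Suc)
  qed
  then show ?thesis using rs[OF assms] by (simp add: F_def)
qed

lemma dirichlet_L_holomorphic: "dirichlet_L chi holomorphic_on UNIV - {1}"
proof -
  have "(\<lambda>s. L_head s + L_numerator s / (s - 1)) holomorphic_on UNIV - {1}"
    by (intro holomorphic_intros holomorphic_on_subset[OF L_head_holomorphic] holomorphic_on_subset[OF L_numerator_holomorphic]) auto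
  then show ?thesis
    by (rule holomorphic_transform) (simp add: dirichlet_L_eq)
qed

text \<open>All Hurwitz residues are 1, so the numerator at 1 is a multiple of the sum of
  \<open>chi\<close> over a residue system, which is 0. The singularity is removable, with the
  derivative of the numerator as its value.\<close>

lemma dirichlet_L_entire:
  assumes "chi \<noteq> principal_character m"
  shows "dirichlet_L chi holomorphic_on UNIV"
proof -
  have 0: "L_numerator 1 = 0"
    using sum_char_eq_0[OF assms] by (simp add: L_numerator_def hurwitz_E_1)
  define f where "f z = (if z = 1 then deriv L_numerator 1 else L_numerator z / (z - 1))" for z
  have "f holomorphic_on UNIV"
    by (rule pole_theorem_open_0[OF L_numerator_holomorphic, of 1]) (auto simp: f_def 0)
  then have hol: "(\<lambda>s. L_head s + f s) holomorphic_on UNIV"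
    by (intro holomorphic_intros L_head_holomorphic)
  have "dirichlet_L chi = (\<lambda>s. L_head s + f s)"
  proof (rule dirichlet_L_eqI)
    show "(\<lambda>s. L_head s + f s) nicely_meromorphic_on UNIV"
      using hol by (intro analytic_on_imp_nicely_meromorphic_on) (simp add: analytic_on_open)
    fix s :: complex assume s: "Re s > 1"
    then have "s \<noteq> 1" by auto
    then show "L_head s + f s = (\<Sum>n. chi (int (Suc n)) / of_nat (Suc n) powr s)"
      unfolding dirichlet_series_eq[OF s] by (simp add: f_def)
  qed
  then show ?thesis using hol by simp
qed

lemma dirichlet_L_bounded:
  assumes "Re s \<ge> 2"
  shows "norm (dirichlet_L chi s) \<le> char_bound * (\<Sum>n. real (Suc n) powr (-2))"
proof -
  have s: "Re s > 1" "s \<noteq> 1" using assms by auto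
  have "norm (chi (int (Suc n)) / of_nat (Suc n) powr s) \<le> char_bound * real (Suc n) powr (-2)" for n
    using dirichlet_series_norm[of n s] assms char_bound_nonneg
    by (elim order_trans) (intro mult_left_mono powr_mono, auto)
  then have "norm (\<Sum>n. chi (int (Suc n)) / of_nat (Suc n) powr s) \<le> (\<Sum>n. char_bound * real (Suc n) powr (-2))"
    by (intro norm_suminf_le summable_mult summable_nat_powr) auto
  also have "\<dots> = char_bound * (\<Sum>n. real (Suc n) powr (-2))"
    by (intro suminf_mult summable_nat_powr) auto
  finally show ?thesis
    unfolding dirichlet_L_eq[OF s(2)] dirichlet_series_eq[OF s(1)] .
qed

text \<open>\<open>hurwitz_growth\<close> covers \<open>Re s \<le> 2\<close> and absolute
  convergence the rest, so no upper limit on \<open>Re s\<close> remains. The Poisson formula uses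
  rectangles extending arbitrarily far to the right.\<close>

lemma dirichlet_L_growth:
  assumes \<sigma>0: "- 1 / 2 < \<sigma>0" "\<sigma>0 \<le> 0"
  shows "\<exists>C\<ge>0. \<forall>s. \<sigma>0 \<le> Re s \<and> \<bar>Im s\<bar> \<ge> 1 \<longrightarrow> norm (dirichlet_L chi s) \<le> C * \<bar>Im s\<bar> powr (3 / 4 - \<sigma>0 / 2)"
proof -
  have "\<forall>r\<in>{1..m}. \<exists>C\<ge>0. \<forall>s. \<sigma>0 \<le> Re s \<and> Re s \<le> 2 \<and> \<bar>Im s\<bar> \<ge> 1 \<longrightarrow>
    norm (hurwitz_E (1 + real r / real m) s / (s - 1)) \<le> C * \<bar>Im s\<bar> powr (3 / 4 - \<sigma>0 / 2)"
    using char_pos \<sigma>0 by (intro ballI hurwitz_growth) auto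
  then obtain C where C: "\<And>r. r \<in> {1..m} \<Longrightarrow> C r \<ge> 0"
    "\<And>r s. r \<in> {1..m} \<Longrightarrow> \<sigma>0 \<le> Re s \<Longrightarrow> Re s \<le> 2 \<Longrightarrow> \<bar>Im s\<bar> \<ge> 1 \<Longrightarrow>
       norm (hurwitz_E (1 + real r / real m) s / (s - 1)) \<le> C r * \<bar>Im s\<bar> powr (3 / 4 - \<sigma>0 / 2)"
    by metis
  define D0 where "D0 = (\<Sum>r=1..m. char_bound * real r powr (- \<sigma>0))"
  define D1 where "D1 = real m powr (- \<sigma>0) * (\<Sum>r=1..m. char_bound * C r)"
  define D2 where "D2 = char_bound * (\<Sum>n. real (Suc n) powr (-2))"
  have nn: "D0 \<ge> 0" "D1 \<ge> 0" "D2 \<ge> 0" using C(1) char_bound_nonneg unfolding D0_def D1_def D2_def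
    by (auto intro!: sum_nonneg mult_nonneg_nonneg suminf_nonneg summable_nat_powr simp del: of_nat_Suc)
  have "norm (dirichlet_L chi s) \<le> (D0 + D1 + D2) * \<bar>Im s\<bar> powr (3 / 4 - \<sigma>0 / 2)"
    if s: "\<sigma>0 \<le> Re s" "\<bar>Im s\<bar> \<ge> 1" for s
  proof -
    define P where "P = \<bar>Im s\<bar> powr (3 / 4 - \<sigma>0 / 2)"
    have P: "P \<ge> 1" unfolding P_def using s \<sigma>0 by (intro ge_one_powr_ge_zero) auto
    have "norm (dirichlet_L chi s) \<le> (D0 + D1 + D2) * P"
    proof (cases "Re s \<ge> 2")
      case True
      have "norm (dirichlet_L chi s) \<le> D2" unfolding D2_def by (rule dirichlet_L_bounded[OF True])
      also have "\<dots> \<le> (D0 + D1 + D2) * P" using P nn mult_mono[of D2 "D0 + D1 + D2" 1 P] by simp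
      finally show ?thesis .
    next
      case False
      have s1: "s \<noteq> 1" using s by auto
      have nr: "norm (of_nat r powr (- s) :: complex) \<le> real r powr (- \<sigma>0)" if "r \<ge> 1" for r
      proof -
        have "norm (of_nat r powr (- s) :: complex) = real r powr (- Re s)"
          using norm_real_powr[of "real r" "-s"] that by simp
        also have "\<dots> \<le> real r powr (- \<sigma>0)" using s that by (intro powr_mono) auto
        finally show ?thesis .
      qed
      have "norm (L_head s) \<le> D0"
        unfolding L_head_def D0_def using nr char_bound_nonneg
        by (intro order_trans[OF norm_sum] sum_mono) (auto simp: norm_mult intro!: mult_mono norm_char_le)
      moreover have "norm (L_numerator s / (s - 1)) \<le> D1 * P"
      proof -
        have "L_numerator s / (s - 1) = of_nat m powr (- s) * (\<Sum>r=1..m. chi (int r) * (hurwitz_E (1 + real r / real m) s / (s - 1)))"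
          by (simp add: L_numerator_def sum_divide_distrib[symmetric])
        also have "norm \<dots> \<le> real m powr (- \<sigma>0) * (\<Sum>r=1..m. char_bound * (C r * P))"
          unfolding norm_mult
        proof (intro mult_mono nr order_trans[OF norm_sum] sum_mono)
          fix r assume r: "r \<in> {1..m}"
          show "norm (chi (int r) * (hurwitz_E (1 + real r / real m) s / (s - 1))) \<le> char_bound * (C r * P)"
            unfolding norm_mult P_def using C(2)[OF r, of s] s False char_bound_nonneg
            by (intro mult_mono norm_char_le) auto
        qed (use char_pos in auto)
        also have "\<dots> = D1 * P" by (simp add: D1_def sum_distrib_left sum_distrib_right mult_ac)
        finally show ?thesis .
      qed
      ultimately have "norm (dirichlet_L chi s) \<le> D0 + D1 * P"
        unfolding dirichlet_L_eq[OF s1] by (intro order_trans[OF norm_triangle_ineq] add_mono)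
      also have "\<dots> \<le> (D0 + D1 + D2) * P"
        using nn(1,3) P mult_left_mono[OF P nn(1)] mult_nonneg_nonneg[of D2 P]
        unfolding distrib_right by linarith
      finally show ?thesis .
    qed
    then show ?thesis by (simp add: P_def)
  qed
  then show ?thesis using nn by (intro exI[of _ "D0 + D1 + D2"]) auto
qed

end

section \<open>Poisson formula and growth of derivatives\<close>

lemma integrable_abs_powr:
  fixes p :: real
  assumes "p < -1"
  shows "integrable lborel (\<lambda>x::real. (1 + \<bar>x\<bar>) powr p)"
proof -
  define f where "f x = (1 + \<bar>x\<bar>) powr p * indicator {0..} x" for x :: real
  have f_meas: "f \<in> borel_measurable borel" unfolding f_def [abs_def] by measurable
  have "(\<integral>\<^sup>+x. ennreal ((1 + \<bar>x\<bar>) powr p) * indicator {0..} x \<partial>lborel) = ennreal (0 - (1 + 0) powr (p + 1) / (p + 1))"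
  proof (rule nn_integral_FTC_atLeast)
    fix x :: real assume "0 \<le> x"
    show "((\<lambda>x. (1 + x) powr (p + 1) / (p + 1)) has_real_derivative (1 + \<bar>x\<bar>) powr p) (at x)"
      using assms \<open>0 \<le> x\<close> by (auto intro!: derivative_eq_intros)
  next
    show "((\<lambda>x. (1 + x) powr (p + 1) / (p + 1)) \<longlongrightarrow> 0) at_top"
      using assms by real_asymp
  qed auto
  then have "(\<integral>\<^sup>+x. ennreal (norm (f x)) \<partial>lborel) < \<infinity>"
    by (simp add: f_def ennreal_mult' ennreal_indicator flip: ennreal_mult'')
  then have f: "integrable lborel f"
    using f_meas by (intro integrableI_bounded) auto
  \<comment> \<open>\<open>f\<close> is the right half of the function; adding its reflection covers
    the whole line, the double value at 0 being harmless for a majorant.\<close>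
  have "integrable lborel (\<lambda>x. f x + f (0 + (-1) * x))"
    using f lborel_integrable_real_affine[OF f, of "-1" 0] by auto
  then show ?thesis
    by (rule Bochner_Integration.integrable_bound) (auto simp: f_def indicator_def intro!: AE_I2)
qed

text \<open>The kernel decays like \<open>(1 + \<bar>x\<bar>) powr (-2)\<close>, so the integrand is
  dominated by the exponent \<open>e - 2 < -1\<close>. The constant \<open>M\<close> compares
  \<open>1 + \<bar>x\<bar>\<close> with
  \<open>sqrt (\<alpha>\<^sup>2 + (x - \<beta>)\<^sup>2)\<close>, which is at least
  \<open>\<alpha>\<close> and at least \<open>\<bar>x - \<beta>\<bar>\<close>.\<close>

lemma integrable_cauchy_kernel:
  fixes h :: "real \<Rightarrow> complex" and \<alpha> \<beta> :: real
  assumes \<alpha>: "\<alpha> > 0" and h: "continuous_on UNIV h" and bound: "\<And>x. norm (h x) \<le> C * (1 + \<bar>x\<bar>) powr e" and e: "e < 1"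
  shows "integrable lborel (\<lambda>x. h x / of_real (\<alpha>\<^sup>2 + (x - \<beta>)\<^sup>2))"
proof -
  define M where "M = (1 + 1 + \<bar>\<beta>\<bar> + \<alpha>) / \<alpha>"
  have M: "1 + \<bar>x\<bar> \<le> M * sqrt (\<alpha>\<^sup>2 + (x - \<beta>)\<^sup>2) \<and> M > 0" for x
  proof -
    have q1: "\<alpha> \<le> sqrt (\<alpha>\<^sup>2 + (x - \<beta>)\<^sup>2)" using \<alpha> by (simp add: real_le_rsqrt)
    have q2: "\<bar>x - \<beta>\<bar> \<le> sqrt (\<alpha>\<^sup>2 + (x - \<beta>)\<^sup>2)" by (simp add: real_le_rsqrt)
    have "1 + \<bar>x\<bar> \<le> 1 + \<bar>\<beta>\<bar> + \<bar>x - \<beta>\<bar>" by linarith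
    then have "\<alpha> * (1 + \<bar>x\<bar>) \<le> \<alpha> * (1 + \<bar>\<beta>\<bar> + \<bar>x - \<beta>\<bar>)" using \<alpha> by (intro mult_left_mono) auto
    also have "\<dots> = (1 + \<bar>\<beta>\<bar>) * \<alpha> + \<alpha> * \<bar>x - \<beta>\<bar>" by (simp add: algebra_simps)
    also have "\<dots> \<le> (1 + \<bar>\<beta>\<bar>) * sqrt (\<alpha>\<^sup>2 + (x - \<beta>)\<^sup>2) + \<alpha> * sqrt (\<alpha>\<^sup>2 + (x - \<beta>)\<^sup>2)"
      using q1 q2 \<alpha> by (intro add_mono mult_left_mono) auto
    also have "\<dots> \<le> (1 + 1 + \<bar>\<beta>\<bar> + \<alpha>) * sqrt (\<alpha>\<^sup>2 + (x - \<beta>)\<^sup>2)" by (simp add: algebra_simps)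
    finally show ?thesis using \<alpha> by (simp add: M_def field_simps)
  qed
  have C: "C \<ge> 0" using order_trans[OF norm_ge_zero bound[of 0]] by simp
  have "integrable lborel (\<lambda>x. C * M\<^sup>2 * (1 + \<bar>x\<bar>) powr (e - 2))"
    using e by (intro integrable_mult_right integrable_abs_powr) auto
  then show ?thesis
  proof (rule Bochner_Integration.integrable_bound)
    have "continuous_on UNIV (\<lambda>x. h x / of_real (\<alpha>\<^sup>2 + (x - \<beta>)\<^sup>2))"
    proof (intro continuous_on_divide h continuous_intros ballI)
      fix x :: real
      have "\<alpha>\<^sup>2 + (x - \<beta>)\<^sup>2 > 0" using \<alpha> by (intro add_pos_nonneg) auto
      then show "complex_of_real (\<alpha>\<^sup>2 + (x - \<beta>)\<^sup>2) \<noteq> 0" unfolding of_real_eq_0_iff by linarith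
    qed
    then show "(\<lambda>x. h x / of_real (\<alpha>\<^sup>2 + (x - \<beta>)\<^sup>2)) \<in> borel_measurable lborel"
      by (simp only: measurable_lborel2 borel_measurable_continuous_onI)
    show "AE x in lborel. norm (h x / of_real (\<alpha>\<^sup>2 + (x - \<beta>)\<^sup>2)) \<le> norm (C * M\<^sup>2 * (1 + \<bar>x\<bar>) powr (e - 2))"
    proof (rule AE_I2)
      fix x :: real
      define q where "q = \<alpha>\<^sup>2 + (x - \<beta>)\<^sup>2"
      have q: "q > 0" using \<alpha> by (simp add: q_def add_pos_nonneg)
      have "(1 + \<bar>x\<bar>)\<^sup>2 \<le> (M * sqrt q)\<^sup>2" using M[of x] by (intro power_mono) (auto simp: q_def)
      also have "\<dots> = M\<^sup>2 * q" using q by (simp add: power_mult_distrib)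
      finally have Mq: "(1 + \<bar>x\<bar>)\<^sup>2 \<le> M\<^sup>2 * q" .
      have "norm (h x / of_real q) = norm (h x) / q" using q by (simp add: norm_divide)
      also have "\<dots> \<le> (C * (1 + \<bar>x\<bar>) powr e) / q" using q bound by (intro divide_right_mono) auto
      also have "\<dots> \<le> (C * (1 + \<bar>x\<bar>) powr e) * (M\<^sup>2 / (1 + \<bar>x\<bar>)\<^sup>2)"
      proof -
        have "1 / q \<le> M\<^sup>2 / (1 + \<bar>x\<bar>)\<^sup>2" using Mq q by (simp add: field_simps)
        then show ?thesis using C mult_left_mono[of "1/q" "M\<^sup>2 / (1 + \<bar>x\<bar>)\<^sup>2" "C * (1 + \<bar>x\<bar>) powr e"] by simp
      qed
      also have "\<dots> = C * M\<^sup>2 * (1 + \<bar>x\<bar>) powr (e - 2)"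
        by (simp add: powr_diff)
      finally show "norm (h x / of_real (\<alpha>\<^sup>2 + (x - \<beta>)\<^sup>2)) \<le> norm (C * M\<^sup>2 * (1 + \<bar>x\<bar>) powr (e - 2))"
        using C by (simp add: q_def)
    qed
  qed
qed

text \<open>Cauchy's formula at \<open>w\<close> with the extra factor
  \<open>2 * \<alpha> / (z - (c - \<alpha>))\<close>, where \<open>c - \<alpha>\<close> is the
  mirror image of \<open>w\<close> in the line through \<open>c\<close>. On this line the two
  denominators multiply to minus the Cauchy kernel's denominator. On the other three sides of the
  rectangle the integrand is \<open>O(R powr (e - 2))\<close> and the lengths are
  \<open>O(R)\<close>, so they vanish since \<open>e < 1\<close>.\<close>

theorem poisson_half_plane:
  fixes g :: "complex \<Rightarrow> complex" and \<alpha> \<beta> :: real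
  assumes \<alpha>: "\<alpha> > 0" and g: "g holomorphic_on UNIV"
    and bound: "\<And>z. Re z \<ge> Re s \<Longrightarrow> norm (g z) \<le> C * (1 + \<bar>Im z\<bar>) powr e" and e: "0 \<le> e" "e < 1"
  shows "of_real (\<alpha> / pi) * (LINT \<tau>|lborel. g (s + \<i> * of_real \<tau>) / of_real (\<alpha>\<^sup>2 + (\<tau> - \<beta>)\<^sup>2)) = g (s + of_real \<alpha> + \<i> * of_real \<beta>)"
proof -
  define c where "c = s + \<i> * of_real \<beta>"
  define w where "w = c + of_real \<alpha>"
  define F where "F z = g z * of_real (2 * \<alpha>) / (z - (c - of_real \<alpha>))" for z
  define G where "G z = F z / (z - w)" for z
  define h where "h y = g (c + \<i> * of_real y) / of_real (\<alpha>\<^sup>2 + y\<^sup>2)" for y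
  have C: "C \<ge> 0"
  proof -
    have "0 \<le> C * (1 + \<bar>Im s\<bar>) powr e" using order_trans[OF norm_ge_zero bound[of s]] by simp
    moreover have "(1 + \<bar>Im s\<bar>) powr e > 0" by simp
    ultimately show ?thesis by (meson mult_neg_pos not_le)
  qed
  have Rec: "Re c = Re s" by (simp add: c_def)
  define B where "B R = C * (1 + \<bar>Im c\<bar> + R) powr e" for R :: real
  have gB: "norm (g z) \<le> B R" if "Re z \<ge> Re c" "\<bar>Im z - Im c\<bar> \<le> R" for z R
  proof -
    have "norm (g z) \<le> C * (1 + \<bar>Im z\<bar>) powr e" using that Rec by (intro bound) auto
    also have "\<dots> \<le> B R" unfolding B_def using that C e by (intro mult_left_mono powr_mono2) auto
    finally show ?thesis .
  qed
  have main: "norm (of_real (\<alpha> / pi) * integral {-R..R} h - g w) \<le> 12 * \<alpha> * (B R / R)" if R: "R > 2 * \<alpha>" for R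
  proof -
    have R0: "R > 0" using R \<alpha> by simp
    define a1 a2 a3 a4 where "a1 = c - \<i> * of_real R" and "a2 = c + of_real R - \<i> * of_real R"
      and "a3 = c + of_real R + \<i> * of_real R" and "a4 = c + \<i> * of_real R"
    have B0: "B R \<ge> 0" using C by (simp add: B_def)
    \<comment> \<open>Wide enough to contain the left edge in its interior; the mirror point
      \<open>c - \<alpha>\<close> lies on its boundary, so \<open>F\<close> is holomorphic on
      \<open>S\<close>.\<close>
    define S where "S = {z. Re z > Re c - \<alpha>}"
    have "F holomorphic_on S"
      unfolding F_def S_def by (intro holomorphic_intros holomorphic_on_subset[OF g]) auto
    have "open S" unfolding S_def by (rule open_halfspace_Re_gt)
    have wbox: "w \<in> box a1 a3" using R \<alpha> by (simp add: in_box_complex_iff w_def a1_def a3_def)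
    have pim: "path_image (rectpath a1 a3) \<subseteq> S - {w}"
    proof -
      have "path_image (rectpath a1 a3) = cbox a1 a3 - box a1 a3"
        using R0 by (intro path_image_rectpath_cbox_minus_box) (auto simp: a1_def a3_def)
      moreover have "z \<in> S" if "z \<in> cbox a1 a3" for z
        using that \<alpha> by (simp add: S_def in_cbox_complex_iff a1_def)
      ultimately show ?thesis using wbox by blast
    qed
    have "(G has_contour_integral (2 * pi * \<i> * winding_number (rectpath a1 a3) w * F w)) (rectpath a1 a3)"
      unfolding G_def
    proof (rule Cauchy_integral_formula_convex_simple[of S])
      show "convex S" unfolding S_def by (rule convex_halfspace_Re_gt)
      show "w \<in> interior S" using \<alpha> interior_open[OF \<open>open S\<close>] by (simp add: S_def w_def)
    qed (use \<open>F holomorphic_on S\<close> pim in auto)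
    also have "winding_number (rectpath a1 a3) w = 1" by (rule winding_number_rectpath[OF wbox])
    also have "F w = g w" using \<alpha> by (simp add: F_def w_def)
    finally have 1: "contour_integral (rectpath a1 a3) G = 2 * pi * \<i> * g w"
      by (simp add: contour_integral_unique)
    have "G holomorphic_on S - {w}" unfolding G_def
      by (intro holomorphic_intros holomorphic_on_subset[OF \<open>F holomorphic_on S\<close>]) auto
    then have contG: "continuous_on (S - {w}) G" by (rule holomorphic_on_imp_continuous_on)
    have rp: "rectpath a1 a3 = linepath a1 a2 +++ linepath a2 a3 +++ linepath a3 a4 +++ linepath a4 a1"
    proof -
      have "Complex (Re a3) (Im a1) = a2" "Complex (Re a1) (Im a3) = a4"
        by (simp_all add: a1_def a2_def a3_def a4_def complex_eq_iff)
      then show ?thesis by (simp add: rectpath_def Let_def)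
    qed
    have sub: "closed_segment a1 a2 \<subseteq> S - {w}" "closed_segment a2 a3 \<subseteq> S - {w}" "closed_segment a3 a4 \<subseteq> S - {w}" "closed_segment a4 a1 \<subseteq> S - {w}"
      using pim unfolding rp by (auto simp: path_image_join)
    have int: "G contour_integrable_on linepath a1 a2" "G contour_integrable_on linepath a2 a3" "G contour_integrable_on linepath a3 a4" "G contour_integrable_on linepath a4 a1"
      using sub by (auto intro!: contour_integrable_continuous_linepath continuous_on_subset[OF contG])
    have 2: "contour_integral (rectpath a1 a3) G = contour_integral (linepath a1 a2) G + contour_integral (linepath a2 a3) G
       + contour_integral (linepath a3 a4) G + contour_integral (linepath a4 a1) G"
      unfolding rp using int by simp
    have Gn: "norm (G z) \<le> B R * (2 * \<alpha>) / (p * q)" if "p > 0" "q > 0" "p \<le> norm (z - (c - of_real \<alpha>))" "q \<le> norm (z - w)" "Re z \<ge> Re c" "\<bar>Im z - Im c\<bar> \<le> R" for p q z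
    proof -
      have "norm (G z) = norm (g z) * (2 * \<alpha>) / (norm (z - (c - of_real \<alpha>)) * norm (z - w))"
        using \<alpha> by (simp add: G_def F_def norm_mult norm_divide)
      also have "\<dots> \<le> B R * (2 * \<alpha>) / (p * q)"
        using that \<alpha> B0 gB[OF that(5,6)] by (intro frac_le mult_mono mult_right_mono mult_nonneg_nonneg mult_pos_pos) auto
      finally show ?thesis .
    qed
    have horiz: "norm (G z) \<le> B R * (2 * \<alpha>) / (R * R)" if "Re z \<ge> Re c" "\<bar>Im z - Im c\<bar> = R" for z
    proof (rule Gn)
      show "R \<le> norm (z - (c - of_real \<alpha>))" "R \<le> norm (z - w)"
        using abs_Im_le_cmod[of "z - (c - of_real \<alpha>)"] abs_Im_le_cmod[of "z - w"] that by (auto simp: w_def)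
    qed (use that R0 in auto)
    have e1: "norm (contour_integral (linepath a1 a2) G) \<le> B R * (2 * \<alpha>) / (R * R) * norm (a2 - a1)"
    proof (rule contour_integral_bound_linepath[OF int(1)])
      fix z assume "z \<in> closed_segment a1 a2"
      then have "z \<in> {z. Im z = Im c - R \<and> Re z \<in> closed_segment (Re a1) (Re a2)}"
        by (subst (asm) closed_segment_same_Im) (auto simp: a1_def a2_def)
      then show "norm (G z) \<le> B R * (2 * \<alpha>) / (R * R)"
        using R0 by (intro horiz) (auto simp: a1_def a2_def closed_segment_eq_real_ivl)
    qed (use B0 \<alpha> R0 in auto)
    have e3: "norm (contour_integral (linepath a3 a4) G) \<le> B R * (2 * \<alpha>) / (R * R) * norm (a4 - a3)"
    proof (rule contour_integral_bound_linepath[OF int(3)])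
      fix z assume "z \<in> closed_segment a3 a4"
      then have "z \<in> {z. Im z = Im c + R \<and> Re z \<in> closed_segment (Re a3) (Re a4)}"
        by (subst (asm) closed_segment_same_Im) (auto simp: a3_def a4_def)
      then show "norm (G z) \<le> B R * (2 * \<alpha>) / (R * R)"
        using R0 by (intro horiz) (auto simp: a3_def a4_def closed_segment_eq_real_ivl)
    qed (use B0 \<alpha> R0 in auto)
    \<comment> \<open>On the right edge the distance to \<open>w\<close> is at least
      \<open>R - \<alpha>\<close>, which exceeds \<open>R / 2\<close> because
      \<open>R > 2 * \<alpha>\<close>.\<close>
    have e2: "norm (contour_integral (linepath a2 a3) G) \<le> B R * (2 * \<alpha>) / (R * (R / 2)) * norm (a3 - a2)"
    proof (rule contour_integral_bound_linepath[OF int(2)])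
      fix z assume "z \<in> closed_segment a2 a3"
      then have "z \<in> {z. Re z = Re c + R \<and> Im z \<in> closed_segment (Im a2) (Im a3)}"
        by (subst (asm) closed_segment_same_Re) (auto simp: a2_def a3_def)
      then have z: "Re z = Re c + R" "\<bar>Im z - Im c\<bar> \<le> R"
        using R0 by (auto simp: a2_def a3_def closed_segment_eq_real_ivl)
      show "norm (G z) \<le> B R * (2 * \<alpha>) / (R * (R / 2))"
      proof (rule Gn)
        show "R \<le> norm (z - (c - of_real \<alpha>))" using complex_Re_le_cmod[of "z - (c - of_real \<alpha>)"] z \<alpha> by simp
        show "R / 2 \<le> norm (z - w)" using complex_Re_le_cmod[of "z - w"] z R by (simp add: w_def)
      qed (use z R0 in auto)
    qed (use B0 \<alpha> R0 in auto)
    \<comment> \<open>The left edge runs downwards; this sign and the minus sign in front of the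
      kernel cancel.\<close>
    have "contour_integral (linepath a4 a1) G = - contour_integral (linepath a1 a4) G"
      using contour_integral_reversepath[of "linepath a4 a1" G] by simp
    also have "contour_integral (linepath a1 a4) G = \<i> * integral {Im c - R..Im c + R} (\<lambda>y. G (Complex (Re c) y))"
      using R0 by (intro contour_integral_linepath_same_Re) (auto simp: a1_def a4_def)
    also have "integral {Im c - R..Im c + R} (\<lambda>y. G (Complex (Re c) y)) = integral {-R..R} (\<lambda>y. G (Complex (Re c) (y + Im c)))"
      using integral_shift_Icc_real[of "-R" R "\<lambda>y. G (Complex (Re c) y)" "Im c"] by (simp add: o_def add.commute)
    also have "\<dots> = integral {-R..R} (\<lambda>y. - of_real (2 * \<alpha>) * h y)"
    proof (rule integral_cong)
      fix y :: real
      have z: "Complex (Re c) (y + Im c) = c + \<i> * of_real y" by (simp add: complex_eq_iff)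
      have "(c + \<i> * of_real y - (c - of_real \<alpha>)) * (c + \<i> * of_real y - w) = - of_real (\<alpha>\<^sup>2 + y\<^sup>2)"
        by (simp add: w_def algebra_simps power2_eq_square)
      then show "G (Complex (Re c) (y + Im c)) = - of_real (2 * \<alpha>) * h y"
        unfolding z G_def F_def h_def divide_divide_eq_left
        by (simp only: minus_divide_right[symmetric] minus_divide_left mult_minus_left times_divide_eq_right mult_ac)
    qed
    finally have e4: "contour_integral (linepath a4 a1) G = 2 * \<i> * of_real \<alpha> * integral {-R..R} h"
      by simp
    have "2 * pi * \<i> * (g w - of_real (\<alpha> / pi) * integral {-R..R} h) = contour_integral (linepath a1 a2) G + contour_integral (linepath a2 a3) G
       + contour_integral (linepath a3 a4) G"
    proof -
      have "2 * pi * \<i> * (g w - of_real (\<alpha> / pi) * integral {-R..R} h) = contour_integral (rectpath a1 a3) G - contour_integral (linepath a4 a1) G"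
        unfolding 1 e4 by (simp add: field_simps)
      then show ?thesis unfolding 2 by simp
    qed
    also have "norm \<dots> \<le> B R * (2 * \<alpha>) / (R * R) * norm (a2 - a1) + B R * (2 * \<alpha>) / (R * (R / 2)) * norm (a3 - a2)
        + B R * (2 * \<alpha>) / (R * R) * norm (a4 - a3)"
      by (intro order_trans[OF norm_triangle_ineq] add_mono e1 e2 e3)
    finally have est: "norm (2 * pi * \<i> * (g w - of_real (\<alpha> / pi) * integral {-R..R} h)) \<le> B R * (2 * \<alpha>) / (R * R) * norm (a2 - a1)
        + B R * (2 * \<alpha>) / (R * (R / 2)) * norm (a3 - a2) + B R * (2 * \<alpha>) / (R * R) * norm (a4 - a3)" .
    have diffs: "a2 - a1 = of_real R" "a3 - a2 = of_real (2 * R) * \<i>" "a4 - a3 = of_real (- R)"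
      by (simp_all add: a1_def a2_def a3_def a4_def)
    note est
    also have "B R * (2 * \<alpha>) / (R * R) * norm (a2 - a1) + B R * (2 * \<alpha>) / (R * (R / 2)) * norm (a3 - a2) + B R * (2 * \<alpha>) / (R * R) * norm (a4 - a3) =
      B R * (2 * \<alpha>) / (R * R) * norm (of_real R :: complex) + B R * (2 * \<alpha>) / (R * (R / 2)) * norm (of_real (2 * R) * \<i> :: complex)
        + B R * (2 * \<alpha>) / (R * R) * norm (of_real (- R) :: complex)"
      unfolding diffs by (rule refl)
    also have "\<dots> =
      B R * (2 * \<alpha>) / (R * R) * R + B R * (2 * \<alpha>) / (R * (R / 2)) * (2 * R) + B R * (2 * \<alpha>) / (R * R) * R"
      unfolding norm_mult norm_of_real norm_ii using R0 by simp
    also have "\<dots> = 12 * \<alpha> * (B R / R)" using R0 by (simp add: field_simps)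
    finally have "2 * pi * norm (g w - of_real (\<alpha> / pi) * integral {-R..R} h) \<le> 12 * \<alpha> * (B R / R)"
      by (simp add: norm_mult)
    moreover have "norm (g w - of_real (\<alpha> / pi) * integral {-R..R} h) \<le> 2 * pi * norm (g w - of_real (\<alpha> / pi) * integral {-R..R} h)"
      using pi_gt3 by (simp add: mult_le_cancel_right1)
    ultimately show ?thesis by (simp add: norm_minus_commute)
  qed
  have shift: "g (s + \<i> * of_real \<tau>) / of_real (\<alpha>\<^sup>2 + (\<tau> - \<beta>)\<^sup>2) = h (- \<beta> + 1 * \<tau>)" for \<tau>
    by (simp add: h_def c_def algebra_simps)
  have "continuous_on UNIV (\<lambda>\<tau>. g (s + \<i> * of_real \<tau>))"
    by (intro continuous_on_compose2[OF holomorphic_on_imp_continuous_on[OF g]] continuous_intros) auto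
  moreover have "norm (g (s + \<i> * of_real \<tau>)) \<le> (C * (1 + \<bar>Im s\<bar>) powr e) * (1 + \<bar>\<tau>\<bar>) powr e" for \<tau>
  proof -
    have "norm (g (s + \<i> * of_real \<tau>)) \<le> C * (1 + \<bar>Im s + \<tau>\<bar>) powr e"
      using bound[of "s + \<i> * of_real \<tau>"] by simp
    also have "\<dots> \<le> C * ((1 + \<bar>Im s\<bar>) * (1 + \<bar>\<tau>\<bar>)) powr e"
    proof (intro mult_left_mono powr_mono2)
      have "0 \<le> \<bar>Im s\<bar> * \<bar>\<tau>\<bar>" by simp
      then show "1 + \<bar>Im s + \<tau>\<bar> \<le> (1 + \<bar>Im s\<bar>) * (1 + \<bar>\<tau>\<bar>)"
        using abs_triangle_ineq[of "Im s" \<tau>] unfolding distrib_left distrib_right by linarith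
    qed (use C e in auto)
    finally show ?thesis by (simp add: powr_mult)
  qed
  ultimately have "integrable lborel (\<lambda>\<tau>. g (s + \<i> * of_real \<tau>) / of_real (\<alpha>\<^sup>2 + (\<tau> - \<beta>)\<^sup>2))"
    using \<alpha> e by (intro integrable_cauchy_kernel) auto
  then have hint: "integrable lborel h"
    unfolding shift using lborel_integrable_real_affine_iff[of 1 h "-\<beta>"] by simp
  have lint: "(LINT \<tau>|lborel. g (s + \<i> * of_real \<tau>) / of_real (\<alpha>\<^sup>2 + (\<tau> - \<beta>)\<^sup>2)) = integral\<^sup>L lborel h"
    unfolding shift using lborel_integral_real_affine[of 1 h "-\<beta>"] by simp
  have lim1: "(\<lambda>n. integral {- real n..real n} h) \<longlonglongrightarrow> integral\<^sup>L lborel h"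
  proof -
    have "(\<lambda>n. LINT x|lborel. indicator {- real n..real n} x *\<^sub>R h x) \<longlonglongrightarrow> integral\<^sup>L lborel h"
    proof (rule integral_dominated_convergence)
      show "integrable lborel (\<lambda>x. norm (h x))" using hint by simp
      show "AE x in lborel. (\<lambda>n. indicator {- real n..real n} x *\<^sub>R h x) \<longlonglongrightarrow> h x"
      proof (rule AE_I2)
        fix x :: real
        obtain N :: nat where N: "\<bar>x\<bar> \<le> real N" using real_arch_simple by blast
        have "eventually (\<lambda>n. indicator {- real n..real n} x *\<^sub>R h x = h x) sequentially"
          using eventually_ge_at_top[of N]
        proof eventually_elim
          case (elim n)
          then have "\<bar>x\<bar> \<le> real n" using N by linarith
          then show ?case by (auto simp: indicator_def)
        qed
        then show "(\<lambda>n. indicator {- real n..real n} x *\<^sub>R h x) \<longlonglongrightarrow> h x" by (rule tendsto_eventually)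
      qed
      show "AE x in lborel. norm (indicator {- real n..real n} x *\<^sub>R h x) \<le> norm (h x)" for n
        by (auto simp: indicator_def)
    qed (use hint in auto)
    moreover have "(LINT x|lborel. indicator {- real n..real n} x *\<^sub>R h x) = integral {- real n..real n} h" for n
    proof -
      have "set_integrable lborel {- real n..real n} h"
        unfolding set_integrable_def using hint by (intro integrable_mult_indicator) auto
      from set_borel_integral_eq_integral(2)[OF this] show ?thesis by (simp add: set_lebesgue_integral_def)
    qed
    ultimately show ?thesis by simp
  qed
  have "(\<lambda>n. 12 * \<alpha> * (C * (1 + \<bar>Im c\<bar> + real n) powr e / real n)) \<longlonglongrightarrow> 0"
    using e by real_asymp
  then have "(\<lambda>n. of_real (\<alpha> / pi) * integral {- real n..real n} h - g w) \<longlonglongrightarrow> 0"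
  proof (rule Lim_null_comparison[rotated])
    show "eventually (\<lambda>n. norm (of_real (\<alpha> / pi) * integral {- real n..real n} h - g w) \<le> 12 * \<alpha> * (C * (1 + \<bar>Im c\<bar> + real n) powr e / real n)) sequentially"
      using eventually_gt_at_top[of "nat \<lceil>2 * \<alpha>\<rceil>"]
    proof eventually_elim
      case (elim n)
      then have "real n > 2 * \<alpha>" by linarith
      from main[OF this] show ?case by (simp add: B_def)
    qed
  qed
  moreover have "(\<lambda>n. of_real (\<alpha> / pi) * integral {- real n..real n} h - g w) \<longlonglongrightarrow> of_real (\<alpha> / pi) * integral\<^sup>L lborel h - g w"
    by (intro tendsto_intros lim1)
  ultimately have "of_real (\<alpha> / pi) * integral\<^sup>L lborel h - g w = 0"
    using LIMSEQ_unique by blast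
  then show ?thesis unfolding lint by (simp add: w_def c_def algebra_simps)
qed


section \<open>Growth of the derivatives of L-functions\<close>

lemma Re_Im_circle:
  assumes "norm (z - w) = r"
  shows "Re w \<ge> Re z - r" "\<bar>Im w\<bar> \<le> \<bar>Im z\<bar> + r" "\<bar>Im w\<bar> \<ge> \<bar>Im z\<bar> - r"
  using abs_Re_le_cmod[of "z - w"] abs_Im_le_cmod[of "z - w"] assms by auto

text \<open>Cauchy's inequality on circles of radius \<open>r\<close>. Since
  \<open>\<bar>Im z\<bar> \<ge> 2\<close> and \<open>r \<le> 1\<close>, the circles stay where
  \<open>\<bar>Im w\<bar> \<ge> 1\<close>, away from the possible pole and inside the range of
  \<open>dirichlet_L_growth\<close>.\<close>

lemma dirichlet_L_deriv_growth:
  assumes char: "dirichlet_character m chi" and \<sigma>: "\<sigma> > - 1 / 2"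
  shows "\<exists>C e. 0 \<le> C \<and> 0 \<le> e \<and> e < 1 \<and>
    (\<forall>z. \<sigma> \<le> Re z \<and> \<bar>Im z\<bar> \<ge> 2 \<longrightarrow> norm ((deriv ^^ k) (dirichlet_L chi) z) \<le> C * (1 + \<bar>Im z\<bar>) powr e)"
proof -
  \<comment> \<open>\<open>dirichlet_L_growth\<close> asks for an abscissa at most 0. The radius
    \<open>r\<close> is half the distance from \<open>\<sigma>1\<close> to -1/2, so
    \<open>\<sigma>0 = \<sigma>1 - r\<close> is still above -1/2.\<close>
  define \<sigma>1 where "\<sigma>1 = min \<sigma> 0"
  define r where "r = (\<sigma>1 + 1 / 2) / 2"
  define \<sigma>0 where "\<sigma>0 = \<sigma>1 - r"
  define e where "e = 3 / 4 - \<sigma>0 / 2"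
  have r: "0 < r" "r \<le> 1" and \<sigma>0: "- 1 / 2 < \<sigma>0" "\<sigma>0 \<le> 0" "\<sigma>0 \<le> \<sigma> - r"
    using \<sigma> by (auto simp: r_def \<sigma>0_def \<sigma>1_def min_def field_simps)
  have e: "0 \<le> e" "e < 1" using \<sigma>0 by (auto simp: e_def)
  obtain C where C: "C \<ge> 0" "\<And>s. \<sigma>0 \<le> Re s \<Longrightarrow> \<bar>Im s\<bar> \<ge> 1 \<Longrightarrow> norm (dirichlet_L chi s) \<le> C * \<bar>Im s\<bar> powr e"
    using dirichlet_L_growth[OF char \<sigma>0(1,2)] unfolding e_def by blast
  have "norm ((deriv ^^ k) (dirichlet_L chi) z) \<le> (fact k * C / r ^ k) * (1 + \<bar>Im z\<bar>) powr e"
    if z: "\<sigma> \<le> Re z" "\<bar>Im z\<bar> \<ge> 2" for z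
  proof -
    have hol: "dirichlet_L chi holomorphic_on cball z r"
    proof (rule holomorphic_on_subset[OF dirichlet_L_holomorphic[OF char]])
      have "1 \<notin> cball z r"
        using abs_Im_le_cmod[of "z - 1"] z r by (auto simp: dist_norm)
      then show "cball z r \<subseteq> UNIV - {1}" by blast
    qed
    have "norm ((deriv ^^ k) (dirichlet_L chi) z) \<le> fact k * (C * (1 + \<bar>Im z\<bar>) powr e) / r ^ k"
    proof (rule Cauchy_inequality)
      show "dirichlet_L chi holomorphic_on ball z r" by (rule holomorphic_on_subset[OF hol]) auto
      show "continuous_on (cball z r) (dirichlet_L chi)" by (rule holomorphic_on_imp_continuous_on[OF hol])
      fix w assume w: "norm (z - w) = r"
      have "norm (dirichlet_L chi w) \<le> C * \<bar>Im w\<bar> powr e"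
        using Re_Im_circle[OF w] z r \<sigma>0 by (intro C) auto
      also have "\<dots> \<le> C * (1 + \<bar>Im z\<bar>) powr e"
        using Re_Im_circle[OF w] r C e by (intro mult_left_mono powr_mono2) auto
      finally show "norm (dirichlet_L chi w) \<le> C * (1 + \<bar>Im z\<bar>) powr e" .
    qed (use r in auto)
    then show ?thesis by (simp add: field_simps)
  qed
  moreover have "0 \<le> fact k * C / r ^ k" using C r by simp
  ultimately show ?thesis using e by blast
qed

text \<open>Only the strip \<open>\<bar>Im z\<bar> < 2\<close> is new. Its part with
  \<open>Re z \<le> 3\<close> is compact, where the entire function is bounded; to the right of it,
  unit circles stay in the region \<open>Re w \<ge> 2\<close>, where the Dirichlet series is
  bounded.\<close>

lemma dirichlet_L_deriv_growth_entire:
  assumes char: "dirichlet_character m chi" and np: "chi \<noteq> principal_character m" and \<sigma>: "\<sigma> > - 1 / 2"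
  shows "\<exists>C e. 0 \<le> C \<and> 0 \<le> e \<and> e < 1 \<and>
    (\<forall>z. \<sigma> \<le> Re z \<longrightarrow> norm ((deriv ^^ k) (dirichlet_L chi) z) \<le> C * (1 + \<bar>Im z\<bar>) powr e)"
proof -
  note ent = dirichlet_L_entire[OF char np]
  obtain C e where C: "0 \<le> C" "0 \<le> e" "e < 1"
    and C': "\<And>z. \<sigma> \<le> Re z \<Longrightarrow> \<bar>Im z\<bar> \<ge> 2 \<Longrightarrow> norm ((deriv ^^ k) (dirichlet_L chi) z) \<le> C * (1 + \<bar>Im z\<bar>) powr e"
    using dirichlet_L_deriv_growth[OF char \<sigma>] by blast
  define B where "B = char_bound m chi * (\<Sum>n. real (Suc n) powr (-2))"
  have B: "norm (dirichlet_L chi w) \<le> B" if "Re w \<ge> 2" for w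
    unfolding B_def by (rule dirichlet_L_bounded[OF char that])
  have B0: "B \<ge> 0" using order_trans[OF norm_ge_zero B[of 2]] by simp
  define K where "K = cbox (Complex \<sigma> (-2)) (Complex 3 2)"
  have "continuous_on K ((deriv ^^ k) (dirichlet_L chi))"
    by (intro holomorphic_on_imp_continuous_on holomorphic_on_subset[OF holomorphic_higher_deriv[OF ent open_UNIV]]) auto
  then have "bounded ((deriv ^^ k) (dirichlet_L chi) ` K)"
    by (intro compact_imp_bounded compact_continuous_image) (auto simp: K_def)
  then obtain D where D: "\<And>z. z \<in> K \<Longrightarrow> norm ((deriv ^^ k) (dirichlet_L chi) z) \<le> D"
    unfolding bounded_iff by blast
  have "norm ((deriv ^^ k) (dirichlet_L chi) z) \<le> (C + \<bar>D\<bar> + fact k * B) * (1 + \<bar>Im z\<bar>) powr e" if z: "\<sigma> \<le> Re z" for z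
  proof -
    define P where "P = (1 + \<bar>Im z\<bar>) powr e"
    have P: "P \<ge> 1" unfolding P_def using C by (intro ge_one_powr_ge_zero) auto
    have "norm ((deriv ^^ k) (dirichlet_L chi) z) \<le> C * P \<or> norm ((deriv ^^ k) (dirichlet_L chi) z) \<le> \<bar>D\<bar> * 1
      \<or> norm ((deriv ^^ k) (dirichlet_L chi) z) \<le> fact k * B * 1"
    proof (cases "\<bar>Im z\<bar> \<ge> 2")
      case True
      then show ?thesis using C'[OF z] by (simp add: P_def)
    next
      case im: False
      show ?thesis
      proof (cases "Re z \<le> 3")
        case True
        then have "z \<in> K" using z im by (auto simp: K_def in_cbox_complex_iff)
        from D[OF this] have "norm ((deriv ^^ k) (dirichlet_L chi) z) \<le> \<bar>D\<bar>" by linarith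
        then show ?thesis by simp
      next
        case False
        have "norm ((deriv ^^ k) (dirichlet_L chi) z) \<le> fact k * B / 1 ^ k"
        proof (rule Cauchy_inequality)
          fix w assume w: "norm (z - w) = 1"
          show "norm (dirichlet_L chi w) \<le> B" using Re_Im_circle[OF w] False by (intro B) auto
        qed (auto intro!: holomorphic_on_imp_continuous_on intro: holomorphic_on_subset[OF ent])
        then show ?thesis by simp
      qed
    qed
    moreover have "C * P \<le> (C + \<bar>D\<bar> + fact k * B) * P" using C P B0 by (intro mult_right_mono) auto
    moreover have "\<bar>D\<bar> * 1 \<le> (C + \<bar>D\<bar> + fact k * B) * P" using C P B0 by (intro mult_mono) auto
    moreover have "fact k * B * 1 \<le> (C + \<bar>D\<bar> + fact k * B) * P" using C P B0 by (intro mult_mono) auto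
    ultimately show ?thesis unfolding P_def by linarith
  qed
  moreover have "0 \<le> C + \<bar>D\<bar> + fact k * B" using C B0 by simp
  ultimately show ?thesis using C by blast
qed

text \<open>Here \<open>Re s \<noteq> 1\<close> enters: the vertical line misses 1, the only
  possible pole.\<close>

lemma vertical_line_continuous:
  assumes char: "dirichlet_character m chi" and s: "Re s \<noteq> 1"
  shows "continuous_on UNIV (\<lambda>\<tau>. (deriv ^^ k) (dirichlet_L chi) (s + \<i> * of_real \<tau>))"
proof (rule continuous_on_compose2[where g = "(deriv ^^ k) (dirichlet_L chi)" and t = "UNIV - {1}"])
  have "open (UNIV - {1::complex})" by auto
  from holomorphic_higher_deriv[OF dirichlet_L_holomorphic[OF char] this]
  show "continuous_on (UNIV - {1}) ((deriv ^^ k) (dirichlet_L chi))"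
    by (rule holomorphic_on_imp_continuous_on)
  show "(\<lambda>\<tau>. s + \<i> * of_real \<tau>) ` UNIV \<subseteq> UNIV - {1}" using s by (auto simp: complex_eq_iff)
qed (intro continuous_intros)

lemma vertical_line_growth:
  assumes char: "dirichlet_character m chi" and s: "Re s > - 1 / 2" "Re s \<noteq> 1"
  shows "\<exists>C e. e < 1 \<and> (\<forall>\<tau>. norm ((deriv ^^ k) (dirichlet_L chi) (s + \<i> * of_real \<tau>)) \<le> C * (1 + \<bar>\<tau>\<bar>) powr e)"
proof -
  define f where "f \<tau> = (deriv ^^ k) (dirichlet_L chi) (s + \<i> * of_real \<tau>)" for \<tau> :: real
  obtain C e where C: "0 \<le> C" "0 \<le> e" "e < 1"
    and C': "\<And>z. Re s \<le> Re z \<Longrightarrow> \<bar>Im z\<bar> \<ge> 2 \<Longrightarrow> norm ((deriv ^^ k) (dirichlet_L chi) z) \<le> C * (1 + \<bar>Im z\<bar>) powr e"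
    using dirichlet_L_deriv_growth[OF char s(1)] by blast
  \<comment> \<open>Beyond \<open>A\<close> the imaginary part \<open>Im s + \<tau>\<close> has
    absolute value at least 2; the remaining segment is compact.\<close>
  define A where "A = \<bar>Im s\<bar> + 2"
  have "continuous_on {-A..A} f"
    using vertical_line_continuous[OF char s(2), of k] unfolding f_def by (rule continuous_on_subset) auto
  then have "bounded (f ` {-A..A})"
    by (intro compact_imp_bounded compact_continuous_image) auto
  then obtain D where D: "\<And>t. t \<in> {-A..A} \<Longrightarrow> norm (f t) \<le> D"
    unfolding bounded_iff by blast
  have "norm (f t) \<le> (C * (1 + \<bar>Im s\<bar>) powr e + \<bar>D\<bar>) * (1 + \<bar>t\<bar>) powr e" for t
  proof (cases "\<bar>t\<bar> \<le> A")
    case True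
    have "norm (f t) \<le> \<bar>D\<bar> * 1" using D[of t] True by (simp add: abs_le_iff)
    also have "\<dots> \<le> (C * (1 + \<bar>Im s\<bar>) powr e + \<bar>D\<bar>) * (1 + \<bar>t\<bar>) powr e"
      using C by (intro mult_mono ge_one_powr_ge_zero) auto
    finally show ?thesis .
  next
    case False
    have "norm (f t) \<le> C * (1 + \<bar>Im s + t\<bar>) powr e"
      using C'[of "s + \<i> * of_real t"] False by (simp add: f_def A_def)
    also have "\<dots> \<le> C * ((1 + \<bar>Im s\<bar>) * (1 + \<bar>t\<bar>)) powr e"
    proof (intro mult_left_mono powr_mono2)
      have "0 \<le> \<bar>Im s\<bar> * \<bar>t\<bar>" by simp
      then show "1 + \<bar>Im s + t\<bar> \<le> (1 + \<bar>Im s\<bar>) * (1 + \<bar>t\<bar>)"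
        using abs_triangle_ineq[of "Im s" t] unfolding distrib_left distrib_right by linarith
    qed (use C in auto)
    also have "\<dots> = (C * (1 + \<bar>Im s\<bar>) powr e) * (1 + \<bar>t\<bar>) powr e" by (simp add: powr_mult)
    also have "\<dots> \<le> (C * (1 + \<bar>Im s\<bar>) powr e + \<bar>D\<bar>) * (1 + \<bar>t\<bar>) powr e"
      by (intro mult_right_mono) auto
    finally show ?thesis .
  qed
  then show ?thesis using C unfolding f_def by blast
qed

section \<open>Moving averages of measure-preserving maps\<close>

text \<open>Greedy choice: take a longest interval, discard everything that meets it, and recurse on
  the rest. The two inequalities in the cover condition say that the half-open intervals overlap.
  Nonempty intervals meet themselves, so the chosen one is discarded too and the family
  shrinks.\<close>

lemma finite_vitali:
  fixes I :: "(nat \<times> nat) set"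
  assumes "finite I" and "\<And>c k. (c, k) \<in> I \<Longrightarrow> k \<ge> 1"
  shows "\<exists>J\<subseteq>I. disjoint_family_on (\<lambda>(c, k). {c<..c + k}) J \<and>
    (\<forall>(c, k)\<in>I. \<exists>(c', k')\<in>J. k \<le> k' \<and> c < c' + k' \<and> c' < c + k)"
  using assms
proof (induction "card I" arbitrary: I rule: less_induct)
  case (less I)
  show ?case
  proof (cases "I = {}")
    case False
    obtain x where x: "x \<in> I" "snd x = Max (snd ` I)"
      using Max_in[of "snd ` I"] less.prems(1) False by fastforce
    obtain c0 k0 where x0: "x = (c0, k0)" by force
    have mx: "k \<le> k0" if "(c, k) \<in> I" for c k
      using x x0 less.prems(1) that by (metis Max_ge finite_imageI imageI snd_conv)
    define I' where "I' = {(c, k) \<in> I. \<not> (c < c0 + k0 \<and> c0 < c + k)}"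
    have "x \<notin> I'" using less.prems(2)[of c0 k0] x x0 by (auto simp: I'_def)
    then have "I' \<subset> I" using x by (auto simp: I'_def)
    then have "card I' < card I" "finite I'"
      using less.prems(1) psubset_card_mono finite_subset[of I' I] by auto
    from less.hyps[OF this] obtain J where J: "J \<subseteq> I'" "disjoint_family_on (\<lambda>(c, k). {c<..c + k}) J"
      "\<forall>(c, k)\<in>I'. \<exists>(c', k')\<in>J. k \<le> k' \<and> c < c' + k' \<and> c' < c + k"
      using less.prems(2) \<open>I' \<subset> I\<close> by blast
    have "disjoint_family_on (\<lambda>(c, k). {c<..c + k}) (insert x J)"
      using J(1,2) unfolding disjoint_family_on_def x0
      by (fastforce simp: I'_def)
    moreover have "\<forall>(c, k)\<in>I. \<exists>(c', k')\<in>insert x J. k \<le> k' \<and> c < c' + k' \<and> c' < c + k"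
    proof (clarify)
      fix c k assume ck: "(c, k) \<in> I"
      show "\<exists>(c', k')\<in>insert x J. k \<le> k' \<and> c < c' + k' \<and> c' < c + k"
      proof (cases "(c, k) \<in> I'")
        case True
        then show ?thesis using J(3) by blast
      next
        case False
        then have "c < c0 + k0 \<and> c0 < c + k" using ck by (auto simp: I'_def)
        then show ?thesis using mx[OF ck] x0 by auto
      qed
    qed
    moreover have "insert x J \<subseteq> I" using J(1) x \<open>I' \<subset> I\<close> by auto
    ultimately show ?thesis by blast
  qed (auto simp: disjoint_family_on_def)
qed

text \<open>
  If an average over \<open>{i + n<..i + n + k}\<close> is large, its interval meets a selected interval
  \<open>{c<..c + k'}\<close> with \<open>k \<le> k'\<close>, and then \<open>c - i\<close> lies in the cone section at height \<open>k' + k' / a0\<close>.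
\<close>

theorem discrete_maximal_inequality:
  fixes Z :: "(int \<times> nat) set" and h0 a0 A lam :: real and \<phi> :: "nat \<Rightarrow> real"
  assumes a0: "a0 > 0" and A: "A > 0"
    and sec: "\<And>l. l > 0 \<Longrightarrow> finite (cone_section Z h0 a0 l) \<and> real (card (cone_section Z h0 a0 l)) \<le> A * real l"
    and F: "finite F" "\<And>n k. (n, k) \<in> F \<Longrightarrow> (int n, k) \<in> height_part Z h0 \<and> k \<ge> 1 \<and> n + k \<le> N"
    and \<phi>: "\<And>i. \<phi> i \<ge> 0" and lam: "lam > 0"
  shows "real (card {i\<in>{..<R}. \<exists>(n, k)\<in>F. (\<Sum>j=1..k. \<phi> (n + j + i)) > lam * real k})
    \<le> A * (2 + 1 / a0) / lam * (\<Sum>i<R + N + 1. \<phi> i)"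
proof -
  define Bad where "Bad = {i\<in>{..<R}. \<exists>(n, k)\<in>F. (\<Sum>j=1..k. \<phi> (n + j + i)) > lam * real k}"
  define I where "I = {(c, k). \<exists>i n. i < R \<and> (n, k) \<in> F \<and> c = i + n \<and> (\<Sum>j=1..k. \<phi> (n + j + i)) > lam * real k}"
  have "I \<subseteq> (\<lambda>(i, n, k). (i + n, k)) ` ({..<R} \<times> F)" by (force simp: I_def)
  then have finI: "finite I" by (rule finite_subset) (use F in auto)
  have Ik: "k \<ge> 1" if "(c, k) \<in> I" for c k using that F(2) by (auto simp: I_def)
  obtain J where J: "J \<subseteq> I" "disjoint_family_on (\<lambda>(c, k). {c<..c + k}) J"
    and cover: "\<forall>(c, k)\<in>I. \<exists>(c', k')\<in>J. k \<le> k' \<and> c < c' + k' \<and> c' < c + k"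
    using finite_vitali[of I] finI Ik by blast
  have finJ: "finite J" using J(1) finI by (rule finite_subset)
  define l where "l k = k + nat \<lceil>real k / a0\<rceil>" for k :: nat
  have l: "l k > 0" "real (l k) \<le> (2 + 1 / a0) * real k" if "k \<ge> 1" for k
  proof -
    have "real (nat \<lceil>real k / a0\<rceil>) = of_int \<lceil>real k / a0\<rceil>" using a0 by simp
    also have "\<dots> \<le> real k / a0 + 1" by linarith
    finally have "real (nat \<lceil>real k / a0\<rceil>) \<le> real k / a0 + real k" using that by linarith
    then show "real (l k) \<le> (2 + 1 / a0) * real k" by (simp add: l_def algebra_simps)
    show "l k > 0" using that by (simp add: l_def)
  qed
  \<comment> \<open>The starting points charged to a selected interval; up to reflection this is the
    cone section, so its size is proportional to the length of the interval.\<close>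
  define S where "S = (\<lambda>(c, k). (\<lambda>z. nat (int c - z)) ` cone_section Z h0 a0 (l k))"
  have finS: "finite (S x)" "real (card (S x)) \<le> A * ((2 + 1 / a0) * real (snd x))" if x: "x \<in> J" for x
  proof -
    obtain c k where ck: "x = (c, k)" by force
    have k: "k \<ge> 1" using x ck J(1) Ik by blast
    note s = sec[OF l(1)[OF k]]
    show "finite (S x)" using s by (simp add: S_def ck)
    have "card (S x) \<le> card (cone_section Z h0 a0 (l k))" unfolding S_def ck using s by (auto intro: card_image_le)
    then have "real (card (S x)) \<le> A * real (l k)" using s by linarith
    also have "\<dots> \<le> A * ((2 + 1 / a0) * real k)" using l(2)[OF k] A by (intro mult_left_mono) auto
    finally show "real (card (S x)) \<le> A * ((2 + 1 / a0) * real (snd x))" by (simp add: ck)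
  qed
  have "Bad \<subseteq> (\<Union>x\<in>J. S x)"
  proof
    fix i assume "i \<in> Bad"
    then obtain n k where nk: "i < R" "(n, k) \<in> F" "(\<Sum>j=1..k. \<phi> (n + j + i)) > lam * real k"
      by (auto simp: Bad_def)
    then have "(i + n, k) \<in> I" by (auto simp: I_def)
    then obtain c' k' where ck': "(c', k') \<in> J" "k \<le> k'" "i + n < c' + k'" "c' < i + n + k" using cover by blast
    have "real_of_int \<bar>(int c' - int i) - int n\<bar> < real k'" using ck' by linarith
    also have "real k' = a0 * (real k' / a0)" using a0 by simp
    also have "\<dots> \<le> a0 * real (nat \<lceil>real k' / a0\<rceil>)" using a0 by (intro mult_left_mono) (linarith, simp)
    also have "\<dots> \<le> a0 * real_of_int (int (l k') - int k)"
      unfolding l_def using a0 ck'(2) by (intro mult_left_mono) linarith+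
    finally have "int c' - int i \<in> cone_section Z h0 a0 (l k')"
      using F(2)[OF nk(2)] unfolding cone_section_def cone_set_def by blast
    then have "i \<in> S (c', k')" unfolding S_def by (force intro!: image_eqI[of _ _ "int c' - int i"])
    then show "i \<in> (\<Union>x\<in>J. S x)" using ck'(1) by blast
  qed
  then have "card Bad \<le> card (\<Union>x\<in>J. S x)" using finJ finS(1) by (intro card_mono) auto
  also have "\<dots> \<le> (\<Sum>x\<in>J. card (S x))" by (rule card_UN_le[OF finJ])
  finally have "real (card Bad) \<le> (\<Sum>x\<in>J. real (card (S x)))" by (simp flip: of_nat_sum)
  also have "\<dots> \<le> (\<Sum>x\<in>J. A * (2 + 1 / a0) / lam * (lam * real (snd x)))"
    using finS(2) lam by (intro sum_mono) (simp add: mult.assoc)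
  also have "\<dots> \<le> (\<Sum>x\<in>J. A * (2 + 1 / a0) / lam * (\<Sum>i\<in>(case x of (c, k) \<Rightarrow> {c<..c + k}). \<phi> i))"
  proof (intro sum_mono mult_left_mono)
    fix x assume "x \<in> J"
    then obtain i n k where x: "x = (i + n, k)" "(\<Sum>j=1..k. \<phi> (n + j + i)) > lam * real k"
      using J(1) by (auto simp: I_def)
    have "(\<Sum>j=1..k. \<phi> (n + j + i)) = (\<Sum>j\<in>{i + n<..i + n + k}. \<phi> j)"
      by (rule sum.reindex_bij_witness[of _ "\<lambda>j. j - (i + n)" "\<lambda>j. n + j + i"]) auto
    then show "lam * real (snd x) \<le> (\<Sum>i\<in>(case x of (c, k) \<Rightarrow> {c<..c + k}). \<phi> i)" using x by simp
  qed (use A a0 lam in auto)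
  \<comment> \<open>Disjointness pays here: the sums over the selected intervals combine into a
    single sum over the whole range.\<close>
  also have "\<dots> = A * (2 + 1 / a0) / lam * (\<Sum>i\<in>(\<Union>x\<in>J. case x of (c, k) \<Rightarrow> {c<..c + k}). \<phi> i)"
    unfolding sum_distrib_left[symmetric]
    by (subst sum.UNION_disjoint_family) (use finJ J(2) in auto)
  also have "\<dots> \<le> A * (2 + 1 / a0) / lam * (\<Sum>i<R + N + 1. \<phi> i)"
  proof (intro mult_left_mono sum_mono2)
    show "(\<Union>x\<in>J. case x of (c, k) \<Rightarrow> {c<..c + k}) \<subseteq> {..<R + N + 1}"
    proof
      fix i assume "i \<in> (\<Union>x\<in>J. case x of (c, k) \<Rightarrow> {c<..c + k})"
      then obtain c k where "(c, k) \<in> J" "i \<le> c + k" by auto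
      moreover then obtain i' n where "i' < R" "(n, k) \<in> F" "c = i' + n" using J(1) by (auto simp: I_def)
      ultimately show "i \<in> {..<R + N + 1}" using F(2)[of n k] by auto
    qed
  qed (use A a0 lam \<phi> in auto)
  finally show ?thesis by (simp add: Bad_def)
qed


text \<open>A shift by one replaces just one term, at a cost of at most \<open>2 * B\<close>. The
  bound does not depend on the window length \<open>k\<close>.\<close>

lemma sum_shift_diff_bound:
  fixes a :: "nat \<Rightarrow> real"
  assumes "\<And>j. \<bar>a j\<bar> \<le> B"
  shows "\<bar>(\<Sum>j=1..k. a j) - (\<Sum>j=1..k. a (j + r))\<bar> \<le> 2 * real r * B"
proof (induction r)
  case (Suc r)
  have "(\<Sum>j=1..k. a (j + r)) - (\<Sum>j=1..k. a (j + Suc r)) = a (1 + r) - a (Suc k + r)"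
    by (induction k) simp_all
  then have "\<bar>(\<Sum>j=1..k. a (j + r)) - (\<Sum>j=1..k. a (j + Suc r))\<bar> \<le> 2 * B"
    using assms[of "1 + r"] assms[of "Suc k + r"] by linarith
  then show ?case using Suc by (simp add: algebra_simps)
qed simp

section \<open>Maximal inequality and pointwise convergence for a measure-preserving map\<close>

locale measure_preserving_map = prob_space M for M :: "'a measure" +
  fixes T :: "'a \<Rightarrow> 'a"
  assumes T_measurable [measurable]: "T \<in> M \<rightarrow>\<^sub>M M" and distr_T: "distr M M T = M"
begin

lemma T_pow_measurable [measurable]: "T ^^ n \<in> M \<rightarrow>\<^sub>M M"
proof (induction n)
  case (Suc n)
  then show ?case unfolding funpow_Suc_right by measurable
qed simp

lemma distr_T_pow: "distr M M (T ^^ n) = M"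
proof (induction n)
  case 0
  show ?case by (simp add: id_def)
next
  case (Suc n)
  have "distr M M (T ^^ Suc n) = distr (distr M M T) M (T ^^ n)"
    unfolding funpow_Suc_right by (rule distr_distr[symmetric]) auto
  then show ?case unfolding distr_T Suc .
qed

lemma integrable_T_pow: "integrable M (g :: 'a \<Rightarrow> real) \<Longrightarrow> integrable M (\<lambda>x. g ((T ^^ n) x))"
  and integral_T_pow: "integrable M g \<Longrightarrow> (LINT x|M. g ((T ^^ n) x)) = (LINT x|M. g x)"
proof -
  assume g: "integrable M g"
  then have [measurable]: "g \<in> borel_measurable M" by auto
  show "integrable M (\<lambda>x. g ((T ^^ n) x))"
    using g integrable_distr_eq[of "T ^^ n" M M g] by (simp add: distr_T_pow)
  show "(LINT x|M. g ((T ^^ n) x)) = (LINT x|M. g x)"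
    using integral_distr[of "T ^^ n" M M g] by (simp add: distr_T_pow)
qed

definition moving_sum :: "('a \<Rightarrow> real) \<Rightarrow> nat \<Rightarrow> nat \<Rightarrow> 'a \<Rightarrow> real" where
  "moving_sum g n k x = (\<Sum>j=1..k. g ((T ^^ (n + j)) x))"

lemma moving_sum_measurable [measurable]:
  "g \<in> borel_measurable M \<Longrightarrow> moving_sum g n k \<in> borel_measurable M"
  unfolding moving_sum_def [abs_def]
  by (intro borel_measurable_sum measurable_compose[OF T_pow_measurable])

text \<open>Calderon's transference: apply the inequality for sequences along an orbit segment of
  length \<open>R\<close>, integrate, and use that all iterates have the same integral. After
  division by \<open>R\<close> the surplus of \<open>N + 1\<close> terms disappears as
  \<open>R\<close> tends to infinity.\<close>

theorem finite_maximal_inequality: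
  fixes Z :: "(int \<times> nat) set" and h0 a0 A lam :: real and g :: "'a \<Rightarrow> real"
  assumes a0: "a0 > 0" and A: "A > 0"
    and sec: "\<And>l. l > 0 \<Longrightarrow> finite (cone_section Z h0 a0 l) \<and> real (card (cone_section Z h0 a0 l)) \<le> A * real l"
    and F: "finite F" "\<And>n k. (n, k) \<in> F \<Longrightarrow> (int n, k) \<in> height_part Z h0 \<and> k \<ge> 1"
    and g: "integrable M g" "\<And>x. g x \<ge> 0" and lam: "lam > 0"
  shows "prob {x \<in> space M. \<exists>(n, k)\<in>F. moving_sum g n k x > lam * real k} \<le> A * (2 + 1 / a0) / lam * (LINT x|M. g x)"
proof -
  have [measurable]: "g \<in> borel_measurable M" using g by auto
  define C where "C = A * (2 + 1 / a0) / lam"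
  have C: "C \<ge> 0" using a0 A lam by (simp add: C_def)
  define N where "N = Max ((\<lambda>(n, k). n + k) ` F)"
  have N: "n + k \<le> N" if "(n, k) \<in> F" for n k
    unfolding N_def using that F(1) by (intro Max_ge) (auto intro: image_eqI[of _ _ "(n, k)"])
  define E where "E = {x \<in> space M. \<exists>(n, k)\<in>F. moving_sum g n k x > lam * real k}"
  have E: "E \<in> sets M"
  proof -
    have "E = (\<Union>x\<in>F. {y \<in> space M. moving_sum g (fst x) (snd x) y > lam * real (snd x)})" by (auto simp: E_def)
    also have "\<dots> \<in> sets M" using F(1) by (intro sets.finite_UN) auto
    finally show ?thesis .
  qed
  have pw: "(\<Sum>i<R. indicator E ((T ^^ i) x)) \<le> C * (\<Sum>i<R + N + 1. g ((T ^^ i) x))" if x: "x \<in> space M" for R x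
  proof -
    have sp: "(T ^^ i) x \<in> space M" for i by (rule measurable_space[OF T_pow_measurable x])
    have mem: "(T ^^ i) x \<in> E \<longleftrightarrow> (\<exists>(n, k)\<in>F. (\<Sum>j=1..k. g ((T ^^ (n + j + i)) x)) > lam * real k)" for i
      using sp[of i] by (simp add: E_def moving_sum_def funpow_add)
    have "(\<Sum>i<R. indicator E ((T ^^ i) x)) = real (card {i\<in>{..<R}. \<exists>(n, k)\<in>F. (\<Sum>j=1..k. g ((T ^^ (n + j + i)) x)) > lam * real k})"
    proof -
      have "{i\<in>{..<R}. \<exists>(n, k)\<in>F. (\<Sum>j=1..k. g ((T ^^ (n + j + i)) x)) > lam * real k} = {i\<in>{..<R}. (T ^^ i) x \<in> E}"
        by (rule Collect_cong) (simp only: mem)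
      moreover have "(\<Sum>i<R. indicat_real E ((T ^^ i) x)) = real (card ({..<R} \<inter> {i. (T ^^ i) x \<in> E}))"
        by (simp add: indicator_def sum.If_cases)
      moreover have "{..<R} \<inter> {i. (T ^^ i) x \<in> E} = {i\<in>{..<R}. (T ^^ i) x \<in> E}" by blast
      ultimately show ?thesis by simp
    qed
    also have "\<dots> \<le> C * (\<Sum>i<R + N + 1. g ((T ^^ i) x))"
      unfolding C_def by (rule discrete_maximal_inequality[OF a0 A sec F(1)]) (use F(2) N g lam in auto)
    finally show ?thesis .
  qed
  have iE: "integrable M (indicat_real E)" using E by (simp add: integrable_indicator_iff emeasure_eq_measure)
  have main: "real R * prob E \<le> C * (real (R + N + 1) * (LINT x|M. g x))" for R
  proof -
    have "real R * prob E = (LINT x|M. (\<Sum>i<R. indicator E ((T ^^ i) x)))"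
      using E iE by (subst Bochner_Integration.integral_sum) (auto intro!: integrable_T_pow simp: integral_T_pow)
    also have "\<dots> \<le> (LINT x|M. C * (\<Sum>i<R + N + 1. g ((T ^^ i) x)))"
      by (intro integral_mono pw integrable_mult_right Bochner_Integration.integrable_sum integrable_T_pow iE g)
    also have "\<dots> = C * (real (R + N + 1) * (LINT x|M. g x))"
      using g by (subst integral_mult_right_zero, subst Bochner_Integration.integral_sum) (auto intro!: integrable_T_pow simp: integral_T_pow)
    finally show ?thesis .
  qed
  have "prob E \<le> C * (LINT x|M. g x)"
  proof (rule tendsto_le[OF _ _ tendsto_const[of "prob E" sequentially]])
    show "(\<lambda>R. C * (real (Suc R + N + 1) / real (Suc R) * (LINT x|M. g x))) \<longlonglongrightarrow> C * (LINT x|M. g x)"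
    proof -
      have "(\<lambda>R. real (Suc R + N + 1) / real (Suc R)) \<longlonglongrightarrow> 1" by real_asymp
      from tendsto_mult[OF tendsto_const[of C] tendsto_mult[OF this tendsto_const[of "LINT x|M. g x"]]] show ?thesis by simp
    qed
    have "prob E \<le> C * (real (Suc R + N + 1) / real (Suc R) * (LINT x|M. g x))" for R
      using main[of "Suc R"] by (simp add: field_simps del: of_nat_Suc of_nat_add)
    then show "\<forall>\<^sub>F R in sequentially. prob E \<le> C * (real (Suc R + N + 1) / real (Suc R) * (LINT x|M. g x))" by simp
  qed simp
  then show ?thesis by (simp add: E_def C_def)
qed

text \<open>The constant does not depend on the finite set of windows, so continuity of the measure
  along an increasing union gives the countable case.\<close>

theorem countable_maximal_inequality:
  fixes Z :: "(int \<times> nat) set" and h0 a0 A lam :: real and g :: "'a \<Rightarrow> real" and ns ks :: "nat \<Rightarrow> nat" and L :: nat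
  assumes a0: "a0 > 0" and A: "A > 0"
    and sec: "\<And>l. l > 0 \<Longrightarrow> finite (cone_section Z h0 a0 l) \<and> real (card (cone_section Z h0 a0 l)) \<le> A * real l"
    and F: "\<And>l. l \<ge> L \<Longrightarrow> (int (ns l), ks l) \<in> height_part Z h0 \<and> ks l \<ge> 1"
    and g: "integrable M g" "\<And>x. g x \<ge> 0" and lam: "lam > 0"
  shows "prob {x \<in> space M. \<exists>l\<ge>L. moving_sum g (ns l) (ks l) x > lam * real (ks l)} \<le> A * (2 + 1 / a0) / lam * (LINT x|M. g x)"
proof -
  have [measurable]: "g \<in> borel_measurable M" using g by auto
  define E where "E m = {x \<in> space M. \<exists>(n, k)\<in>(\<lambda>l. (ns l, ks l)) ` {L..<L+m}. moving_sum g n k x > lam * real k}" for m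
  have E: "E m \<in> sets M" for m
  proof -
    have "E m = (\<Union>l\<in>{L..<L+m}. {y \<in> space M. moving_sum g (ns l) (ks l) y > lam * real (ks l)})" by (auto simp: E_def)
    also have "\<dots> \<in> sets M" by (intro sets.finite_UN) auto
    finally show ?thesis .
  qed
  have "(\<lambda>m. prob (E m)) \<longlonglongrightarrow> prob (\<Union>m. E m)"
    using E by (intro finite_Lim_measure_incseq) (force simp: incseq_def E_def)+
  moreover have "prob (E m) \<le> A * (2 + 1 / a0) / lam * (LINT x|M. g x)" for m
    unfolding E_def by (rule finite_maximal_inequality[OF a0 A sec]) (use F g lam in auto)
  ultimately have "prob (\<Union>m. E m) \<le> A * (2 + 1 / a0) / lam * (LINT x|M. g x)"
    by (intro LIMSEQ_le_const2) auto
  also have "(\<Union>m. E m) = {x \<in> space M. \<exists>l\<ge>L. moving_sum g (ns l) (ks l) x > lam * real (ks l)}"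
  proof (intro equalityI subsetI)
    fix x assume "x \<in> {x \<in> space M. \<exists>l\<ge>L. moving_sum g (ns l) (ks l) x > lam * real (ks l)}"
    then obtain l where l: "l \<ge> L" "moving_sum g (ns l) (ks l) x > lam * real (ks l)" "x \<in> space M" by blast
    then have "(ns l, ks l) \<in> (\<lambda>l. (ns l, ks l)) ` {L..<L + Suc l}" by (intro imageI) simp
    then have "x \<in> E (Suc l)" using l(2,3) unfolding E_def by blast
    then show "x \<in> (\<Union>m. E m)" by blast
  qed (auto simp: E_def)
  finally show ?thesis .
qed

text \<open>With \<open>Q\<close> the mean of iterates of \<open>p\<close> and \<open>c\<close> its
  integral, write \<open>f - I\<close> as \<open>f - p\<close>, \<open>p - Q\<close>,
  \<open>Q - c\<close> and \<open>c - I\<close>. The first and third are small in L1 and are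
  controlled by the maximal inequality, the second has bounded window sums, the fourth is a small
  constant. The set of non-convergence at level \<open>\<eta>\<close> thus has arbitrarily small
  measure.\<close>

theorem moving_ergodic_theorem:
  fixes f :: "'a \<Rightarrow> real"
  assumes st: "stoltz ns ks" and f: "integrable M f"
    and approx: "\<And>e. e > 0 \<Longrightarrow> \<exists>p B. p \<in> borel_measurable M \<and> (\<forall>x. \<bar>p x\<bar> \<le> B) \<and> (LINT x|M. \<bar>f x - p x\<bar>) < e \<and>
      (\<exists>N>0. \<exists>r. (LINT x|M. \<bar>(\<Sum>i<N. p ((T ^^ r i) x)) / real N - (LINT x|M. p x)\<bar>) < e)"
  shows "AE x in M. (\<lambda>q. moving_sum f (ns q) (ks q) x / real (ks q)) \<longlonglongrightarrow> (LINT x|M. f x)"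
proof -
  have [measurable]: "f \<in> borel_measurable M" using f by auto
  obtain Z h h0 a0 A where h: "filterlim h at_top sequentially"
    and Zh: "\<And>t l. t \<ge> 1 \<Longrightarrow> l \<ge> t \<Longrightarrow> (int (ns l), ks l) \<in> height_part Z (h t)"
    and a0: "a0 > 0" and A: "A > 0"
    and sec: "\<And>l. l > 0 \<Longrightarrow> finite (cone_section Z h0 a0 l) \<and> real (card (cone_section Z h0 a0 l)) \<le> A * real l"
    using st unfolding stoltz_def by metis
  have kh: "real (ks l) \<ge> h l \<and> (int (ns l), ks l) \<in> Z" if "l \<ge> 1" for l
    using Zh[of l l] that by (auto simp: height_part_def)
  have ks_lim: "filterlim (\<lambda>l. real (ks l)) at_top sequentially"
  proof (rule filterlim_at_top_mono[OF h])
    show "\<forall>\<^sub>F l in sequentially. h l \<le> real (ks l)"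
      using eventually_ge_at_top[of 1] by eventually_elim (use kh in auto)
  qed
  have "\<forall>\<^sub>F l in sequentially. h l \<ge> max h0 1 \<and> l \<ge> 1"
  proof (intro eventually_conj)
    show "\<forall>\<^sub>F l in sequentially. h l \<ge> max h0 1" using h unfolding filterlim_at_top by blast
    show "\<forall>\<^sub>F l in sequentially. l \<ge> (1::nat)" by (rule eventually_ge_at_top)
  qed
  then obtain L where L: "\<And>l. l \<ge> L \<Longrightarrow> h l \<ge> max h0 1 \<and> l \<ge> 1"
    unfolding eventually_sequentially by blast
  have FL: "(int (ns l), ks l) \<in> height_part Z h0 \<and> ks l \<ge> 1" if "l \<ge> L" for l
    using L[OF that] kh[of l] by (auto simp: height_part_def)
  define I where "I = (LINT x|M. f x)"
  define avg where "avg g l x = moving_sum g (ns l) (ks l) x / real (ks l)" for g l x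
  have avg_meas [measurable]: "g \<in> borel_measurable M \<Longrightarrow> avg g l \<in> borel_measurable M" for g l
    unfolding avg_def [abs_def] by (intro borel_measurable_divide moving_sum_measurable borel_measurable_const)
  define Bad where "Bad \<eta> = {x \<in> space M. \<forall>m. \<exists>l\<ge>m. \<bar>avg f l x - I\<bar> > \<eta>}" for \<eta>
  have Bad_sets: "Bad \<eta> \<in> sets M" for \<eta> unfolding Bad_def by measurable
  \<comment> \<open>The budget \<open>\<eta>\<close> is split: \<open>\<eta> / 4\<close> for
    \<open>c - I\<close>, \<open>\<eta> / 4\<close> for the shift error \<open>D\<close>, and
    \<open>\<eta> / 2\<close> for the window average of \<open>g\<close>, whose integral is at most
    \<open>2 * e\<close>.\<close>
  have bound: "prob (Bad \<eta>) \<le> A * (2 + 1 / a0) / (\<eta> / 2) * (2 * e)" if \<eta>: "\<eta> > 0" and e: "0 < e" "e \<le> \<eta> / 4" for \<eta> e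
  proof -
    obtain p B N r where p [measurable]: "p \<in> borel_measurable M" and B: "\<And>x. \<bar>p x\<bar> \<le> B"
      and fp: "(LINT x|M. \<bar>f x - p x\<bar>) < e" and N: "N > 0"
      and pN: "(LINT x|M. \<bar>(\<Sum>i<N. p ((T ^^ r i) x)) / real N - (LINT x|M. p x)\<bar>) < e"
      using approx[OF e(1)] by blast
    define c where "c = (LINT x|M. p x)"
    define Q where "Q x = (\<Sum>i<N. p ((T ^^ r i) x)) / real N" for x
    have Q [measurable]: "Q \<in> borel_measurable M" unfolding Q_def [abs_def] by measurable
    have B0: "B \<ge> 0" using B[of undefined] by linarith
    have QB: "\<bar>Q x\<bar> \<le> B" for x
    proof -
      have "\<bar>\<Sum>i<N. p ((T ^^ r i) x)\<bar> \<le> (\<Sum>i<N. B)" by (intro order_trans[OF sum_abs] sum_mono B)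
      then show ?thesis using N by (simp add: Q_def abs_divide field_simps)
    qed
    have ip: "integrable M p" by (rule integrable_const_bound[of _ B]) (use B in auto)
    have iQ: "integrable M Q" by (rule integrable_const_bound[of _ B]) (use QB in auto)
    define g where "g x = \<bar>f x - p x\<bar> + \<bar>Q x - c\<bar>" for x
    have ig: "integrable M g" unfolding g_def using f ip iQ by auto
    have g0: "g x \<ge> 0" for x by (simp add: g_def)
    have lg: "(LINT x|M. g x) \<le> 2 * e"
    proof -
      have "(LINT x|M. \<bar>Q x - c\<bar>) < e" using pN by (simp add: Q_def c_def)
      then show ?thesis
        unfolding g_def using f ip iQ fp by (subst Bochner_Integration.integral_add) auto
    qed
    have cI: "\<bar>c - I\<bar> \<le> e"
    proof -
      have "c - I = (LINT x|M. p x - f x)" unfolding c_def I_def using ip f by simp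
      also have "\<bar>\<dots>\<bar> \<le> (LINT x|M. \<bar>p x - f x\<bar>)" by (rule integral_abs_bound)
      finally show ?thesis using fp by (simp add: abs_minus_commute)
    qed
    define D where "D = (\<Sum>i<N. 2 * real (r i) * B)"
    have D0: "D \<ge> 0" using B0 by (auto simp: D_def intro!: sum_nonneg)
    have cob: "\<bar>moving_sum p n k x - moving_sum Q n k x\<bar> \<le> D" for n k x
    proof -
      have "moving_sum p n k x - moving_sum Q n k x = (\<Sum>i<N. (\<Sum>j=1..k. p ((T ^^ (n + j)) x)) - (\<Sum>j=1..k. p ((T ^^ (n + (j + r i))) x))) / real N"
      proof -
        have "moving_sum Q n k x = (\<Sum>j=1..k. \<Sum>i<N. p ((T ^^ (n + (j + r i))) x)) / real N"
        proof -
          have pw: "(T ^^ a) ((T ^^ b) x) = (T ^^ (b + a)) x" for a b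
            by (simp add: add.commute[of b] funpow_add)
          show ?thesis unfolding moving_sum_def Q_def pw add.assoc sum_divide_distrib[symmetric] ..
        qed
        also have "\<dots> = (\<Sum>i<N. \<Sum>j=1..k. p ((T ^^ (n + (j + r i))) x)) / real N" by (subst sum.swap) simp
        finally show ?thesis using N by (simp add: moving_sum_def sum_subtractf diff_divide_distrib)
      qed
      also have "\<bar>\<dots>\<bar> \<le> (\<Sum>i<N. 2 * real (r i) * B) / real N"
        unfolding abs_divide abs_of_nat
      proof (intro divide_right_mono order_trans[OF sum_abs] sum_mono)
        fix i
        show "\<bar>(\<Sum>j=1..k. p ((T ^^ (n + j)) x)) - (\<Sum>j=1..k. p ((T ^^ (n + (j + r i))) x))\<bar> \<le> 2 * real (r i) * B"
          using sum_shift_diff_bound[of "\<lambda>j. p ((T ^^ (n + j)) x)" B k "r i"] B by simp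
      qed auto
      also have "\<dots> \<le> D / 1" unfolding D_def[symmetric] using D0 N by (intro divide_left_mono) auto
      finally show ?thesis by simp
    qed
    \<comment> \<open>From some index on the windows are so long that \<open>D / k\<close> is below
      \<open>\<eta> / 4\<close>.\<close>
    have "\<forall>\<^sub>F l in sequentially. real (ks l) > max 1 (D / (\<eta> / 4)) \<and> l \<ge> L"
    proof (intro eventually_conj)
      show "\<forall>\<^sub>F l in sequentially. real (ks l) > max 1 (D / (\<eta> / 4))"
        using ks_lim unfolding filterlim_at_top_dense by blast
      show "\<forall>\<^sub>F l in sequentially. l \<ge> L" by (rule eventually_ge_at_top)
    qed
    then obtain L' where L': "\<And>l. l \<ge> L' \<Longrightarrow> real (ks l) > max 1 (D / (\<eta> / 4)) \<and> l \<ge> L"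
      unfolding eventually_sequentially by blast
    have sub: "Bad \<eta> \<subseteq> {x \<in> space M. \<exists>l\<ge>L. moving_sum g (ns l) (ks l) x > \<eta> / 2 * real (ks l)}"
    proof
      fix x assume "x \<in> Bad \<eta>"
      then obtain l where l: "l \<ge> L'" "\<bar>avg f l x - I\<bar> > \<eta>" and x: "x \<in> space M" unfolding Bad_def by auto
      define k n where "k = ks l" and "n = ns l"
      have k: "real k > 1" "D < \<eta> / 4 * real k" using L'[OF l(1)] \<eta> by (auto simp: k_def field_simps)
      have "moving_sum f n k x - real k * I = moving_sum (\<lambda>x. f x - p x) n k x + (moving_sum p n k x - moving_sum Q n k x)
          + moving_sum (\<lambda>x. Q x - c) n k x + real k * (c - I)"
        by (simp add: moving_sum_def sum_subtractf algebra_simps)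
      also have "\<bar>\<dots>\<bar> \<le> moving_sum (\<lambda>x. \<bar>f x - p x\<bar>) n k x + D + moving_sum (\<lambda>x. \<bar>Q x - c\<bar>) n k x + real k * e"
      proof -
        have "\<bar>moving_sum (\<lambda>x. f x - p x) n k x\<bar> \<le> moving_sum (\<lambda>x. \<bar>f x - p x\<bar>) n k x"
          unfolding moving_sum_def by (rule sum_abs)
        moreover have "\<bar>moving_sum (\<lambda>x. Q x - c) n k x\<bar> \<le> moving_sum (\<lambda>x. \<bar>Q x - c\<bar>) n k x"
          unfolding moving_sum_def by (rule sum_abs)
        moreover have "\<bar>real k * (c - I)\<bar> \<le> real k * e" using cI by (simp add: abs_mult mult_left_mono)
        ultimately show ?thesis using cob[of n k x] by linarith
      qed
      also have "\<dots> = moving_sum g n k x + D + real k * e" by (simp add: moving_sum_def g_def sum.distrib)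
      finally have 1: "\<bar>moving_sum f n k x - real k * I\<bar> \<le> moving_sum g n k x + D + real k * e" .
      have "avg f l x - I = (moving_sum f n k x - real k * I) / real k" using k by (simp add: avg_def k_def n_def field_simps)
      then have "\<eta> < \<bar>moving_sum f n k x - real k * I\<bar> / real k" using l(2) by (simp only: abs_divide abs_of_nat)
      then have "\<eta> * real k < \<bar>moving_sum f n k x - real k * I\<bar>" using k by (simp only: pos_less_divide_eq)
      moreover have "real k * e \<le> \<eta> / 4 * real k" using e k by (simp add: mult.commute mult_left_mono)
      ultimately have "moving_sum g n k x > \<eta> / 2 * real k" using 1 k(2) by linarith
      then show "x \<in> {x \<in> space M. \<exists>l\<ge>L. moving_sum g (ns l) (ks l) x > \<eta> / 2 * real (ks l)}"
        using x L'[OF l(1)] by (auto simp: k_def n_def)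
    qed
    have gm [measurable]: "g \<in> borel_measurable M" using ig by auto
    have "prob (Bad \<eta>) \<le> prob {x \<in> space M. \<exists>l\<ge>L. moving_sum g (ns l) (ks l) x > \<eta> / 2 * real (ks l)}"
      using sub by (intro finite_measure_mono) auto
    also have "\<dots> \<le> A * (2 + 1 / a0) / (\<eta> / 2) * (LINT x|M. g x)"
      by (rule countable_maximal_inequality[OF a0 A sec FL ig g0]) (use \<eta> in auto)
    also have "\<dots> \<le> A * (2 + 1 / a0) / (\<eta> / 2) * (2 * e)"
      using lg A a0 \<eta> by (intro mult_left_mono) auto
    finally show ?thesis .
  qed
  have zero: "prob (Bad \<eta>) = 0" if \<eta>: "\<eta> > 0" for \<eta>
  proof -
    define K where "K = A * (2 + 1 / a0) / (\<eta> / 2) * 2"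
    have "prob (Bad \<eta>) \<le> 0 + d" if d: "d > 0" for d
    proof -
      have K: "K > 0" unfolding K_def using A a0 \<eta> by (intro mult_pos_pos divide_pos_pos add_pos_pos) auto
      define e where "e = min (\<eta> / 4) (d / K)"
      have "prob (Bad \<eta>) \<le> A * (2 + 1 / a0) / (\<eta> / 2) * (2 * e)"
      proof (rule bound[OF \<eta>])
        show "0 < e" using \<eta> d K by (simp add: e_def)
        show "e \<le> \<eta> / 4" unfolding e_def by (rule min.cobounded1)
      qed
      also have "\<dots> = K * e" by (simp add: K_def)
      also have "\<dots> \<le> K * (d / K)" using K by (intro mult_left_mono) (auto simp: e_def)
      finally show ?thesis using K by simp
    qed
    then have "prob (Bad \<eta>) \<le> 0" by (rule field_le_epsilon)
    then show ?thesis using measure_nonneg[of M "Bad \<eta>"] by linarith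
  qed
  have "AE x in M. \<forall>m::nat. x \<notin> Bad (1 / real (Suc m))"
    unfolding AE_all_countable
  proof
    fix m :: nat
    have "Bad (1 / real (Suc m)) \<in> null_sets M"
      using zero[of "1 / real (Suc m)"] Bad_sets by (auto simp: null_sets_def emeasure_eq_measure)
    then show "AE x in M. x \<notin> Bad (1 / real (Suc m))" by (rule AE_not_in)
  qed
  then show ?thesis
  proof (rule AE_mp[OF _ AE_I2], intro impI)
    fix x assume x: "x \<in> space M" and nb: "\<forall>m. x \<notin> Bad (1 / real (Suc m))"
    show "(\<lambda>q. moving_sum f (ns q) (ks q) x / real (ks q)) \<longlonglongrightarrow> (LINT x|M. f x)"
    proof (rule LIMSEQ_I)
      fix d :: real assume "d > 0"
      then obtain m where m: "1 / real (Suc m) < d" by (metis nat_approx_posE)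
      have "\<not> (\<forall>m'. \<exists>l\<ge>m'. \<bar>avg f l x - I\<bar> > 1 / real (Suc m))"
        using nb x by (auto simp: Bad_def)
      then obtain m' where "\<And>l. l \<ge> m' \<Longrightarrow> \<bar>avg f l x - I\<bar> \<le> 1 / real (Suc m)" by (auto simp: not_less)
      then show "\<exists>no. \<forall>q\<ge>no. norm (moving_sum f (ns q) (ks q) x / real (ks q) - (LINT x|M. f x)) < d"
        using m unfolding avg_def I_def by (intro exI[of _ m']) fastforce
    qed
  qed
qed

text \<open>Sampling at the multiples of \<open>d\<close> keeps distinct times at least
  \<open>d\<close> apart, so all off-diagonal correlations are at most \<open>e\<^sup>2 / 8\<close>.
  The diagonal contributes \<open>B\<^sup>2 / N\<close>, and the second moment of the mean becomes
  less than \<open>e\<^sup>2 / 4\<close>.\<close>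

lemma mixing_imp_mean_ergodic:
  assumes p [measurable]: "p \<in> borel_measurable M" and B: "\<And>x. \<bar>p x\<bar> \<le> B"
    and mix: "\<And>e. e > 0 \<Longrightarrow> \<exists>d. \<forall>n\<ge>d. \<bar>LINT x|M. p x * p ((T ^^ n) x)\<bar> \<le> e"
    and e: "e > 0"
  shows "\<exists>N>0. \<exists>r. (LINT x|M. \<bar>(\<Sum>i<N. p ((T ^^ r i) x)) / real N\<bar>) < e"
proof -
  have B0: "B \<ge> 0" using B[of undefined] by linarith
  obtain d where d: "\<And>n. n \<ge> d \<Longrightarrow> \<bar>LINT x|M. p x * p ((T ^^ n) x)\<bar> \<le> e\<^sup>2 / 8"
    using mix[of "e\<^sup>2 / 8"] e by auto
  obtain N :: nat where N: "N > 8 * B\<^sup>2 / e\<^sup>2" using reals_Archimedean2 by blast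
  have N0: "N > 0" using N e by (cases N) (auto simp: field_simps intro: less_le_trans)
  define r where "r i = i * d" for i
  define Q where "Q x = (\<Sum>i<N. p ((T ^^ r i) x)) / real N" for x
  have pT [measurable]: "(\<lambda>x. p ((T ^^ n) x)) \<in> borel_measurable M" for n
    by (rule measurable_compose[OF T_pow_measurable p])
  have Q [measurable]: "Q \<in> borel_measurable M" unfolding Q_def [abs_def] by measurable
  have bd: "\<bar>p x * p y\<bar> \<le> B * B" for x y
    unfolding abs_mult using B B0 by (intro mult_mono) auto
  have ipp: "integrable M (\<lambda>x. p ((T ^^ a) x) * p ((T ^^ b) x))" for a b
    by (rule integrable_const_bound[of _ "B * B"]) (use bd in auto)
  have QB: "\<bar>Q x\<bar> \<le> B" for x
  proof -
    have "\<bar>\<Sum>i<N. p ((T ^^ r i) x)\<bar> \<le> (\<Sum>i<N. B)" by (intro order_trans[OF sum_abs] sum_mono B)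
    then show ?thesis using N0 by (simp add: Q_def abs_divide field_simps)
  qed
  have iQ: "integrable M Q" by (rule integrable_const_bound[of _ B]) (use QB in auto)
  have iQ2: "integrable M (\<lambda>x. Q x * Q x)"
  proof (rule integrable_const_bound[of _ "B * B"])
    have "\<bar>Q x * Q x\<bar> \<le> B * B" for x unfolding abs_mult using QB B0 by (intro mult_mono) auto
    then show "AE x in M. norm (Q x * Q x) \<le> B * B" by simp
  qed auto
  have corr: "(LINT x|M. p ((T ^^ r i) x) * p ((T ^^ r j) x)) \<le> (if i = j then B\<^sup>2 else 0) + e\<^sup>2 / 8" for i j
  proof -
    have *: "(LINT x|M. p ((T ^^ r i) x) * p ((T ^^ r j) x)) \<le> e\<^sup>2 / 8" if "i < j" for i j
    proof -
      define n where "n = (j - i) * d"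
      have rj: "r j = n + r i" unfolding n_def r_def
        using that by (metis add_mult_distrib le_add_diff_inverse2 less_imp_le)
      have n: "n \<ge> d"
      proof -
        have "1 \<le> j - i" using that by linarith
        from mult_le_mono1[OF this, of d] show ?thesis by (simp add: n_def)
      qed
      have "(LINT x|M. p ((T ^^ r i) x) * p ((T ^^ r j) x)) = (LINT x|M. (\<lambda>x. p x * p ((T ^^ n) x)) ((T ^^ r i) x))"
        by (simp add: rj funpow_add)
      also have "\<dots> = (LINT x|M. p x * p ((T ^^ n) x))"
        using ipp[of 0 n] by (intro integral_T_pow) simp
      finally show ?thesis using d[OF n] by linarith
    qed
    consider "i < j" | "j < i" | "i = j" by linarith
    then show ?thesis
    proof cases
      case 1
      then show ?thesis using *[of i j] by simp
    next
      case 2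
      then show ?thesis using *[of j i] by (simp add: mult.commute)
    next
      case 3
      have "(LINT x|M. p ((T ^^ r i) x) * p ((T ^^ r j) x)) \<le> (LINT x|M. B * B)"
        using bd ipp by (intro integral_mono) (auto intro: order_trans[OF abs_ge_self])
      also have "\<dots> = B\<^sup>2" by (simp add: prob_space power2_eq_square)
      finally show ?thesis using 3 e by (smt (verit) divide_nonneg_pos zero_le_power2)
    qed
  qed
  have "(LINT x|M. Q x * Q x) = (LINT x|M. (\<Sum>i<N. \<Sum>j<N. p ((T ^^ r i) x) * p ((T ^^ r j) x))) / (real N * real N)"
    unfolding Q_def by (simp add: sum_product)
  also have "(LINT x|M. (\<Sum>i<N. \<Sum>j<N. p ((T ^^ r i) x) * p ((T ^^ r j) x))) = (\<Sum>i<N. \<Sum>j<N. (LINT x|M. p ((T ^^ r i) x) * p ((T ^^ r j) x)))"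
    by (subst Bochner_Integration.integral_sum; (subst Bochner_Integration.integral_sum)?) (auto intro!: ipp Bochner_Integration.integrable_sum)
  also have "\<dots> \<le> (\<Sum>i<N. \<Sum>j<N. (if i = j then B\<^sup>2 else 0) + e\<^sup>2 / 8)"
    by (intro sum_mono corr)
  also have "\<dots> = real N * B\<^sup>2 + real N * real N * (e\<^sup>2 / 8)"
    by (simp add: sum.distrib algebra_simps)
  finally have "(LINT x|M. Q x * Q x) \<le> (real N * B\<^sup>2 + real N * real N * (e\<^sup>2 / 8)) / (real N * real N)"
    using N0 by (simp add: divide_right_mono)
  also have "\<dots> = B\<^sup>2 / real N + e\<^sup>2 / 8" using N0 by (simp add: field_simps)
  also have "\<dots> < e\<^sup>2 / 8 + e\<^sup>2 / 8" using N N0 e by (simp add: field_simps)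
  finally have Q2: "(LINT x|M. Q x * Q x) < e\<^sup>2 / 4" by simp
  have "(LINT x|M. \<bar>Q x\<bar>) \<le> (LINT x|M. Q x * Q x / e + e / 4)"
  proof (intro integral_mono)
    fix x
    \<comment> \<open>Completing a square passes from the second moment to the L1 norm in place of
      Cauchy-Schwarz.\<close>
    have "0 \<le> (\<bar>Q x\<bar> - e / 2)\<^sup>2" by simp
    then have "e * \<bar>Q x\<bar> \<le> Q x * Q x + e * e / 4" by (simp add: power2_eq_square algebra_simps)
    then show "\<bar>Q x\<bar> \<le> Q x * Q x / e + e / 4" using e by (simp add: field_simps)
  qed (use iQ iQ2 in auto)
  also have "\<dots> = (LINT x|M. Q x * Q x) / e + e / 4" using iQ2 by (simp add: prob_space)
  also have "\<dots> < (e\<^sup>2 / 4) / e + e / 4" using Q2 e by (intro add_strict_right_mono divide_strict_right_mono) auto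
  also have "\<dots> < e" using e by (simp add: power2_eq_square)
  finally show ?thesis using N0 unfolding Q_def by blast
qed

end

section \<open>The doubling map\<close>

text \<open>Half-open, so that \<open>frac\<close> maps into the space and \<open>doubling\<close>
  is a self-map.\<close>

definition unit_measure :: "real measure" where
  "unit_measure = restrict_space lborel {0..<1}"

definition doubling :: "real \<Rightarrow> real" where "doubling u = frac (2 * u)"

lemma space_unit [simp]: "space unit_measure = {0..<1}"
  by (simp add: unit_measure_def space_restrict_space)

lemma borel_measurable_unit: "f \<in> borel_measurable borel \<Longrightarrow> f \<in> borel_measurable unit_measure"
  unfolding unit_measure_def by (rule measurable_restrict_space1) simp

lemma nn_integral_unit:
  "(\<integral>\<^sup>+u. f u \<partial>unit_measure) = (\<integral>\<^sup>+u. f u * indicator {0..<1} u \<partial>lborel)"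
  unfolding unit_measure_def by (rule nn_integral_restrict_space) simp

lemma doubling_measurable_borel [measurable]: "doubling \<in> borel_measurable borel"
  unfolding doubling_def [abs_def] frac_def by measurable

lemma doubling_measurable: "doubling \<in> unit_measure \<rightarrow>\<^sub>M unit_measure"
proof -
  have "doubling \<in> restrict_space lborel {0..<1} \<rightarrow>\<^sub>M restrict_space lborel {0..<1}"
    by (rule measurable_restrict_space3) (auto simp: doubling_def frac_lt_1)
  then show ?thesis by (simp add: unit_measure_def)
qed

text \<open>The two branches \<open>2 * u\<close> and \<open>2 * u - 1\<close> each sweep the unit
  interval at double speed and contribute half of the integral.\<close>

lemma nn_integral_doubling:
  assumes [measurable]: "f \<in> borel_measurable borel"
  shows "(\<integral>\<^sup>+u. f (doubling u) \<partial>unit_measure) = (\<integral>\<^sup>+u. f u \<partial>unit_measure)"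
proof -
  define g where "g u = f u * indicator {0..<1} u" for u
  have g [measurable]: "g \<in> borel_measurable borel" unfolding g_def [abs_def] by measurable
  have pw: "f (doubling u) * indicator {0..<1} u = g (0 + 2 * u) + g (-1 + 2 * u)" for u
  proof -
    have "frac (2 * u) = 2 * u" if "0 \<le> u" "u < 1/2" using that by (subst frac_eq) auto
    moreover have "frac (2 * u) = 2 * u - 1" if "1/2 \<le> u" "u < 1"
    proof -
      have "\<lfloor>2 * u\<rfloor> = 1" using that by (intro floor_unique) auto
      then show ?thesis by (simp add: frac_def)
    qed
    ultimately show ?thesis by (auto simp: g_def doubling_def indicator_def)
  qed
  have h0: "(\<integral>\<^sup>+u. g u \<partial>lborel) = 2 * (\<integral>\<^sup>+u. g (t + 2 * u) \<partial>lborel)" for t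
    using nn_integral_real_affine[OF g, of 2 t] by simp
  have "2 * (\<integral>\<^sup>+u. f (doubling u) \<partial>unit_measure) = 2 * (\<integral>\<^sup>+u. g (0 + 2 * u) \<partial>lborel) + 2 * (\<integral>\<^sup>+u. g (-1 + 2 * u) \<partial>lborel)"
    unfolding nn_integral_unit pw by (subst nn_integral_add) (auto simp: distrib_left)
  also have "\<dots> = (\<integral>\<^sup>+u. g u \<partial>lborel) + (\<integral>\<^sup>+u. g u \<partial>lborel)"
    by (simp only: h0[symmetric])
  also have "\<dots> = 2 * (\<integral>\<^sup>+u. f u \<partial>unit_measure)"
    by (simp add: nn_integral_unit g_def mult_2)
  finally show ?thesis by (simp add: ennreal_mult_cancel_left)
qed

lemma prob_space_unit: "prob_space unit_measure"
proof (rule prob_spaceI)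
  have "emeasure unit_measure {0..<1} = emeasure lborel {0..<1::real}"
    unfolding unit_measure_def by (rule emeasure_restrict_space) auto
  then show "emeasure unit_measure (space unit_measure) = 1" by simp
qed

interpretation unit: measure_preserving_map unit_measure doubling
proof (intro measure_preserving_map.intro measure_preserving_map_axioms.intro)
  show "prob_space unit_measure" by (rule prob_space_unit)
  show "doubling \<in> unit_measure \<rightarrow>\<^sub>M unit_measure" by (rule doubling_measurable)
  show "distr unit_measure unit_measure doubling = unit_measure"
  proof (rule measure_eqI)
    fix A assume "A \<in> sets (distr unit_measure unit_measure doubling)"
    then have A: "A \<in> sets unit_measure" by simp
    then have Ab: "A \<in> sets borel" by (auto simp: unit_measure_def sets_restrict_space)
    have "emeasure (distr unit_measure unit_measure doubling) A = (\<integral>\<^sup>+u. indicator A u \<partial>distr unit_measure unit_measure doubling)"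
      using A by simp
    also have "\<dots> = (\<integral>\<^sup>+u. indicator A (doubling u) \<partial>unit_measure)"
      using A by (intro nn_integral_distr doubling_measurable) auto
    also have "\<dots> = (\<integral>\<^sup>+u. indicator A u \<partial>unit_measure)"
      using Ab by (intro nn_integral_doubling) auto
    also have "\<dots> = emeasure unit_measure A" using A by simp
    finally show "emeasure (distr unit_measure unit_measure doubling) A = emeasure unit_measure A" .
  qed simp
qed

lemma doubling_pow:
  assumes "u \<in> {0..<1}"
  shows "(doubling ^^ n) u = frac (2 ^ n * u)"
proof (induction n)
  case 0
  then show ?case using assms by (simp add: frac_eq)
next
  case (Suc n)
  have "frac (2 * frac y) = frac (2 * y)" for y :: real
  proof -
    have "2 * frac y = 2 * y + of_int (- 2 * \<lfloor>y\<rfloor>)" by (simp add: frac_def)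
    moreover have "frac (x + of_int k) = frac x" for x :: real and k by (simp add: frac_def)
    ultimately show ?thesis by (simp only:)
  qed
  then have "doubling (frac (2 ^ n * u)) = frac (2 ^ Suc n * u)" by (simp add: doubling_def mult.assoc)
  then show ?case using Suc by simp
qed

lemma integral_unit:
  fixes f :: "real \<Rightarrow> real"
  shows "(LINT u|unit_measure. f u) = (LINT u|lborel. indicator {0..<1} u * f u)"
  unfolding unit_measure_def by (subst integral_restrict_space) auto

text \<open>On a dyadic interval of length \<open>1 / 2 ^ n\<close> the second factor runs through
  one full copy of \<open>p\<close> and has mean 0, while the first is nearly constant by uniform
  continuity. Freezing the first factor on each interval makes the integral vanish exactly; the
  error is at most \<open>e' * B\<close>.\<close>

lemma doubling_mixing:
  fixes p :: "real \<Rightarrow> real"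
  assumes cont: "continuous_on {0..1} p" and meas [measurable]: "p \<in> borel_measurable borel"
    and B: "\<And>x. \<bar>p x\<bar> \<le> B" and mean: "(LINT u|unit_measure. p u) = 0" and e: "e > 0"
  shows "\<exists>d. \<forall>n\<ge>d. \<bar>LINT u|unit_measure. p u * p ((doubling ^^ n) u)\<bar> \<le> e"
proof -
  have B0: "B \<ge> 0" using B[of 0] by linarith
  \<comment> \<open>\<open>B + 1\<close> rather than \<open>B\<close>, as \<open>B\<close> may be
    0.\<close>
  define e' where "e' = e / (B + 1)"
  have e': "e' > 0" "e' * B \<le> e" using e B0 by (auto simp: e'_def field_simps)
  have "uniformly_continuous_on {0..1} p" using cont by (intro compact_uniformly_continuous) auto
  then obtain \<delta> where \<delta>: "\<delta> > 0" "\<And>x y. x \<in> {0..1} \<Longrightarrow> y \<in> {0..1} \<Longrightarrow> \<bar>y - x\<bar> < \<delta> \<Longrightarrow> \<bar>p y - p x\<bar> < e'"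
    unfolding uniformly_continuous_on_def dist_real_def using e'(1) by metis
  obtain d where d: "(1 / 2) ^ d < \<delta>" using real_arch_pow_inv[OF \<delta>(1), of "1/2"] by auto
  have "\<bar>LINT u|unit_measure. p u * p ((doubling ^^ n) u)\<bar> \<le> e" if n: "n \<ge> d" for n
  proof -
    define K where "K = (2::real) ^ n"
    have K: "K > 0" "1 / K < \<delta>"
    proof -
      show "K > 0" by (simp add: K_def)
      have "1 / K = (1 / 2) ^ n" by (simp add: K_def power_divide)
      also have "\<dots> \<le> (1 / 2) ^ d" using n by (intro power_decreasing) auto
      finally show "1 / K < \<delta>" using d by simp
    qed
    \<comment> \<open>The value of \<open>p\<close> at the left end of the dyadic interval
      containing \<open>u\<close>.\<close>
    define s where "s u = p (of_int \<lfloor>K * u\<rfloor> / K)" for u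
    have s_meas [measurable]: "s \<in> borel_measurable borel" unfolding s_def [abs_def] by measurable
    have frac_meas [measurable]: "(\<lambda>u. p (frac (K * u))) \<in> borel_measurable borel" unfolding frac_def by measurable
    have near: "\<bar>p u - s u\<bar> \<le> e'" if u: "u \<in> {0..<1}" for u
    proof -
      have "of_int \<lfloor>K * u\<rfloor> \<le> K * u" "K * u < of_int \<lfloor>K * u\<rfloor> + 1" by linarith+
      then have "(K * u - of_int \<lfloor>K * u\<rfloor>) / K < 1 / K" "of_int \<lfloor>K * u\<rfloor> / K \<le> K * u / K"
        using K by (intro divide_strict_right_mono divide_right_mono; linarith)+
      then have 1: "of_int \<lfloor>K * u\<rfloor> / K \<le> u" "u - of_int \<lfloor>K * u\<rfloor> / K < 1 / K"
        using K by (simp_all add: diff_divide_distrib)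
      have "0 \<le> of_int \<lfloor>K * u\<rfloor> / K" using u K by simp
      then have "of_int \<lfloor>K * u\<rfloor> / K \<in> {0..1}" using 1 u unfolding atLeastAtMost_iff atLeastLessThan_iff by linarith
      moreover have "\<bar>u - of_int \<lfloor>K * u\<rfloor> / K\<bar> < \<delta>" using 1 K by linarith
      ultimately have "\<bar>p u - p (of_int \<lfloor>K * u\<rfloor> / K)\<bar> < e'" using u by (intro \<delta>(2)) auto
      then show ?thesis by (simp add: s_def)
    qed
    have bint: "integrable unit_measure h" if "h \<in> borel_measurable borel" "\<And>u. \<bar>h u\<bar> \<le> C" for h and C :: real
      by (rule unit.integrable_const_bound[of _ C]) (use that borel_measurable_unit in auto)
    have bd: "\<bar>p x * p y\<bar> \<le> B * B" for x y unfolding abs_mult using B B0 by (intro mult_mono) auto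
    have bd_frac: "\<bar>s u * p (frac (K * u))\<bar> \<le> B * B" for u unfolding s_def by (rule bd)
    define \<psi> where "\<psi> u = indicator {0..<1} u * p u" for u
    have \<psi>0: "(LINT u|lborel. \<psi> u) = 0" using mean by (simp add: integral_unit \<psi>_def)
    have \<psi>i: "integrable lborel \<psi>"
    proof -
      have "integrable unit_measure p" by (rule bint[of _ B]) (use B meas in auto)
      then show ?thesis unfolding unit_measure_def \<psi>_def by (subst (asm) integrable_restrict_space) auto
    qed
    have shift0: "(LINT u|lborel. \<psi> (t + K * u)) = 0" for t
      using lborel_integral_real_affine[of K \<psi> t] K \<psi>0 by simp
    have shifti: "integrable lborel (\<lambda>u. \<psi> (t + K * u))" for t
      using lborel_integrable_real_affine[OF \<psi>i, of K t] K by simp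
    \<comment> \<open>Exactly one \<open>j\<close> contributes, namely the number of the dyadic
      interval containing \<open>u\<close>; outside the unit interval none does.\<close>
    have pw: "indicator {0..<1} u * (s u * p (frac (K * u))) = (\<Sum>j<2 ^ n. p (real j / K) * \<psi> (- real j + K * u))" for u
    proof (cases "u \<in> {0..<1}")
      case True
      define j0 where "j0 = nat \<lfloor>K * u\<rfloor>"
      have Ku: "0 \<le> K * u" "K * u < K" using True K by auto
      have j0: "real j0 = of_int \<lfloor>K * u\<rfloor>" using Ku by (simp add: j0_def)
      have "real j0 < 2 ^ n" using Ku unfolding j0 K_def by linarith
      then have j0n: "j0 < 2 ^ n" by simp
      have "p (real j / K) * \<psi> (- real j + K * u) = (if j = j0 then s u * p (frac (K * u)) else 0)" for j
      proof (cases "j = j0")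
        case True
        have "- real j0 + K * u = frac (K * u)" by (simp add: j0 frac_def)
        then show ?thesis using True by (simp add: \<psi>_def s_def j0 frac_lt_1)
      next
        case False
        have "\<not> (0 \<le> - real j + K * u \<and> - real j + K * u < 1)"
        proof
          assume "0 \<le> - real j + K * u \<and> - real j + K * u < 1"
          then have "\<lfloor>K * u\<rfloor> = int j" by (intro floor_unique) auto
          then show False using False by (simp add: j0_def)
        qed
        then show ?thesis using False by (auto simp: \<psi>_def indicator_def)
      qed
      then show ?thesis using True j0n by simp
    next
      case False
      have "\<psi> (- real j + K * u) = 0" if "j < 2 ^ n" for j
      proof -
        have "real j + 1 \<le> K" using that unfolding K_def by (metis Suc_leI of_nat_Suc of_nat_le_iff of_nat_numeral of_nat_power add.commute)
        then have "\<not> (0 \<le> - real j + K * u \<and> - real j + K * u < 1)"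
        proof (cases "u < 0")
          case True
          then have "K * u < 0" using K by (simp add: mult_pos_neg)
          then show ?thesis by simp
        next
          case False
          then have "K * u \<ge> K * 1" using \<open>u \<notin> {0..<1}\<close> K by (intro mult_left_mono) auto
          then show ?thesis using \<open>real j + 1 \<le> K\<close> by linarith
        qed
        then show ?thesis by (auto simp: \<psi>_def indicator_def)
      qed
      then show ?thesis using False by simp
    qed
    have zero: "(LINT u|unit_measure. s u * p (frac (K * u))) = 0"
    proof -
      have "(LINT u|lborel. (\<Sum>j<2 ^ n. p (real j / K) * \<psi> (- real j + K * u))) = (\<Sum>j<2 ^ n. (LINT u|lborel. p (real j / K) * \<psi> (- real j + K * u)))"
        by (intro Bochner_Integration.integral_sum integrable_mult_right shifti)
      then show ?thesis
        unfolding integral_unit pw integral_mult_right_zero shift0 mult_zero_right sum.neutral_const .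
    qed
    have "(LINT u|unit_measure. p u * p ((doubling ^^ n) u)) = (LINT u|unit_measure. p u * p (frac (K * u)))"
      by (intro Bochner_Integration.integral_cong) (auto simp: doubling_pow K_def)
    also have "\<dots> = (LINT u|unit_measure. p u * p (frac (K * u))) - (LINT u|unit_measure. s u * p (frac (K * u)))"
      by (simp add: zero)
    also have "\<dots> = (LINT u|unit_measure. p u * p (frac (K * u)) - s u * p (frac (K * u)))"
      by (intro Bochner_Integration.integral_diff[symmetric] bint[of _ "B * B"] bd bd_frac) measurable
    also have "\<bar>\<dots>\<bar> \<le> (LINT u|unit_measure. \<bar>p u * p (frac (K * u)) - s u * p (frac (K * u))\<bar>)"
      by (rule integral_abs_bound)
    also have "\<dots> \<le> (LINT u|unit_measure. e' * B)"
    proof (rule integral_mono)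
      show "integrable unit_measure (\<lambda>u. \<bar>p u * p (frac (K * u)) - s u * p (frac (K * u))\<bar>)"
        by (intro integrable_abs Bochner_Integration.integrable_diff bint[of _ "B * B"] bd bd_frac) measurable
      fix u assume "u \<in> space unit_measure"
      then have "\<bar>p u - s u\<bar> * \<bar>p (frac (K * u))\<bar> \<le> e' * B"
        using near[of u] B e' by (intro mult_mono) auto
      then show "\<bar>p u * p (frac (K * u)) - s u * p (frac (K * u))\<bar> \<le> e' * B"
        by (simp only: left_diff_distrib[symmetric] abs_mult)
    qed simp
    also have "\<dots> = e' * B" by (simp add: unit.prob_space del: space_unit)
    finally show ?thesis using e' by linarith
  qed
  then show ?thesis by blast
qed

section \<open>The Boole map\<close>

definition boole_param :: "real \<Rightarrow> real \<Rightarrow> real \<Rightarrow> real" where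
  "boole_param \<alpha> \<beta> u = \<beta> + \<alpha> * cot (pi * u)"

text \<open>Since \<open>x / 0 = 0\<close>, the duplication formula for \<open>cot\<close> holds at the poles as well.\<close>

lemma cot_duplication: "(cot \<theta> - 1 / cot \<theta>) / 2 = cot (2 * \<theta> :: real)"
proof (cases "sin \<theta> = 0 \<or> cos \<theta> = 0")
  case True
  then have "sin (2 * \<theta>) = 0" by (auto simp: sin_double)
  then show ?thesis using True by (auto simp: cot_def)
next
  case False
  then show ?thesis
    by (simp add: cot_def sin_double cos_double divide_simps power2_eq_square)
qed

text \<open>The duplication formula for \<open>cot\<close>. Where the cotangent is 0, the convention
  that the Boole map fixes \<open>\<beta>\<close> matches \<open>1 / 0 = 0\<close>, so the conjugacy
  holds for every \<open>u\<close> without an exceptional set.\<close>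

lemma boole_map_param:
  assumes \<alpha>: "\<alpha> > 0"
  shows "boole_map \<alpha> \<beta> (boole_param \<alpha> \<beta> u) = boole_param \<alpha> \<beta> (doubling u)"
proof -
  have per: "cot (pi * frac v) = cot (pi * v)" for v
  proof -
    have "pi * frac v = pi * v + of_int (- \<lfloor>v\<rfloor>) * pi" by (simp add: frac_def algebra_simps)
    moreover have "cot (y + of_int k * pi) = cot y" for y and k :: int
      by (simp add: cot_def sin_add cos_add sin_npi_int cos_npi_int field_simps)
    ultimately show ?thesis by (simp only:)
  qed
  have "boole_map \<alpha> \<beta> (boole_param \<alpha> \<beta> u) = \<beta> + \<alpha> * ((cot (pi * u) - 1 / cot (pi * u)) / 2)"
  proof (cases "cot (pi * u) = 0")
    case False
    then show ?thesis using \<alpha> by (simp add: boole_map_def boole_param_def divide_simps power2_eq_square) (simp add: algebra_simps)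
  qed (simp add: boole_map_def boole_param_def)
  also have "\<dots> = boole_param \<alpha> \<beta> (doubling u)"
    unfolding cot_duplication boole_param_def doubling_def per by (simp add: mult_ac)
  finally show ?thesis .
qed

lemma boole_map_pow:
  assumes "\<alpha> > 0"
  shows "(boole_map \<alpha> \<beta> ^^ n) (boole_param \<alpha> \<beta> u) = boole_param \<alpha> \<beta> ((doubling ^^ n) u)"
  by (induction n) (simp_all add: boole_map_param[OF assms])

lemma boole_param_measurable [measurable]: "boole_param \<alpha> \<beta> \<in> borel_measurable borel"
  unfolding boole_param_def [abs_def] cot_def by measurable

text \<open>The derivative of \<open>cot\<close> is \<open>- (1 + cot\<^sup>2)\<close>. In terms of
  \<open>x\<close> it is minus the reciprocal of the Cauchy density, the form in which a change of
  variables cancels the kernel.\<close>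

lemma boole_param_deriv:
  assumes "\<alpha> > 0" "u \<in> {0<..<1}"
  shows "(boole_param \<alpha> \<beta> has_real_derivative - (pi / \<alpha> * (\<alpha>\<^sup>2 + (boole_param \<alpha> \<beta> u - \<beta>)\<^sup>2))) (at u within S)"
proof -
  have s: "sin (pi * u) > 0" using assms by (intro sin_gt_zero) auto
  have "(boole_param \<alpha> \<beta> has_real_derivative \<alpha> * (- inverse ((sin (pi * u))\<^sup>2) * pi)) (at u)"
  proof -
    have "((\<lambda>x. cot (pi * x)) has_real_derivative - inverse ((sin (pi * u))\<^sup>2) * pi) (at u)"
      by (rule DERIV_chain2[OF DERIV_cot]) (use s in \<open>auto intro!: derivative_eq_intros\<close>)
    then show ?thesis unfolding boole_param_def by (auto intro!: derivative_eq_intros)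
  qed
  also have "\<alpha> * (- inverse ((sin (pi * u))\<^sup>2) * pi) = - (pi / \<alpha> * (\<alpha>\<^sup>2 + (boole_param \<alpha> \<beta> u - \<beta>)\<^sup>2))"
  proof -
    have cc: "cos (pi * u) * cos (pi * u) = 1 - sin (pi * u) * sin (pi * u)"
      using sin_cos_squared_add[of "pi * u"] by (simp add: power2_eq_square)
    have "\<alpha>\<^sup>2 + (boole_param \<alpha> \<beta> u - \<beta>)\<^sup>2 = \<alpha>\<^sup>2 / (sin (pi * u))\<^sup>2"
      using s by (simp add: boole_param_def cot_def field_simps power2_eq_square cc)
    then show ?thesis using s assms by (simp only:) (simp add: field_simps power2_eq_square)
  qed
  finally show ?thesis by (rule has_field_derivative_at_within)
qed

lemma boole_param_inj: "\<alpha> > 0 \<Longrightarrow> inj_on (boole_param \<alpha> \<beta>) {0<..<1}"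
proof (rule inj_onI)
  fix u v :: real assume \<alpha>: "\<alpha> > 0" and uv: "u \<in> {0<..<1}" "v \<in> {0<..<1}" "boole_param \<alpha> \<beta> u = boole_param \<alpha> \<beta> v"
  have s: "sin (pi * u) > 0" "sin (pi * v) > 0" using uv by (auto intro!: sin_gt_zero)
  have "cot (pi * u) = cot (pi * v)" using uv(3) \<alpha> by (simp add: boole_param_def)
  then have "sin (pi * u - pi * v) = 0" using s by (simp add: cot_def sin_diff field_simps)
  moreover have "\<bar>pi * u - pi * v\<bar> < pi"
  proof -
    have "\<bar>pi * u - pi * v\<bar> = pi * \<bar>u - v\<bar>" by (simp add: abs_mult flip: right_diff_distrib)
    also have "\<dots> < pi * 1" using uv by (intro mult_strict_left_mono) auto
    finally show ?thesis by simp
  qed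
  ultimately have "pi * u - pi * v = 0" using sin_eq_0_pi[of "pi * u - pi * v"] by auto
  then show "u = v" by simp
qed

lemma boole_param_surj:
  assumes \<alpha>: "\<alpha> > 0"
  shows "\<exists>u\<in>{0<..<1}. boole_param \<alpha> \<beta> u = x"
proof
  define \<theta> where "\<theta> = arctan ((x - \<beta>) / \<alpha>)"
  have \<theta>: "- (pi / 2) < \<theta>" "\<theta> < pi / 2" unfolding \<theta>_def by (rule arctan_lbound arctan_ubound)+
  define u where "u = 1 / 2 - \<theta> / pi"
  show "u \<in> {0<..<1}" using \<theta> by (auto simp: u_def field_simps)
  have "pi * u = pi / 2 - \<theta>" by (simp add: u_def field_simps)
  then have "cot (pi * u) = tan \<theta>"
    by (simp add: cot_def tan_def sin_diff cos_diff)
  then show "boole_param \<alpha> \<beta> u = x" using \<alpha> by (simp add: boole_param_def \<theta>_def tan_arctan)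
qed

lemma boole_param_image: "\<alpha> > 0 \<Longrightarrow> boole_param \<alpha> \<beta> ` {0<..<1} = UNIV"
  using boole_param_surj by (metis UNIV_eq_I imageI)

text \<open>A differentiable map sends null sets to null sets, and already the open interval is
  mapped onto the whole line. The image need not be Borel, hence the passage through
  \<open>lebesgue\<close>.\<close>

lemma AE_boole_param:
  assumes \<alpha>: "\<alpha> > 0" and AE: "AE u in unit_measure. P (boole_param \<alpha> \<beta> u)"
  shows "AE x in lborel. P x"
proof -
  have "AE u in lborel. u \<in> {0..<1} \<longrightarrow> P (boole_param \<alpha> \<beta> u)"
    using AE unfolding unit_measure_def by (subst (asm) AE_restrict_space_iff) auto
  then obtain N where N: "N \<in> null_sets lborel" "{u. \<not> (u \<in> {0..<1} \<longrightarrow> P (boole_param \<alpha> \<beta> u))} \<subseteq> N"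
    by (auto elim!: AE_E simp: null_sets_def)
  have "negligible N" using N(1) by (simp add: negligible_iff_null_sets null_sets_completionI)
  then have "negligible (N \<inter> {0<..<1})" by (rule negligible_subset) auto
  then have "negligible (boole_param \<alpha> \<beta> ` (N \<inter> {0<..<1}))"
  proof (rule negligible_differentiable_image_negligible[rotated])
    show "boole_param \<alpha> \<beta> differentiable_on N \<inter> {0<..<1}"
      unfolding differentiable_on_def
      using boole_param_deriv[OF \<alpha>] unfolding real_differentiable_def by blast
  qed simp
  moreover have "{x. \<not> P x} \<subseteq> boole_param \<alpha> \<beta> ` (N \<inter> {0<..<1})"
  proof
    fix x assume x: "x \<in> {x. \<not> P x}"
    obtain u where u: "u \<in> {0<..<1}" "boole_param \<alpha> \<beta> u = x" using boole_param_surj[OF \<alpha>] by blast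
    then have "u \<in> N" using N(2) x by auto
    then show "x \<in> boole_param \<alpha> \<beta> ` (N \<inter> {0<..<1})" using u by blast
  qed
  ultimately have "{x. \<not> P x} \<in> null_sets lebesgue"
    using negligible_subset negligible_iff_null_sets by blast
  then have "AE x in lebesgue. P x" by (auto intro: AE_I')
  then show ?thesis by (simp add: AE_completion_iff)
qed

text \<open>Change of variables on the open interval: the absolute derivative times the kernel is
  the constant \<open>pi / \<alpha>\<close>. The point 0 is added back as a null set.\<close>

lemma integral_boole_param:
  fixes f :: "real \<Rightarrow> real"
  assumes \<alpha>: "\<alpha> > 0" and f: "continuous_on UNIV f" and int: "integrable lborel (\<lambda>x. f x / (\<alpha>\<^sup>2 + (x - \<beta>)\<^sup>2))"
  shows "integrable unit_measure (\<lambda>u. f (boole_param \<alpha> \<beta> u))"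
    and "(LINT u|unit_measure. f (boole_param \<alpha> \<beta> u)) = \<alpha> / pi * (LINT x|lborel. f x / (\<alpha>\<^sup>2 + (x - \<beta>)\<^sup>2))"
proof -
  have [measurable]: "f \<in> borel_measurable borel" using f by (rule borel_measurable_continuous_onI)
  define X where "X = boole_param \<alpha> \<beta>"
  have [measurable]: "X \<in> borel_measurable borel" by (simp add: X_def)
  define g where "g x = f x / (\<alpha>\<^sup>2 + (x - \<beta>)\<^sup>2)" for x
  define J where "J = (LINT x|lborel. g x)"
  have ig: "integrable lborel g" using int by (simp add: g_def [abs_def])
  have "(g has_integral J) UNIV" unfolding J_def by (rule has_integral_integral_lborel[OF ig])
  moreover have "set_integrable lebesgue UNIV g"
    unfolding set_integrable_def using ig by (simp add: integrable_completion)
  ultimately have "g absolutely_integrable_on X ` {0<..<1} \<and> integral (X ` {0<..<1}) g = J"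
    unfolding X_def boole_param_image[OF \<alpha>] by (simp add: integral_unique)
  then have "(\<lambda>u. \<bar>- (pi / \<alpha> * (\<alpha>\<^sup>2 + (X u - \<beta>)\<^sup>2))\<bar> *\<^sub>R g (X u)) absolutely_integrable_on {0<..<1} \<and>
      integral {0<..<1} (\<lambda>u. \<bar>- (pi / \<alpha> * (\<alpha>\<^sup>2 + (X u - \<beta>)\<^sup>2))\<bar> *\<^sub>R g (X u)) = J"
    using boole_param_deriv[OF \<alpha>] boole_param_inj[OF \<alpha>] unfolding X_def
    by (subst has_absolute_integral_change_of_variables_real) auto
  also have "(\<lambda>u. \<bar>- (pi / \<alpha> * (\<alpha>\<^sup>2 + (X u - \<beta>)\<^sup>2))\<bar> *\<^sub>R g (X u)) = (\<lambda>u. pi / \<alpha> * f (X u))"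
  proof
    fix u
    have "\<alpha>\<^sup>2 + (X u - \<beta>)\<^sup>2 > 0" using \<alpha> by (intro add_pos_nonneg) auto
    then show "\<bar>- (pi / \<alpha> * (\<alpha>\<^sup>2 + (X u - \<beta>)\<^sup>2))\<bar> *\<^sub>R g (X u) = pi / \<alpha> * f (X u)"
      using \<alpha> by (simp add: g_def abs_mult)
  qed
  finally have abs: "(\<lambda>u. pi / \<alpha> * f (X u)) absolutely_integrable_on {0<..<1}" and
    eq: "integral {0<..<1} (\<lambda>u. pi / \<alpha> * f (X u)) = J" by auto
  have meas: "(\<lambda>u. indicator {0<..<1} u *\<^sub>R (pi / \<alpha> * f (X u))) \<in> borel_measurable lborel" by measurable
  have sl: "integrable lborel (\<lambda>u. indicator {0<..<1} u *\<^sub>R (pi / \<alpha> * f (X u)))"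
    using abs meas unfolding set_integrable_def by (simp add: integrable_completion)
  then have "set_integrable lborel {0<..<1} (\<lambda>u. pi / \<alpha> * f (X u))" by (simp add: set_integrable_def)
  then have li: "(LINT u|lborel. indicator {0<..<1} u *\<^sub>R (pi / \<alpha> * f (X u))) = J"
    using eq set_borel_integral_eq_integral(2) unfolding set_lebesgue_integral_def by metis
  have ae: "AE u in lborel. \<alpha> / pi * (indicator {0<..<1} u *\<^sub>R (pi / \<alpha> * f (X u))) = indicator {0..<1} u *\<^sub>R f (X u)"
    using AE_lborel_singleton[of "0::real"] by eventually_elim (use \<alpha> in \<open>auto simp: indicator_def\<close>)
  have sl': "integrable lborel (\<lambda>u. \<alpha> / pi * (indicator {0<..<1} u *\<^sub>R (pi / \<alpha> * f (X u))))"
    using sl by (intro integrable_mult_right)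
  have "integrable lborel (\<lambda>u. indicator {0..<1} u *\<^sub>R f (X u))"
    by (rule integrable_cong_AE_imp[OF sl']) (use ae in \<open>auto elim: eventually_mono\<close>)
  then show "integrable unit_measure (\<lambda>u. f (boole_param \<alpha> \<beta> u))"
    unfolding unit_measure_def X_def by (subst integrable_restrict_space) auto
  have "(LINT u|unit_measure. f (X u)) = (LINT u|lborel. indicator {0..<1} u *\<^sub>R f (X u))"
    unfolding unit_measure_def by (subst integral_restrict_space) auto
  also have "\<dots> = (LINT u|lborel. \<alpha> / pi * (indicator {0<..<1} u *\<^sub>R (pi / \<alpha> * f (X u))))"
    by (rule integral_cong_AE) (use ae in \<open>auto elim: eventually_mono\<close>)
  also have "\<dots> = \<alpha> / pi * J" using li by (subst integral_mult_right_zero) simp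
  finally show "(LINT u|unit_measure. f (boole_param \<alpha> \<beta> u)) = \<alpha> / pi * (LINT x|lborel. f x / (\<alpha>\<^sup>2 + (x - \<beta>)\<^sup>2))"
    by (simp add: X_def J_def g_def)
qed


text \<open>A piecewise linear ramp at each end: 0 within \<open>1 / n\<close> of the ends and
  outside the unit interval, and 1 at distance at least \<open>2 / n\<close> from both ends. It
  removes the poles of \<open>cot (pi * u)\<close> at 0 and 1.\<close>

definition cutoff :: "nat \<Rightarrow> real \<Rightarrow> real" where
  "cutoff n u = max 0 (min 1 (real n * u - 1)) * max 0 (min 1 (real n * (1 - u) - 1))"

lemma cutoff_bounds: "0 \<le> cutoff n u" "cutoff n u \<le> 1"
  by (auto simp: cutoff_def intro!: mult_le_one)

lemma cutoff_tendsto: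
  assumes "u \<in> {0<..<1}"
  shows "(\<lambda>n. cutoff n u) \<longlonglongrightarrow> 1"
proof (rule tendsto_eventually)
  obtain N :: nat where N: "2 / u < real N" "2 / (1 - u) < real N"
    using reals_Archimedean2[of "max (2 / u) (2 / (1 - u))"] by auto
  show "\<forall>\<^sub>F n in sequentially. cutoff n u = 1"
    using eventually_ge_at_top[of N]
  proof eventually_elim
    case (elim n)
    then have "2 / u < real n" "2 / (1 - u) < real n" using N by auto
    then have "real n * u - 1 \<ge> 1" "real n * (1 - u) - 1 \<ge> 1" using assms by (auto simp: field_simps)
    then show ?case by (simp add: cutoff_def min_def)
  qed
qed

text \<open>\<open>f\<close> composed with the cotangent may be unbounded near 0 and 1. Multiplied
  by \<open>cutoff n\<close> it becomes continuous and bounded, and dominated convergence gives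
  closeness in L1.\<close>

lemma boole_param_approx:
  fixes f :: "real \<Rightarrow> real"
  assumes \<alpha>: "\<alpha> > 0" and f: "continuous_on UNIV f" and int: "integrable unit_measure (\<lambda>u. f (boole_param \<alpha> \<beta> u))" and e: "e > 0"
  shows "\<exists>p B. continuous_on UNIV p \<and> (\<forall>x. \<bar>p x\<bar> \<le> B) \<and> (LINT u|unit_measure. \<bar>f (boole_param \<alpha> \<beta> u) - p u\<bar>) < e"
proof -
  define F where "F u = f (boole_param \<alpha> \<beta> u)" for u
  have F_meas [measurable]: "F \<in> borel_measurable borel"
    unfolding F_def [abs_def] using borel_measurable_continuous_onI[OF f] by measurable
  have F_cont: "continuous_on {0<..<1} F"
  proof -
    have "continuous_on {0<..<1} (boole_param \<alpha> \<beta>)"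
      using boole_param_deriv[OF \<alpha>] by (meson DERIV_continuous_on)
    then show ?thesis unfolding F_def by (intro continuous_on_compose2[OF f]) auto
  qed
  have cut_cont: "continuous_on S (cutoff n)" for n S
    unfolding cutoff_def [abs_def] by (intro continuous_intros)
  define p where "p n u = F u * cutoff n u" for n :: nat and u
  have p_zero: "cutoff n u = 0" if "real n * u < 1 \<or> real n * (1 - u) < 1" for n u
    using that by (auto simp: cutoff_def)
  have p_cont: "continuous_on UNIV (p n)" for n
  proof -
    \<comment> \<open>On this open set the cutoff vanishes; it contains everything outside the open
      unit interval, so the two open sets cover the line and continuity can be glued.\<close>
    define A where "A = {u. real n * u < 1 \<or> real n * (1 - u) < 1}"
    have "A = {u. real n * u < 1} \<union> {u. real n * (1 - u) < 1}" by (auto simp: A_def)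
    then have "open A" by (auto intro!: open_Collect_less continuous_intros)
    moreover have "continuous_on A (p n)"
      by (rule continuous_on_eq[of _ "\<lambda>_. 0"]) (auto simp: A_def p_def p_zero)
    moreover have "continuous_on {0<..<1} (p n)"
      unfolding p_def by (intro continuous_intros F_cont cut_cont)
    ultimately have "continuous_on (A \<union> {0<..<1}) (p n)" by (intro continuous_on_open_Un) auto
    moreover have "u \<in> A \<union> {0<..<1}" for u
    proof (cases "0 < u \<and> u < 1")
      case False
      then have "real n * u \<le> 0 \<or> real n * (1 - u) \<le> 0" by (auto simp: mult_le_0_iff)
      then show ?thesis by (auto simp: A_def)
    qed auto
    then have "A \<union> {0<..<1} = UNIV" by blast
    ultimately show ?thesis by simp
  qed
  have p_bd: "\<exists>B. \<forall>x. \<bar>p n x\<bar> \<le> B" for n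
  proof -
    have "bounded (p n ` {0..1})"
      by (intro compact_imp_bounded compact_continuous_image continuous_on_subset[OF p_cont]) auto
    then obtain B where B: "\<And>x. x \<in> {0..1} \<Longrightarrow> \<bar>p n x\<bar> \<le> B" unfolding bounded_iff real_norm_def by blast
    have "\<bar>p n x\<bar> \<le> B" for x
    proof (cases "x \<in> {0..1}")
      case False
      then have "real n * x \<le> 0 \<or> real n * (1 - x) \<le> 0" by (auto simp: mult_le_0_iff)
      then have "p n x = 0" unfolding p_def by (subst p_zero) auto
      then show ?thesis using B[of 0] by simp
    qed (rule B)
    then show ?thesis by blast
  qed
  have "(\<lambda>n. LINT u|unit_measure. \<bar>F u - p n u\<bar>) \<longlonglongrightarrow> (LINT u|unit_measure. 0)"
  proof (rule integral_dominated_convergence)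
    show "integrable unit_measure (\<lambda>u. \<bar>F u\<bar>)" using int by (simp add: F_def)
    have p_meas: "p n \<in> borel_measurable borel" for n by (rule borel_measurable_continuous_onI[OF p_cont])
    then show "(\<lambda>u. \<bar>F u - p n u\<bar>) \<in> borel_measurable unit_measure" for n
      by (intro borel_measurable_unit) measurable
    show "AE u in unit_measure. norm \<bar>F u - p n u\<bar> \<le> \<bar>F u\<bar>" for n
    proof (rule AE_I2)
      fix u
      have "F u - p n u = F u * (1 - cutoff n u)" by (simp add: p_def algebra_simps)
      then show "norm \<bar>F u - p n u\<bar> \<le> \<bar>F u\<bar>"
        using cutoff_bounds[of n u] by (simp add: abs_mult mult_left_le)
    qed
    have "AE u in unit_measure. u \<noteq> 0"
      unfolding unit_measure_def by (subst AE_restrict_space_iff) (use AE_lborel_singleton[of "0::real"] in \<open>auto elim: eventually_mono\<close>)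
    then show "AE u in unit_measure. (\<lambda>n. \<bar>F u - p n u\<bar>) \<longlonglongrightarrow> 0"
    proof (rule AE_mp[OF _ AE_I2], intro impI)
      fix u assume u: "u \<in> space unit_measure" "u \<noteq> 0"
      then have "u \<in> {0<..<1}" by auto
      then have "(\<lambda>n. \<bar>F u - F u * cutoff n u\<bar>) \<longlonglongrightarrow> \<bar>F u - F u * 1\<bar>"
        by (intro tendsto_intros cutoff_tendsto)
      then show "(\<lambda>n. \<bar>F u - p n u\<bar>) \<longlonglongrightarrow> 0" by (simp add: p_def)
    qed
  qed simp
  then have "\<forall>\<^sub>F n in sequentially. (LINT u|unit_measure. \<bar>F u - p n u\<bar>) < e"
    using e by (intro order_tendstoD(2)) auto
  then obtain n where n: "(LINT u|unit_measure. \<bar>F u - p n u\<bar>) < e"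
    using eventually_happens sequentially_bot by blast
  obtain B where "\<forall>x. \<bar>p n x\<bar> \<le> B" using p_bd by blast
  then show ?thesis using n p_cont unfolding F_def by blast
qed

text \<open>All the work is done for the doubling map; the conjugacy carries the orbit sums over,
  and null sets are pushed forward by \<open>AE_boole_param\<close>.\<close>

theorem boole_moving_ergodic:
  fixes f :: "real \<Rightarrow> real"
  assumes \<alpha>: "\<alpha> > 0" and st: "stoltz ns ks" and f: "continuous_on UNIV f"
    and int: "integrable lborel (\<lambda>x. f x / (\<alpha>\<^sup>2 + (x - \<beta>)\<^sup>2))"
  shows "AE x in lborel. (\<lambda>q. (\<Sum>j=1..ks q. f ((boole_map \<alpha> \<beta> ^^ (ns q + j)) x)) / real (ks q)) \<longlonglongrightarrow>
    \<alpha> / pi * (LINT x|lborel. f x / (\<alpha>\<^sup>2 + (x - \<beta>)\<^sup>2))"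
proof (rule AE_boole_param[OF \<alpha>])
  define F where "F u = f (boole_param \<alpha> \<beta> u)" for u
  note F = integral_boole_param[OF \<alpha> f int, folded F_def]
  have "AE u in unit_measure. (\<lambda>q. unit.moving_sum F (ns q) (ks q) u / real (ks q)) \<longlonglongrightarrow> (LINT u|unit_measure. F u)"
  proof (rule unit.moving_ergodic_theorem[OF st F(1)])
    fix e :: real assume e: "e > 0"
    obtain p B where p: "continuous_on UNIV p" "\<And>x. \<bar>p x\<bar> \<le> B" "(LINT u|unit_measure. \<bar>F u - p u\<bar>) < e"
      using boole_param_approx[OF \<alpha> f F(1)[unfolded F_def] e] unfolding F_def by blast
    have pm [measurable]: "p \<in> borel_measurable borel" by (rule borel_measurable_continuous_onI[OF p(1)])
    have ip: "integrable unit_measure p"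
      by (rule unit.integrable_const_bound[of _ B]) (use p(2) borel_measurable_unit[OF pm] in auto)
    define c where "c = (LINT u|unit_measure. p u)"
    \<comment> \<open>Centred because the mixing estimate needs mean 0; averages of \<open>p\<close>
      and \<open>p0\<close> differ by the constant \<open>c\<close>.\<close>
    define p0 where "p0 u = p u - c" for u
    have p0m: "p0 \<in> borel_measurable borel" unfolding p0_def [abs_def] by measurable
    have p0B: "\<bar>p0 x\<bar> \<le> B + \<bar>c\<bar>" for x using p(2)[of x] by (simp add: p0_def)
    have mean: "(LINT u|unit_measure. p0 u) = 0"
      unfolding p0_def using ip by (simp add: c_def unit.prob_space del: space_unit)
    have "\<exists>N>0. \<exists>r. (LINT u|unit_measure. \<bar>(\<Sum>i<N. p0 ((doubling ^^ r i) u)) / real N\<bar>) < e"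
    proof (rule unit.mixing_imp_mean_ergodic[OF borel_measurable_unit[OF p0m] p0B _ e])
      show "\<exists>d. \<forall>n\<ge>d. \<bar>LINT u|unit_measure. p0 u * p0 ((doubling ^^ n) u)\<bar> \<le> e'" if "e' > 0" for e'
        by (rule doubling_mixing[OF _ p0m p0B mean that])
           (auto simp: p0_def intro!: continuous_intros intro: continuous_on_subset[OF p(1)])
    qed
    then obtain N r where N: "N > 0" "(LINT u|unit_measure. \<bar>(\<Sum>i<N. p0 ((doubling ^^ r i) u)) / real N\<bar>) < e" by blast
    have "(\<Sum>i<N. p0 ((doubling ^^ r i) u)) / real N = (\<Sum>i<N. p ((doubling ^^ r i) u)) / real N - c" for u
      using N(1) by (simp add: p0_def sum_subtractf diff_divide_distrib)
    then have "(LINT u|unit_measure. \<bar>(\<Sum>i<N. p ((doubling ^^ r i) u)) / real N - (LINT u|unit_measure. p u)\<bar>) < e"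
      using N(2) by (simp only: c_def)
    then have "\<exists>N>0. \<exists>r. (LINT x|unit_measure. \<bar>(\<Sum>i<N. p ((doubling ^^ r i) x)) / real N - (LINT x|unit_measure. p x)\<bar>) < e"
      using N(1) by blast
    then show "\<exists>p B. p \<in> borel_measurable unit_measure \<and> (\<forall>x. \<bar>p x\<bar> \<le> B) \<and> (LINT x|unit_measure. \<bar>F x - p x\<bar>) < e \<and>
      (\<exists>N>0. \<exists>r. (LINT x|unit_measure. \<bar>(\<Sum>i<N. p ((doubling ^^ r i) x)) / real N - (LINT x|unit_measure. p x)\<bar>) < e)"
      using p(2,3) borel_measurable_unit[OF pm] by (intro exI[of _ p] exI[of _ B] conjI allI)
  qed
  then show "AE u in unit_measure. (\<lambda>q. (\<Sum>j=1..ks q. f ((boole_map \<alpha> \<beta> ^^ (ns q + j)) (boole_param \<alpha> \<beta> u))) / real (ks q)) \<longlonglongrightarrow>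
    \<alpha> / pi * (LINT x|lborel. f x / (\<alpha>\<^sup>2 + (x - \<beta>)\<^sup>2))"
    unfolding F(2) unit.moving_sum_def unfolding F_def boole_map_pow[OF \<alpha>] .
qed

section \<open>Vertical averages of L-functions\<close>

theorem boole_moving_ergodic_complex:
  fixes f :: "real \<Rightarrow> complex"
  assumes \<alpha>: "\<alpha> > 0" and st: "stoltz ns ks" and f: "continuous_on UNIV f"
    and int: "integrable lborel (\<lambda>x. f x / of_real (\<alpha>\<^sup>2 + (x - \<beta>)\<^sup>2))"
  shows "AE x in lborel. (\<lambda>q. 1 / of_nat (ks q) * (\<Sum>j=1..ks q. f ((boole_map \<alpha> \<beta> ^^ (ns q + j)) x))) \<longlonglongrightarrow>
    of_real (\<alpha> / pi) * (LINT x|lborel. f x / of_real (\<alpha>\<^sup>2 + (x - \<beta>)\<^sup>2))"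
proof -
  define I where "I = (LINT x|lborel. f x / of_real (\<alpha>\<^sup>2 + (x - \<beta>)\<^sup>2))"
  have re: "Re (f x / of_real (\<alpha>\<^sup>2 + (x - \<beta>)\<^sup>2)) = Re (f x) / (\<alpha>\<^sup>2 + (x - \<beta>)\<^sup>2)"
    and im: "Im (f x / of_real (\<alpha>\<^sup>2 + (x - \<beta>)\<^sup>2)) = Im (f x) / (\<alpha>\<^sup>2 + (x - \<beta>)\<^sup>2)" for x
    by (simp_all only: Re_divide_of_real Im_divide_of_real)
  have ire: "integrable lborel (\<lambda>x. Re (f x) / (\<alpha>\<^sup>2 + (x - \<beta>)\<^sup>2))"
    and lre: "(LINT x|lborel. Re (f x) / (\<alpha>\<^sup>2 + (x - \<beta>)\<^sup>2)) = Re I"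
    using integrable_Re[OF int] integral_Re[OF int] by (simp_all only: re I_def)
  have iim: "integrable lborel (\<lambda>x. Im (f x) / (\<alpha>\<^sup>2 + (x - \<beta>)\<^sup>2))"
    and lim: "(LINT x|lborel. Im (f x) / (\<alpha>\<^sup>2 + (x - \<beta>)\<^sup>2)) = Im I"
    using integrable_Im[OF int] integral_Im[OF int] by (simp_all only: im I_def)
  have "continuous_on UNIV (\<lambda>x. Re (f x))" "continuous_on UNIV (\<lambda>x. Im (f x))"
    by (intro continuous_intros f)+
  note AE = boole_moving_ergodic[OF \<alpha> st this(1) ire] boole_moving_ergodic[OF \<alpha> st this(2) iim]
  show ?thesis
    using AE
  proof eventually_elim
    case (elim x)
    then show ?case
      unfolding tendsto_complex_iff lre lim I_def[symmetric] by simp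
  qed
qed

lemma L_vertical_average:
  fixes k :: nat
  assumes \<alpha>: "\<alpha> > 0" and char: "dirichlet_character m chi" and st: "stoltz ns ks"
    and s: "Re s > - 1 / 2" "Re s \<noteq> 1"
  defines "f \<equiv> \<lambda>\<tau>. (deriv ^^ k) (dirichlet_L chi) (s + \<i> * of_real \<tau>)"
  shows "integrable lborel (\<lambda>\<tau>. f \<tau> / of_real (\<alpha>\<^sup>2 + (\<tau> - \<beta>)\<^sup>2))"
    and "AE x in lborel. (\<lambda>q. 1 / of_nat (ks q) * (\<Sum>j=1..ks q. f ((boole_map \<alpha> \<beta> ^^ (ns q + j)) x))) \<longlonglongrightarrow>
      of_real (\<alpha> / pi) * (LINT \<tau>|lborel. f \<tau> / of_real (\<alpha>\<^sup>2 + (\<tau> - \<beta>)\<^sup>2))"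
proof -
  have cont: "continuous_on UNIV f" unfolding f_def by (rule vertical_line_continuous[OF char s(2)])
  obtain C e where e: "e < 1" and C: "\<And>\<tau>. norm (f \<tau>) \<le> C * (1 + \<bar>\<tau>\<bar>) powr e"
    using vertical_line_growth[OF char s, of k] unfolding f_def by blast
  show int: "integrable lborel (\<lambda>\<tau>. f \<tau> / of_real (\<alpha>\<^sup>2 + (\<tau> - \<beta>)\<^sup>2))"
    by (rule integrable_cauchy_kernel[OF \<alpha> cont C e])
  show "AE x in lborel. (\<lambda>q. 1 / of_nat (ks q) * (\<Sum>j=1..ks q. f ((boole_map \<alpha> \<beta> ^^ (ns q + j)) x))) \<longlonglongrightarrow>
      of_real (\<alpha> / pi) * (LINT \<tau>|lborel. f \<tau> / of_real (\<alpha>\<^sup>2 + (\<tau> - \<beta>)\<^sup>2))"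
    by (rule boole_moving_ergodic_complex[OF \<alpha> st cont int])
qed

theorem theorem7p5:
  fixes \<alpha> \<beta> :: real and m k :: nat and chi :: "int \<Rightarrow> complex"
    and ns ks :: "nat \<Rightarrow> nat" and s :: complex
  assumes "\<alpha> > 0"
    and "dirichlet_character m chi"
    and "stoltz ns ks"
    and "Re s > - 1 / 2" and "Re s \<noteq> 1"
  shows "(chi \<noteq> principal_character m \<longrightarrow>
      integrable lborel (\<lambda>\<tau>. (deriv ^^ k) (dirichlet_L chi) (s + \<i> * of_real \<tau>)
                              / of_real (\<alpha>\<^sup>2 + (\<tau> - \<beta>)\<^sup>2)) \<and>
      (AE x in lborel.
         (\<lambda>q. 1 / of_nat (ks q) *
              (\<Sum>j = 1..ks q. (deriv ^^ k) (dirichlet_L chi)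
                 (s + \<i> * of_real ((boole_map \<alpha> \<beta> ^^ (ns q + j)) x))))
         \<longlonglongrightarrow> of_real (\<alpha> / pi) *
              (LINT \<tau>|lborel. (deriv ^^ k) (dirichlet_L chi) (s + \<i> * of_real \<tau>)
                              / of_real (\<alpha>\<^sup>2 + (\<tau> - \<beta>)\<^sup>2))) \<and>
      of_real (\<alpha> / pi) *
        (LINT \<tau>|lborel. (deriv ^^ k) (dirichlet_L chi) (s + \<i> * of_real \<tau>)
                        / of_real (\<alpha>\<^sup>2 + (\<tau> - \<beta>)\<^sup>2))
        = (deriv ^^ k) (dirichlet_L chi) (s + of_real \<alpha> + \<i> * of_real \<beta>)) \<and>
    (chi = principal_character m \<longrightarrow>
      integrable lborel (\<lambda>\<tau>. (deriv ^^ k) (dirichlet_L chi) (s + \<i> * of_real \<tau>)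
                              / of_real (\<alpha>\<^sup>2 + (\<tau> - \<beta>)\<^sup>2)) \<and>
      (AE x in lborel.
         (\<lambda>q. 1 / of_nat (ks q) *
              (\<Sum>j = 1..ks q. (deriv ^^ k) (dirichlet_L chi)
                 (s + \<i> * of_real ((boole_map \<alpha> \<beta> ^^ (ns q + j)) x))))
         \<longlonglongrightarrow> of_real (\<alpha> / pi) *
              (LINT \<tau>|lborel. (deriv ^^ k) (dirichlet_L chi) (s + \<i> * of_real \<tau>)
                              / of_real (\<alpha>\<^sup>2 + (\<tau> - \<beta>)\<^sup>2))))"
proof (intro conjI impI)
  note avg = L_vertical_average[OF assms]
  show "integrable lborel (\<lambda>\<tau>. (deriv ^^ k) (dirichlet_L chi) (s + \<i> * of_real \<tau>) / of_real (\<alpha>\<^sup>2 + (\<tau> - \<beta>)\<^sup>2))"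
    "integrable lborel (\<lambda>\<tau>. (deriv ^^ k) (dirichlet_L chi) (s + \<i> * of_real \<tau>) / of_real (\<alpha>\<^sup>2 + (\<tau> - \<beta>)\<^sup>2))"
    by (rule avg)+
  show "AE x in lborel.
         (\<lambda>q. 1 / of_nat (ks q) *
              (\<Sum>j = 1..ks q. (deriv ^^ k) (dirichlet_L chi)
                 (s + \<i> * of_real ((boole_map \<alpha> \<beta> ^^ (ns q + j)) x))))
         \<longlonglongrightarrow> of_real (\<alpha> / pi) *
              (LINT \<tau>|lborel. (deriv ^^ k) (dirichlet_L chi) (s + \<i> * of_real \<tau>)
                              / of_real (\<alpha>\<^sup>2 + (\<tau> - \<beta>)\<^sup>2))"
    "AE x in lborel.
         (\<lambda>q. 1 / of_nat (ks q) *
              (\<Sum>j = 1..ks q. (deriv ^^ k) (dirichlet_L chi)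
                 (s + \<i> * of_real ((boole_map \<alpha> \<beta> ^^ (ns q + j)) x))))
         \<longlonglongrightarrow> of_real (\<alpha> / pi) *
              (LINT \<tau>|lborel. (deriv ^^ k) (dirichlet_L chi) (s + \<i> * of_real \<tau>)
                              / of_real (\<alpha>\<^sup>2 + (\<tau> - \<beta>)\<^sup>2))"
    by (rule avg)+
next
  assume np: "chi \<noteq> principal_character m"
  \<comment> \<open>Evaluating the integral needs holomorphy and the growth bound on the whole
    half-plane to the right of \<open>s\<close>, not only on the line; entireness for non-principal
    \<open>chi\<close> provides both.\<close>
  have "(deriv ^^ k) (dirichlet_L chi) holomorphic_on UNIV"
    by (intro holomorphic_higher_deriv dirichlet_L_entire[OF assms(2) np]) auto
  moreover obtain C e where "0 \<le> e" "e < 1"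
    "\<And>z. Re s \<le> Re z \<Longrightarrow> norm ((deriv ^^ k) (dirichlet_L chi) z) \<le> C * (1 + \<bar>Im z\<bar>) powr e"
    using dirichlet_L_deriv_growth_entire[OF assms(2) np assms(4), of k] by blast
  ultimately show "of_real (\<alpha> / pi) *
        (LINT \<tau>|lborel. (deriv ^^ k) (dirichlet_L chi) (s + \<i> * of_real \<tau>)
                        / of_real (\<alpha>\<^sup>2 + (\<tau> - \<beta>)\<^sup>2))
        = (deriv ^^ k) (dirichlet_L chi) (s + of_real \<alpha> + \<i> * of_real \<beta>)"
    by (intro poisson_half_plane[OF assms(1)])
qed

end
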